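(* Let $n\ge1$, $k>0$, let $f$ be a smooth function on $\mathbb{R}^{n+1}$ and, for $\lambda\in\mathbb{R}^{n+1}$, let $f_\lambda(\nu_1,\dots,\nu_n)=f\big(\nu_1,\dots,\nu_n,\sum_{i=1}^{n+1}\lambda_i-\sum_{i=1}^{n}\nu_i\big)$. Then for every $\lambda\in\mathfrak a^+$, $$V_k(f)(\lambda)=\frac{c_{n,k}}{\pi(\lambda)^{2k}}\int_{\lambda_{n+1}}^{\lambda_n}\cdots\int_{\lambda_2}^{\lambda_1}\sum_{w\in S_n}\epsilon(w)\,Q(\lambda,w\nu)\,\widetilde V_k(f_\lambda)(w\nu)\,W_k(\lambda,\nu)\,d\nu_1\cdots d\nu_n.$$
   Context: Root system $A_n$ on $\mathbb{R}^{n+1}$ (no normalization $\sum x_i=0$), constant multiplicity $k>0$, Dunkl operators $T_jf(\lambda)=\partial_{\lambda_j}f(\lambda)+k\sum_{i\neq j}\frac{f(\lambda)-f((i,j)\lambda)}{\lambda_j-\lambda_i}$, $(i,j)$ the transposition of coordinates. The intertwining operator $V_k$ is the unique linear operator on polynomials with $T_jV_k=V_k\partial_j$ for all $j$, $V_k$ preserving each space of homogeneous polynomials of degree $m$, and $V_k1=1$; it is given by $V_kf(\lambda)=\int f\,d\mu_\lambda$ for a (compactly supported) positive probability measure $\mu_\lambda$, which defines $V_kf$ for smooth $f$. $\widetilde V_k$ is the corresponding operator for $A_{n-1}$ on $\mathbb{R}^n$ with the same $k$ (for $n=1$, $\widetilde V_k$ is the identity). $\mathfrak a^+=\{\lambda:\lambda_1>\dots>\lambda_{n+1}\}$,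 $\pi(\lambda)=\prod_{i<j}(\lambda_i-\lambda_j)$, $c_{n,k}=\frac{(n+1)\Gamma((n+1)k)}{\Gamma(k)^{n+1}}$, $(w\nu)_i=\nu_{w(i)}$, $\epsilon(w)$ the sign, $Q(\lambda,\nu)=\prod_{r=1}^{n+1}\big[\prod_{s=r+1}^{n}(\lambda_r-\nu_s)\prod_{s=1}^{r-1}(\nu_s-\lambda_r)\big]$, $W_k(\lambda,\nu)=\Big(\prod_{r=1}^{n+1}\big[\prod_{s=r}^{n}(\lambda_r-\nu_s)\prod_{s=1}^{r-1}(\nu_s-\lambda_r)\big]\Big)^{k-1}$. *)

theory Defs
  imports "HOL-Probability.Probability" "HOL-Combinatorics.Permutations"
begin

text \<open>Points of R^m are represented as extensional functions on the index set {1..m}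
  (elements of PiE {1..m} (\<lambda>_. UNIV)); measures live on PiM {1..m} (\<lambda>_. lborel).\<close>

abbreviation Rsp :: "nat \<Rightarrow> (nat \<Rightarrow> real) set" where
  "Rsp m \<equiv> PiE {1..m} (\<lambda>_. (UNIV :: real set))"

abbreviation Rmeas :: "nat \<Rightarrow> (nat \<Rightarrow> real) measure" where
  "Rmeas m \<equiv> PiM {1..m} (\<lambda>_. lborel)"

definition pd :: "nat \<Rightarrow> ((nat \<Rightarrow> real) \<Rightarrow> real) \<Rightarrow> (nat \<Rightarrow> real) \<Rightarrow> real" where
  "pd j p x = deriv (\<lambda>t. p (x(j := t))) (x j)"

fun iter_pd :: "nat list \<Rightarrow> ((nat \<Rightarrow> real) \<Rightarrow> real) \<Rightarrow> (nat \<Rightarrow> real) \<Rightarrow> real" where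
  "iter_pd [] f = f"
| "iter_pd (j # js) f = pd j (iter_pd js f)"

definition smooth_coords :: "nat \<Rightarrow> ((nat \<Rightarrow> real) \<Rightarrow> real) \<Rightarrow> bool" where
  "smooth_coords m f \<longleftrightarrow>
     (\<forall>js. set js \<subseteq> {1..m} \<longrightarrow>
        continuous_on (Rsp m) (iter_pd js f) \<and>
        (\<forall>j\<in>{1..m}. \<forall>x\<in>Rsp m. (\<lambda>t. iter_pd js f (x(j := t))) differentiable (at (x j))))"

inductive_set poly_fun :: "nat \<Rightarrow> ((nat \<Rightarrow> real) \<Rightarrow> real) set" for m where
  pconst: "(\<lambda>_. c) \<in> poly_fun m"
| pvar: "i \<in> {1..m} \<Longrightarrow> (\<lambda>x. x i) \<in> poly_fun m"
| padd: "p \<in> poly_fun m \<Longrightarrow> q \<in> poly_fun m \<Longrightarrow> (\<lambda>x. p x + q x) \<in> poly_fun m"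
| pmult: "p \<in> poly_fun m \<Longrightarrow> q \<in> poly_fun m \<Longrightarrow> (\<lambda>x. p x * q x) \<in> poly_fun m"

definition hom_poly :: "nat \<Rightarrow> nat \<Rightarrow> ((nat \<Rightarrow> real) \<Rightarrow> real) \<Rightarrow> bool" where
  "hom_poly m d p \<longleftrightarrow> p \<in> poly_fun m \<and>
     (\<forall>t::real. \<forall>x\<in>Rsp m. p (restrict (\<lambda>i. t * x i) {1..m}) = t ^ d * p x)"

definition swapc :: "nat \<Rightarrow> nat \<Rightarrow> (nat \<Rightarrow> real) \<Rightarrow> nat \<Rightarrow> real" where
  "swapc i j x = (\<lambda>l. if l = i then x j else if l = j then x i else x l)"

definition dunkl_T :: "nat \<Rightarrow> real \<Rightarrow> nat \<Rightarrow> ((nat \<Rightarrow> real) \<Rightarrow> real) \<Rightarrow> (nat \<Rightarrow> real) \<Rightarrow> real" where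
  "dunkl_T m k j f x = pd j f x +
     k * (\<Sum>i\<in>{1..m} - {j}. (f x - f (swapc i j x)) / (x j - x i))"

text \<open>mu is the family of (compactly supported) probability measures representing the
  intertwining operator V_k of A_{m-1} on R^m: V_k p (x) = integral of p w.r.t. mu x,
  V_k maps homogeneous polynomials of degree d to homogeneous polynomials of degree d,
  V_k 1 = 1, and T_j V_k = V_k partial_j on polynomials (the identity of polynomials is
  required on the dense set of points with pairwise distinct coordinates, where T_j is
  given pointwise by its formula).\<close>
definition intertwining_measures ::
  "nat \<Rightarrow> real \<Rightarrow> ((nat \<Rightarrow> real) \<Rightarrow> (nat \<Rightarrow> real) measure) \<Rightarrow> bool" where
  "intertwining_measures m k \<mu> \<longleftrightarrow>
     (\<forall>x\<in>Rsp m. prob_space (\<mu> x) \<and> sets (\<mu> x) = sets (Rmeas m) \<and>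
        (\<exists>R. AE y in \<mu> x. \<forall>i\<in>{1..m}. \<bar>y i\<bar> \<le> R)) \<and>
     (\<forall>d p. hom_poly m d p \<longrightarrow>
        (\<exists>q. hom_poly m d q \<and>
             (\<forall>x\<in>Rsp m. (\<integral>y. p y \<partial>\<mu> x) = q x) \<and>
             (\<forall>j\<in>{1..m}. \<forall>x\<in>Rsp m. inj_on x {1..m} \<longrightarrow>
                 dunkl_T m k j q x = (\<integral>y. pd j p y \<partial>\<mu> x))))"

definition Vk :: "((nat \<Rightarrow> real) \<Rightarrow> (nat \<Rightarrow> real) measure) \<Rightarrow> ((nat \<Rightarrow> real) \<Rightarrow> real) \<Rightarrow> (nat \<Rightarrow> real) \<Rightarrow> real" where
  "Vk \<mu> f x = (\<integral>y. f y \<partial>\<mu> x)"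

definition f_lam :: "nat \<Rightarrow> ((nat \<Rightarrow> real) \<Rightarrow> real) \<Rightarrow> (nat \<Rightarrow> real) \<Rightarrow> (nat \<Rightarrow> real) \<Rightarrow> real" where
  "f_lam n f lam \<nu> = f (restrict (\<lambda>i. if i \<le> n then \<nu> i
        else (\<Sum>l\<in>{1..n+1}. lam l) - (\<Sum>l\<in>{1..n}. \<nu> l)) {1..n+1})"

definition c_nk :: "nat \<Rightarrow> real \<Rightarrow> real" where
  "c_nk n k = real (n + 1) * Gamma (real (n + 1) * k) / Gamma k ^ (n + 1)"

definition pi_A :: "nat \<Rightarrow> (nat \<Rightarrow> real) \<Rightarrow> real" where
  "pi_A n lam = (\<Prod>i\<in>{1..n+1}. \<Prod>j\<in>{i+1..n+1}. lam i - lam j)"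

definition Qf :: "nat \<Rightarrow> (nat \<Rightarrow> real) \<Rightarrow> (nat \<Rightarrow> real) \<Rightarrow> real" where
  "Qf n lam \<nu> = (\<Prod>r\<in>{1..n+1}. (\<Prod>s\<in>{r+1..n}. lam r - \<nu> s) * (\<Prod>s\<in>{1..r-1}. \<nu> s - lam r))"

definition Wf :: "nat \<Rightarrow> real \<Rightarrow> (nat \<Rightarrow> real) \<Rightarrow> (nat \<Rightarrow> real) \<Rightarrow> real" where
  "Wf n k lam \<nu> = (\<Prod>r\<in>{1..n+1}. (\<Prod>s\<in>{r..n}. lam r - \<nu> s) * (\<Prod>s\<in>{1..r-1}. \<nu> s - lam r)) powr (k - 1)"

definition box_dom :: "nat \<Rightarrow> (nat \<Rightarrow> real) \<Rightarrow> (nat \<Rightarrow> real) set" where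
  "box_dom n lam = {\<nu> \<in> Rsp n. \<forall>i\<in>{1..n}. lam (i + 1) \<le> \<nu> i \<and> \<nu> i \<le> lam i}"

end

theory Submission
  imports Defs
begin

text \<open>Restricted to a homogeneous polynomial of degree \<open>d\<close>, the intertwining relations imply the single
  Euler-type equation
  \<open>d V p (\<lambda>) + k \<Sum>\<^bsub>i<j\<^esub> (V p (\<lambda>) - V p ((i,j)\<lambda>)) = \<Sum>\<^sub>j \<lambda>\<^sub>j V (\<partial>\<^sub>j p) (\<lambda>)\<close>,
  and by the maximum principle on the orbit of \<open>\<lambda>\<close> it determines \<open>V\<close> by induction on \<open>d\<close>.
  The right-hand side \<open>A p\<close> of the theorem, extended to the orbit by
  \<open>A p (\<lambda> \<circ> \<sigma>) = sign \<sigma> \<integral> \<Sum>\<^sub>w sign w Q(\<lambda> \<circ> \<sigma>, w\<nu>) \<dots>\<close> with box and weight unchanged, satisfies the same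
  equation: integrate by parts in \<open>\<nu>\<close> (the boundary terms vanish because \<open>Q W\<^sub>k (\<lambda>\<^sub>s - \<nu>\<^sub>s)\<close> contains every
  factor \<open>\<lambda>\<^sub>r - \<nu>\<^sub>s\<close>), use the intertwining property of the lower-rank operator, and symmetrise over \<open>w\<close>; what
  remains is a rational identity for \<open>Q\<close>.

  It remains to see that \<open>A 1 = 1\<close>. By Cauchy's determinant this is a Dixon--Anderson integral with exponents
  \<open>s\<^sub>r\<close> attached to the nodes \<open>\<lambda>\<^sub>r\<close>. It is log-convex in each \<open>s\<^sub>r\<close>, integration by parts gives a first-order
  recursion for \<open>s\<^sub>r \<mapsto> s\<^sub>r + 1\<close>, and the Bohr--Mollerup theorem reduces it to \<open>s = 1\<close>.

  Only powers of linear forms are needed as test functions: their sums approximate exponentials, whose span is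
  dense in the continuous functions on cubes by Stone--Weierstrass.\<close>

section \<open>Polynomial functions\<close>

text \<open>The hypotheses speak about the measures only through polynomials, and the Dunkl
  equations only at points with distinct coordinates. Hence all is done on the orbit of one regular
  \<open>lam\<close>, where pairing the Dunkl operators with the coordinates cancels every
  denominator. In degree 0 the maximum principle says nothing; there the equation makes the orbit
  function harmonic for the transpositions, hence constant, so the normalisation is evaluated at the
  identity alone. That evaluation needs unequal exponents: antisymmetrising \<open>Qf\<close>
  leaves, besides Vandermonde products, the factors \<open>\<nu> s - lam (n+1)\<close>, which raise
  the exponent of the last node from k to k + 1. The constant \<open>c_nk\<close> is Gamma((n+1)k +
  1) / (Gamma(k)^n Gamma(k + 1)), simplified. For a power of a linear form, \<open>f_lam\<close> is
  a power of an affine form whose constant term is the same on the whole orbit, so the lower-rank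
  operator enters through its moments. The passage to continuous functions needs supports bounded
  uniformly over the box, while the hypothesis gives a radius for each point separately; moment
  bounds from the maximum principle close this gap.\<close>

declare sum.cl_ivl_Suc [simp del] prod.cl_ivl_Suc [simp del]

lemma poly_fun_sum [intro]:
  "(\<And>i. i \<in> I \<Longrightarrow> p i \<in> poly_fun m) \<Longrightarrow> (\<lambda>x. \<Sum>i\<in>I. p i x) \<in> poly_fun m"
  by (induction I rule: infinite_finite_induct) (auto intro: poly_fun.intros)

lemma poly_fun_prod [intro]:
  "(\<And>i. i \<in> I \<Longrightarrow> p i \<in> poly_fun m) \<Longrightarrow> (\<lambda>x. \<Prod>i\<in>I. p i x) \<in> poly_fun m"
  by (induction I rule: infinite_finite_induct) (auto intro: poly_fun.intros)

lemma poly_fun_diff [intro]: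
  assumes "p \<in> poly_fun m" "q \<in> poly_fun m"
  shows "(\<lambda>x. p x - q x) \<in> poly_fun m"
  using poly_fun.padd[OF assms(1) poly_fun.pmult[OF poly_fun.pconst[of "-1"] assms(2)]] by simp

lemma poly_fun_power [intro]: "p \<in> poly_fun m \<Longrightarrow> (\<lambda>x. p x ^ d) \<in> poly_fun m"
  by (induction d) (auto intro: poly_fun.intros)

lemma poly_fun_upd:
  assumes "p \<in> poly_fun m"
  shows "(\<lambda>x. p (x(u := c))) \<in> poly_fun m"
  using assms
proof induction
  case (pvar i)
  then show ?case by (cases "i = u") (auto intro: poly_fun.intros)
qed (auto intro: poly_fun.intros)

lemma poly_fun_permute:
  assumes "p \<in> poly_fun m" "w permutes {1..m}"
  shows "(\<lambda>x. p (x \<circ> w)) \<in> poly_fun m"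
  using assms(1)
proof induction
  case (pvar i)
  then have "w i \<in> {1..m}" using assms(2) permutes_in_image by metis
  then show ?case by (auto intro: poly_fun.intros)
qed (auto intro: poly_fun.intros)

lemma poly_fun_measurable:
  assumes "p \<in> poly_fun m"
  shows "p \<in> borel_measurable (Rmeas m)"
  using assms
proof induction
  case (pvar i)
  have "(\<lambda>x. x i) \<in> measurable (Rmeas m) lborel"
    using pvar by (rule measurable_component_singleton)
  then show ?case by simp
qed auto

lemma poly_fun_bounded:
  assumes "p \<in> poly_fun m"
  shows "\<exists>B\<ge>0. \<forall>x. (\<forall>i\<in>{1..m}. \<bar>x i\<bar> \<le> R) \<longrightarrow> \<bar>p x\<bar> \<le> B"
  using assms
proof induction
  case (pconst c)
  then show ?case by (auto intro!: exI[of _ "\<bar>c\<bar>"])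
next
  case (pvar i)
  then show ?case by (intro exI[of _ "\<bar>R\<bar>"]) fastforce
next
  case (padd p q)
  then obtain B C where "B \<ge> 0" "C \<ge> 0"
    and B: "\<And>x. (\<forall>i\<in>{1..m}. \<bar>x i\<bar> \<le> R) \<Longrightarrow> \<bar>p x\<bar> \<le> B"
    and C: "\<And>x. (\<forall>i\<in>{1..m}. \<bar>x i\<bar> \<le> R) \<Longrightarrow> \<bar>q x\<bar> \<le> C" by blast
  show ?case
  proof (intro exI[of _ "B + C"] conjI allI impI)
    fix x :: "nat \<Rightarrow> real" assume x: "\<forall>i\<in>{1..m}. \<bar>x i\<bar> \<le> R"
    show "\<bar>p x + q x\<bar> \<le> B + C" using B[OF x] C[OF x] by linarith
  qed (use \<open>B \<ge> 0\<close> \<open>C \<ge> 0\<close> in simp)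
next
  case (pmult p q)
  then obtain B C where "B \<ge> 0" "C \<ge> 0"
    and B: "\<And>x. (\<forall>i\<in>{1..m}. \<bar>x i\<bar> \<le> R) \<Longrightarrow> \<bar>p x\<bar> \<le> B"
    and C: "\<And>x. (\<forall>i\<in>{1..m}. \<bar>x i\<bar> \<le> R) \<Longrightarrow> \<bar>q x\<bar> \<le> C" by blast
  show ?case
  proof (intro exI[of _ "B * C"] conjI allI impI)
    fix x :: "nat \<Rightarrow> real" assume x: "\<forall>i\<in>{1..m}. \<bar>x i\<bar> \<le> R"
    show "\<bar>p x * q x\<bar> \<le> B * C"
      using B[OF x] C[OF x] \<open>B \<ge> 0\<close> by (simp add: abs_mult mult_mono)
  qed (use \<open>B \<ge> 0\<close> \<open>C \<ge> 0\<close> in simp)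
qed

text \<open>\<open>pd\<close> is \<open>deriv\<close> of a slice, which computes nothing before
  differentiability is known. The induction therefore produces some polynomial derivative, for any
  index \<open>u\<close>; it is identified with \<open>pd\<close> afterwards.\<close>

lemma poly_fun_has_derivative_ex:
  assumes "p \<in> poly_fun m"
  shows "\<exists>p'\<in>poly_fun m. \<forall>x t. ((\<lambda>t. p (x(u := t))) has_real_derivative p' (x(u := t))) (at t)"
  using assms
proof induction
  case (pconst c)
  then show ?case by (intro bexI[of _ "\<lambda>_. 0"]) (auto intro: poly_fun.intros)
next
  case (pvar i)
  show ?case
  proof (cases "i = u")
    case True
    then show ?thesis by (intro bexI[of _ "\<lambda>_. 1"]) (auto intro: poly_fun.intros)
  next
    case False
    then show ?thesis by (intro bexI[of _ "\<lambda>_. 0"]) (auto intro: poly_fun.intros)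
  qed
next
  case (padd p q)
  then obtain p' q' where p': "p' \<in> poly_fun m" "q' \<in> poly_fun m"
    "\<And>x t. ((\<lambda>t. p (x(u := t))) has_real_derivative p' (x(u := t))) (at t)"
    "\<And>x t. ((\<lambda>t. q (x(u := t))) has_real_derivative q' (x(u := t))) (at t)" by blast
  show ?case
  proof (intro bexI[of _ "\<lambda>x. p' x + q' x"] allI)
    fix x t
    show "((\<lambda>t. p (x(u := t)) + q (x(u := t))) has_real_derivative
       p' (x(u := t)) + q' (x(u := t))) (at t)"
      by (rule DERIV_add[OF p'(3,4)])
  qed (use p'(1,2) in \<open>auto intro: poly_fun.intros\<close>)
next
  case (pmult p q)
  then obtain p' q' where p': "p' \<in> poly_fun m" "q' \<in> poly_fun m"
    "\<And>x t. ((\<lambda>t. p (x(u := t))) has_real_derivative p' (x(u := t))) (at t)"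
    "\<And>x t. ((\<lambda>t. q (x(u := t))) has_real_derivative q' (x(u := t))) (at t)" by blast
  show ?case
  proof (intro bexI[of _ "\<lambda>x. p' x * q x + q' x * p x"] allI)
    fix x t
    show "((\<lambda>t. p (x(u := t)) * q (x(u := t))) has_real_derivative
       p' (x(u := t)) * q (x(u := t)) + q' (x(u := t)) * p (x(u := t))) (at t)"
      by (rule DERIV_mult[OF p'(3,4)])
  qed (use p'(1,2) pmult in \<open>auto intro: poly_fun.intros\<close>)
qed

lemma
  assumes "p \<in> poly_fun m"
  shows poly_fun_pd: "pd u p \<in> poly_fun m"
    and poly_fun_has_derivative:
      "((\<lambda>t. p (x(u := t))) has_real_derivative pd u p (x(u := t))) (at t)"
proof -
  obtain p' where p': "p' \<in> poly_fun m"
    "\<And>x t. ((\<lambda>t. p (x(u := t))) has_real_derivative p' (x(u := t))) (at t)"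
    using poly_fun_has_derivative_ex[OF assms] by blast
  have "pd u p = p'"
    unfolding pd_def using DERIV_imp_deriv[OF p'(2)] by fastforce
  with p' show "pd u p \<in> poly_fun m"
    "((\<lambda>t. p (x(u := t))) has_real_derivative pd u p (x(u := t))) (at t)" by auto
qed

section \<open>Beta weights and signed powers on an interval\<close>

lemma powr_integrable_left:
  fixes a b p :: real
  assumes "a < b" "p > 0"
  shows "set_integrable lborel {a<..<b} (\<lambda>t. (t - a) powr (p - 1))"
proof -
  have "set_integrable lborel (einterval (ereal a) (ereal b)) (\<lambda>t. (t - a) powr (p - 1))"
  proof (rule interval_integral_FTC_nonneg(1))
    show "((\<lambda>t. (t - a) powr p / p) has_real_derivative (x - a) powr (p - 1)) (at x)"
      if "ereal a < ereal x" for x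
      using that assms(2) by (auto intro!: derivative_eq_intros simp: powr_diff)
    show "isCont (\<lambda>t. (t - a) powr (p - 1)) x" if "ereal a < ereal x" for x
      using that by (auto intro!: continuous_intros)
    show "(((\<lambda>t. (t - a) powr p / p) \<circ> real_of_ereal) \<longlongrightarrow> (a - a) powr p / p) (at_right (ereal a))"
      unfolding ereal_tendsto_simps using assms
      by (intro tendsto_eq_intros) (auto intro: eventually_mono[OF eventually_at_right_less])
    show "(((\<lambda>t. (t - a) powr p / p) \<circ> real_of_ereal) \<longlongrightarrow> (b - a) powr p / p) (at_left (ereal b))"
      unfolding ereal_tendsto_simps using assms by (intro tendsto_eq_intros) auto
  qed (use assms in auto)
  then show ?thesis by simp
qed

lemma set_integrable_reflect:
  fixes f :: "real \<Rightarrow> real"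
  assumes "set_integrable lborel {a<..<b} (\<lambda>t. f (a + b - t))"
  shows "set_integrable lborel {a<..<b} f"
proof -
  have "integrable lborel (\<lambda>x. indicator {a<..<b} x * f (a + b - x))"
    using assms by (simp add: set_integrable_def)
  then have "integrable lborel (\<lambda>x. indicator {a<..<b} ((a + b) + (-1) * x) * f (a + b - ((a + b) + (-1) * x)))"
    by (rule lborel_integrable_real_affine) simp
  moreover have "indicator {a<..<b} ((a + b) + (-1) * x) * f (a + b - ((a + b) + (-1) * x))
      = indicator {a<..<b} x * f x" for x :: real
    by (auto simp: indicator_def)
  ultimately show ?thesis by (simp only: set_integrable_def real_scaleR_def)
qed

lemma beta_integrable:
  fixes a b p q :: real
  assumes "a < b" "p > 0" "q > 0"
  shows "set_integrable lborel {a<..<b} (\<lambda>t. (t - a) powr (p - 1) * (b - t) powr (q - 1))"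
proof -
  have R: "set_integrable lborel {a<..<b} (\<lambda>t. (b - t) powr (q - 1))"
  proof (rule set_integrable_reflect)
    have "(\<lambda>t. (b - (a + b - t)) powr (q - 1)) = (\<lambda>t. (t - a) powr (q - 1))"
      by (simp add: fun_eq_iff)
    then show "set_integrable lborel {a<..<b} (\<lambda>t. (b - (a + b - t)) powr (q - 1))"
      using powr_integrable_left[OF assms(1,3)] by (simp only:)
  qed
  have *: "set_integrable lborel {a<..<b} (\<lambda>t. (b - a) powr p / (b - a) * (b - t) powr (q - 1)
        + (b - a) powr q / (b - a) * (t - a) powr (p - 1))"
    using powr_integrable_left[OF assms(1,2)] R
    by (intro set_integral_add(1) set_integrable_mult_right) auto
  show ?thesis
  proof (rule set_integrable_bound[OF *])
    show "set_borel_measurable lborel {a<..<b} (\<lambda>t. (t - a) powr (p - 1) * (b - t) powr (q - 1))"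
      unfolding set_borel_measurable_def by measurable
    show "AE x in lborel. x \<in> {a<..<b} \<longrightarrow>
      norm ((x - a) powr (p - 1) * (b - x) powr (q - 1))
      \<le> norm ((b - a) powr p / (b - a) * (b - x) powr (q - 1) + (b - a) powr q / (b - a) * (x - a) powr (p - 1))"
    proof (intro AE_I2 impI)
      fix x assume x: "x \<in> {a<..<b}"
      have "(x - a) powr (p - 1) * (b - x) powr (q - 1) * (b - a)
          = (x - a) powr p * (b - x) powr (q - 1) + (x - a) powr (p - 1) * (b - x) powr q"
        using x by (simp add: powr_diff field_simps)
      also have "\<dots> \<le> (b - a) powr p * (b - x) powr (q - 1) + (b - a) powr q * (x - a) powr (p - 1)"
        using x assms powr_mono2[of p "x - a" "b - a"] powr_mono2[of q "b - x" "b - a"]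
        by (intro add_mono) (auto simp: mult_right_mono mult.commute[of "(x - a) powr (p - 1)"])
      finally have "(x - a) powr (p - 1) * (b - x) powr (q - 1) \<le>
          ((b - a) powr p * (b - x) powr (q - 1) + (b - a) powr q * (x - a) powr (p - 1)) / (b - a)"
        using assms by (subst pos_le_divide_eq) auto
      then show "norm ((x - a) powr (p - 1) * (b - x) powr (q - 1))
      \<le> norm ((b - a) powr p / (b - a) * (b - x) powr (q - 1) + (b - a) powr q / (b - a) * (x - a) powr (p - 1))"
        using assms by (simp add: add_divide_distrib)
    qed
  qed
qed

text \<open>The function is sign(t - c) |t - c|^s, the factor produced when a weight is multiplied
  by the node polynomial. In this form the derivative has the same expression on both sides of
  c.\<close>

lemma abs_powr_times_deriv:
  fixes s c x :: real
  assumes "x \<noteq> c"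
  shows "((\<lambda>t. \<bar>t - c\<bar> powr (s - 1) * (t - c)) has_real_derivative s * \<bar>x - c\<bar> powr (s - 1)) (at x)"
proof (cases "x > c")
  case True
  have "((\<lambda>t. (t - c) powr s) has_real_derivative s * (x - c) powr (s - 1)) (at x)"
    using True by (auto intro!: derivative_eq_intros)
  then have "((\<lambda>t. \<bar>t - c\<bar> powr (s - 1) * (t - c)) has_real_derivative s * (x - c) powr (s - 1)) (at x)"
    by (rule has_field_derivative_transform_within_open[where S = "{c<..}"])
      (use True in \<open>auto simp: powr_diff\<close>)
  then show ?thesis using True by simp
next
  case False
  then have "x < c" using assms by simp
  have "((\<lambda>t. - ((c - t) powr s)) has_real_derivative s * (c - x) powr (s - 1)) (at x)"
    using \<open>x < c\<close> by (auto intro!: derivative_eq_intros)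
  then have "((\<lambda>t. \<bar>t - c\<bar> powr (s - 1) * (t - c)) has_real_derivative s * (c - x) powr (s - 1)) (at x)"
    by (rule has_field_derivative_transform_within_open[where S = "{..<c}"])
      (use \<open>x < c\<close> in \<open>auto simp: powr_diff field_simps\<close>)
  then show ?thesis using \<open>x < c\<close> by simp
qed

text \<open>Only the point c is critical; there the modulus is |t - c|^s, which tends to zero
  because s > 0. This is what later makes boundary terms vanish.\<close>

lemma abs_powr_times_cont:
  fixes s c :: real
  assumes "s > 0"
  shows "isCont (\<lambda>t. \<bar>t - c\<bar> powr (s - 1) * (t - c)) x"
proof (cases "x = c")
  case True
  have "((\<lambda>t. \<bar>t - c\<bar> powr s) \<longlongrightarrow> \<bar>c - c\<bar> powr s) (at c)"
    using assms by (intro tendsto_intros) auto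
  then have lim: "((\<lambda>t. \<bar>t - c\<bar> powr s) \<longlongrightarrow> 0) (at c)" using assms by simp
  have "((\<lambda>t. \<bar>t - c\<bar> powr (s - 1) * (t - c)) \<longlongrightarrow> 0) (at c)"
  proof (rule Lim_null_comparison[OF _ lim])
    have "norm (\<bar>t - c\<bar> powr (s - 1) * (t - c)) \<le> \<bar>t - c\<bar> powr s" for t
      by (cases "t = c") (auto simp: abs_mult powr_diff)
    then show "\<forall>\<^sub>F x in at c. norm (\<bar>x - c\<bar> powr (s - 1) * (x - c)) \<le> \<bar>x - c\<bar> powr s"
      by simp
  qed
  then show ?thesis by (simp add: True isCont_def)
next
  case False
  then show ?thesis using DERIV_isCont[OF abs_powr_times_deriv] by auto
qed

section \<open>Product weights on the interlacing box and integration by parts\<close>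

definition pnod :: "nat \<Rightarrow> (nat \<Rightarrow> real) \<Rightarrow> real \<Rightarrow> real" where
  "pnod m x t = (\<Prod>r\<in>{1..m}. t - x r)"

text \<open>The numerator of a Lagrange basis polynomial. Deleting the factor by its index, instead
  of dividing \<open>pnod\<close> by it, keeps the value meaningful at the node itself.\<close>

definition enod :: "nat \<Rightarrow> (nat \<Rightarrow> real) \<Rightarrow> nat \<Rightarrow> real \<Rightarrow> real" where
  "enod m x r t = (\<Prod>a\<in>{1..m}-{r}. t - x a)"

text \<open>The rank \<open>n = 0\<close> is allowed: the induction in \<open>DA_one_eq\<close>
  starts there.\<close>

locale chamber =
  fixes n :: nat and lam :: "nat \<Rightarrow> real"
  assumes dec: "i \<in> {1..n} \<Longrightarrow> lam (i + 1) < lam i"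
begin

lemma lam_less:
  assumes "1 \<le> i" "i < j" "j \<le> n + 1"
  shows "lam j < lam i"
  using assms(2,3)
proof (induction j)
  case (Suc j)
  have "lam (j + 1) < lam j" using Suc.prems assms(1) by (intro dec) auto
  then show ?case using Suc by (cases "i = j") auto
qed simp

lemma lam_le: "1 \<le> i \<Longrightarrow> i \<le> j \<Longrightarrow> j \<le> n + 1 \<Longrightarrow> lam j \<le> lam i"
  using lam_less[of i j] by (cases "i = j") auto

lemma lam_inj: "inj_on lam {1..n+1}"
  by (rule linorder_inj_onI) (use lam_less in fastforce)+

text \<open>Open cells avoid all nodes and are pairwise disjoint, so inside the box every factor of
  the weight is positive and the coordinates are distinct.\<close>

definition cell :: "nat \<Rightarrow> real set" where
  "cell u = {lam (u + 1)<..<lam u}"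

text \<open>The indicator is built into \<open>wt\<close>, so that integrals over the interlacing box are integrals
  over the whole space; general exponents \<open>s\<close> are needed for the normalisation constant only.\<close>
definition wt1 :: "(nat \<Rightarrow> real) \<Rightarrow> real \<Rightarrow> real" where
  "wt1 s t = (\<Prod>r\<in>{1..n+1}. \<bar>t - lam r\<bar> powr (s r - 1))"

definition wt :: "(nat \<Rightarrow> real) \<Rightarrow> (nat \<Rightarrow> real) \<Rightarrow> real" where
  "wt s \<nu> = (\<Prod>u\<in>{1..n}. indicator (cell u) (\<nu> u) * wt1 s (\<nu> u))"

lemma cell_cases:
  assumes "u \<in> {1..n}" "t \<in> cell u" "r \<in> {1..n+1}"
  shows "r \<le> u \<Longrightarrow> t < lam r" and "u < r \<Longrightarrow> lam r < t"
  using assms lam_le[of r u] lam_le[of "u + 1" r] by (auto simp: cell_def)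

lemma cell_neq: "u \<in> {1..n} \<Longrightarrow> t \<in> cell u \<Longrightarrow> r \<in> {1..n+1} \<Longrightarrow> t \<noteq> lam r"
  using cell_cases[of u t r] by (cases "r \<le> u") auto

lemma wt1_pos: "u \<in> {1..n} \<Longrightarrow> t \<in> cell u \<Longrightarrow> wt1 s t > 0"
  unfolding wt1_def using cell_neq by (intro prod_pos) auto

lemma wt1_nonneg: "wt1 s t \<ge> 0"
  unfolding wt1_def by (intro prod_nonneg) auto

lemma wt_nonneg: "wt s \<nu> \<ge> 0"
  unfolding wt_def by (intro prod_nonneg) (auto simp: wt1_nonneg)

lemma wt_pos: "(\<And>u. u \<in> {1..n} \<Longrightarrow> \<nu> u \<in> cell u) \<Longrightarrow> wt s \<nu> > 0"
  unfolding wt_def using wt1_pos by (intro prod_pos) auto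

lemma wt_zero: "u \<in> {1..n} \<Longrightarrow> \<nu> u \<notin> cell u \<Longrightarrow> wt s \<nu> = 0"
  unfolding wt_def by (rule prod_zero) (auto intro!: bexI[of _ u])

lemma wt1_measurable [measurable]: "wt1 s \<in> borel_measurable borel"
  unfolding wt1_def by measurable

lemma cell_borel [measurable]: "cell u \<in> sets borel"
  unfolding cell_def by simp

text \<open>On a closed cell only the two end nodes can be singular. The factors of all other nodes
  are continuous there, hence bounded, and what remains is a beta weight.\<close>

lemma wt1_integrable:
  assumes u: "u \<in> {1..n}" and s: "\<And>r. r \<in> {1..n+1} \<Longrightarrow> s r > 0"
  shows "integrable lborel (\<lambda>t. indicator (cell u) t * wt1 s t)"
proof -
  let ?I = "{1..n+1} - {u, u+1}"
  let ?g = "\<lambda>t. \<Prod>r\<in>?I. \<bar>t - lam r\<bar> powr (s r - 1)"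
  let ?b = "\<lambda>t. (t - lam (u+1)) powr (s (u+1) - 1) * (lam u - t) powr (s u - 1)"
  have ab: "lam (u+1) < lam u" using u by (rule dec)
  have "t \<noteq> lam r" if "t \<in> {lam (u+1)..lam u}" "r \<in> ?I" for t r
    using that u lam_less[of r u] lam_less[of "u+1" r] by (cases "r < u") auto
  then have "continuous_on {lam (u+1)..lam u} ?g"
    by (auto intro!: continuous_intros)
  then have "bounded (?g ` {lam (u+1)..lam u})"
    by (intro compact_imp_bounded compact_continuous_image) auto
  then obtain B where "\<forall>x\<in>?g ` {lam (u+1)..lam u}. norm x \<le> B"
    unfolding bounded_iff by blast
  then have B: "\<bar>?g t\<bar> \<le> B" if "t \<in> {lam (u+1)..lam u}" for t
    using that by (metis (no_types, lifting) image_eqI real_norm_def)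
  have eq: "wt1 s t = ?g t * ?b t" if "t \<in> cell u" for t
  proof -
    have "wt1 s t = (\<Prod>r\<in>insert u (insert (u+1) ?I). \<bar>t - lam r\<bar> powr (s r - 1))"
      unfolding wt1_def using u by (intro prod.cong) auto
    also have "\<dots> = \<bar>t - lam u\<bar> powr (s u - 1) * (\<bar>t - lam (u+1)\<bar> powr (s (u+1) - 1) * ?g t)"
      by simp
    finally show ?thesis using that by (simp add: cell_def)
  qed
  have "set_integrable lborel (cell u) (\<lambda>t. B * ?b t)"
    unfolding cell_def using beta_integrable[OF ab] s u by (intro set_integrable_mult_right) auto
  then have "set_integrable lborel (cell u) (wt1 s)"
  proof (rule set_integrable_bound)
    show "set_borel_measurable lborel (cell u) (wt1 s)"
      unfolding set_borel_measurable_def by measurable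
    have "norm (wt1 s t) \<le> norm (B * ?b t)" if "t \<in> cell u" for t
    proof -
      have "\<bar>?g t\<bar> \<le> \<bar>B\<bar>" using B[of t] that by (auto simp: cell_def)
      then show ?thesis unfolding eq[OF that] by (simp add: abs_mult mult_right_mono)
    qed
    then show "AE x in lborel. x \<in> cell u \<longrightarrow> norm (wt1 s x) \<le> norm (B * ?b x)" by auto
  qed
  then show ?thesis by (simp add: set_integrable_def)
qed

sublocale lb: product_sigma_finite "\<lambda>_::nat. lborel :: real measure" ..

lemma wt_integrable:
  assumes "\<And>r. r \<in> {1..n+1} \<Longrightarrow> s r > 0"
  shows "integrable (Rmeas n) (wt s)"
  unfolding wt_def using wt1_integrable[of _ s] assms
  by (intro lb.product_integrable_prod) auto

definition Rad :: real where "Rad = (\<Sum>r\<in>{1..n+1}. \<bar>lam r\<bar>)"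

lemma lam_Rad: "r \<in> {1..n+1} \<Longrightarrow> \<bar>lam r\<bar> \<le> Rad"
  unfolding Rad_def by (intro member_le_sum) auto

lemma cell_Rad: "u \<in> {1..n} \<Longrightarrow> t \<in> cell u \<Longrightarrow> \<bar>t\<bar> \<le> Rad"
  using lam_Rad[of u] lam_Rad[of "u+1"] by (auto simp: cell_def)

lemma wt_bounded_integrable:
  assumes "\<And>r. r \<in> {1..n+1} \<Longrightarrow> s r > 0"
    and "g \<in> borel_measurable (Rmeas n)"
    and B: "\<And>\<nu>. (\<And>u. u \<in> {1..n} \<Longrightarrow> \<nu> u \<in> cell u) \<Longrightarrow> \<bar>g \<nu>\<bar> \<le> B"
  shows "integrable (Rmeas n) (\<lambda>\<nu>. wt s \<nu> * g \<nu>)"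
proof (rule Bochner_Integration.integrable_bound)
  show "integrable (Rmeas n) (\<lambda>\<nu>. \<bar>B\<bar> * wt s \<nu>)"
    using wt_integrable assms(1) by (intro integrable_mult_right) auto
  show "(\<lambda>\<nu>. wt s \<nu> * g \<nu>) \<in> borel_measurable (Rmeas n)"
    using wt_integrable[of s] assms(1,2) by (intro borel_measurable_times) auto
  have "norm (wt s \<nu> * g \<nu>) \<le> norm (\<bar>B\<bar> * wt s \<nu>)" for \<nu>
  proof (cases "\<forall>u\<in>{1..n}. \<nu> u \<in> cell u")
    case True
    then have "\<bar>g \<nu>\<bar> \<le> \<bar>B\<bar>" using B[of \<nu>] by auto
    then show ?thesis using wt_nonneg[of s \<nu>] by (simp add: abs_mult mult.commute mult_right_mono)
  next
    case False
    then show ?thesis using wt_zero by auto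
  qed
  then show "AE x in Rmeas n. norm (wt s x * g x) \<le> norm (\<bar>B\<bar> * wt s x)" by auto
qed

lemma wt_poly_integrable:
  assumes "\<And>r. r \<in> {1..n+1} \<Longrightarrow> s r > 0" and "g \<in> poly_fun n"
  shows "integrable (Rmeas n) (\<lambda>\<nu>. wt s \<nu> * g \<nu>)"
proof -
  obtain B where "\<And>x. (\<forall>i\<in>{1..n}. \<bar>x i\<bar> \<le> Rad) \<Longrightarrow> \<bar>g x\<bar> \<le> B"
    using poly_fun_bounded[OF assms(2)] by blast
  then show ?thesis
    using assms poly_fun_measurable cell_Rad by (intro wt_bounded_integrable[where B = B]) auto
qed

text \<open>Multiplication by \<open>pnod\<close> raises the exponent at each node to
  \<open>s r\<close> and clears the poles of the logarithmic derivative: the summand s_r / (t -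
  lam_r) becomes \<open>s r\<close> times \<open>enod\<close>.\<close>

lemma wt1_pnod_deriv:
  assumes "u \<in> {1..n}" "t \<in> cell u"
  shows "((\<lambda>t. wt1 s t * pnod (n+1) lam t) has_real_derivative wt1 s t * (\<Sum>r\<in>{1..n+1}. s r * enod (n+1) lam r t)) (at t)"
proof -
  have eq: "wt1 s t * pnod (n+1) lam t = (\<Prod>r\<in>{1..n+1}. \<bar>t - lam r\<bar> powr (s r - 1) * (t - lam r))" for t
    by (simp only: wt1_def pnod_def prod.distrib)
  have "((\<lambda>t. \<Prod>r\<in>{1..n+1}. \<bar>t - lam r\<bar> powr (s r - 1) * (t - lam r)) has_real_derivative
     (\<Sum>r\<in>{1..n+1}. s r * \<bar>t - lam r\<bar> powr (s r - 1) *
        (\<Prod>a\<in>{1..n+1}-{r}. \<bar>t - lam a\<bar> powr (s a - 1) * (t - lam a)))) (at t)"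
    using assms cell_neq by (intro has_field_derivative_prod abs_powr_times_deriv) auto
  moreover have "s r * \<bar>t - lam r\<bar> powr (s r - 1) *
        (\<Prod>a\<in>{1..n+1}-{r}. \<bar>t - lam a\<bar> powr (s a - 1) * (t - lam a)) = wt1 s t * (s r * enod (n+1) lam r t)"
    if "r \<in> {1..n+1}" for r
  proof -
    have "wt1 s t = \<bar>t - lam r\<bar> powr (s r - 1) * (\<Prod>a\<in>{1..n+1}-{r}. \<bar>t - lam a\<bar> powr (s a - 1))"
      unfolding wt1_def using that by (intro prod.remove) auto
    then show ?thesis by (simp only: enod_def prod.distrib mult_ac)
  qed
  then have "(\<Sum>r\<in>{1..n+1}. s r * \<bar>t - lam r\<bar> powr (s r - 1) *
        (\<Prod>a\<in>{1..n+1}-{r}. \<bar>t - lam a\<bar> powr (s a - 1) * (t - lam a))) = wt1 s t * (\<Sum>r\<in>{1..n+1}. s r * enod (n+1) lam r t)"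
    unfolding sum_distrib_left by (intro sum.cong) auto
  ultimately show ?thesis
    unfolding eq by metis
qed

text \<open>The fundamental theorem for \<open>wt1\<close> times \<open>pnod\<close> times
  \<open>h\<close>. The exponent at each node is the positive number \<open>s r\<close>, so this
  function extends continuously by zero to both ends of the cell.\<close>

lemma wt1_by_parts:
  fixes h h' :: "real \<Rightarrow> real"
  assumes u: "u \<in> {1..n}" and s: "\<And>r. r \<in> {1..n+1} \<Longrightarrow> s r > 0"
    and h: "\<And>t. (h has_real_derivative h' t) (at t)" and h': "\<And>t. isCont h' t"
  shows "(\<integral>t. indicator (cell u) t * wt1 s t * (pnod (n+1) lam t * h' t + h t * (\<Sum>r\<in>{1..n+1}. s r * enod (n+1) lam r t)) \<partial>lborel) = 0"
proof -
  let ?a = "lam (u+1)" and ?b = "lam u"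
  define k where "k = (\<lambda>t. pnod (n+1) lam t * h' t + h t * (\<Sum>r\<in>{1..n+1}. s r * enod (n+1) lam r t))"
  let ?f = "\<lambda>t. wt1 s t * k t"
  let ?F = "\<lambda>t. wt1 s t * pnod (n+1) lam t * h t"
  have ab: "?a < ?b" using u by (rule dec)
  have hc: "isCont h t" for t using h DERIV_isCont by blast
  have kc: "isCont k t" for t
    unfolding k_def pnod_def enod_def
    by (intro continuous_add continuous_mult continuous_sum continuous_prod continuous_diff
          continuous_const continuous_ident hc h')
  \<comment> \<open>Continuity is needed at the nodes as well, because the end points of the cell
    are nodes.\<close>
  have Fc: "isCont ?F t" for t
  proof -
    have "isCont (\<lambda>t. \<Prod>r\<in>{1..n+1}. \<bar>t - lam r\<bar> powr (s r - 1) * (t - lam r)) t"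
      using s abs_powr_times_cont by (intro continuous_prod) auto
    then have "isCont (\<lambda>t. wt1 s t * pnod (n+1) lam t) t" by (simp only: wt1_def pnod_def prod.distrib)
    then show ?thesis using hc by (rule continuous_mult)
  qed
  have p0: "pnod (n+1) lam ?a = 0" "pnod (n+1) lam ?b = 0"
    unfolding pnod_def using u
    by (auto intro!: prod_zero intro: bexI[of _ u] bexI[of _ "u + 1"])
  have "bounded (k ` {?a..?b})"
    by (intro compact_imp_bounded compact_continuous_image continuous_at_imp_continuous_on ballI kc compact_Icc)
  then obtain B where "\<forall>x\<in>k ` {?a..?b}. norm x \<le> B"
    unfolding bounded_iff by blast
  then have B: "\<bar>k t\<bar> \<le> B" if "t \<in> {?a..?b}" for t
    using that by simp
  have km: "k \<in> borel_measurable borel"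
    by (intro borel_measurable_continuous_onI continuous_at_imp_continuous_on ballI kc)
  have int: "integrable lborel (\<lambda>t. indicator (cell u) t * wt1 s t * k t)"
  proof (rule Bochner_Integration.integrable_bound)
    show "integrable lborel (\<lambda>t. \<bar>B\<bar> * (indicator (cell u) t * wt1 s t))"
      using wt1_integrable[OF u] s by (intro integrable_mult_right) auto
    show "(\<lambda>t. indicator (cell u) t * wt1 s t * k t) \<in> borel_measurable lborel"
      using km by measurable
    have "norm (indicator (cell u) t * wt1 s t * k t) \<le> norm (\<bar>B\<bar> * (indicator (cell u) t * wt1 s t))" for t
    proof (cases "t \<in> cell u")
      case True
      then have "\<bar>k t\<bar> \<le> \<bar>B\<bar>" using B[of t] by (auto simp: cell_def)
      then show ?thesis using True wt1_nonneg[of s t] by (simp add: abs_mult mult.commute mult_right_mono)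
    qed simp
    then show "AE x in lborel. norm (indicator (cell u) x * wt1 s x * k x) \<le> norm (\<bar>B\<bar> * (indicator (cell u) x * wt1 s x))"
      by auto
  qed
  have "(LBINT t=ereal ?a..ereal ?b. ?f t) = ?F ?b - ?F ?a"
  proof (rule interval_integral_FTC_integrable)
    fix x assume "ereal ?a < ereal x" "ereal x < ereal ?b"
    then have x: "x \<in> cell u" by (simp add: cell_def)
    have "(?F has_real_derivative wt1 s x * pnod (n+1) lam x * h' x + wt1 s x * (\<Sum>r\<in>{1..n+1}. s r * enod (n+1) lam r x) * h x) (at x)"
      by (rule DERIV_mult'[OF wt1_pnod_deriv[OF u x] h])
    also have "wt1 s x * pnod (n+1) lam x * h' x + wt1 s x * (\<Sum>r\<in>{1..n+1}. s r * enod (n+1) lam r x) * h x = ?f x"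
      by (simp add: k_def algebra_simps)
    finally show "(?F has_vector_derivative ?f x) (at x)"
      by (simp add: has_real_derivative_iff_has_vector_derivative)
    have "isCont (wt1 s) x"
      unfolding wt1_def using cell_neq[OF u x] by (intro continuous_intros) auto
    then show "isCont ?f x" using kc by (rule continuous_mult)
  next
    show "set_integrable lborel (einterval (ereal ?a) (ereal ?b)) ?f"
      using int by (simp add: set_integrable_def cell_def mult.assoc)
    show "((?F \<circ> real_of_ereal) \<longlongrightarrow> ?F ?a) (at_right (ereal ?a))"
      unfolding ereal_tendsto_simps using Fc by (auto simp: isCont_def intro: filterlim_mono at_le)
    show "((?F \<circ> real_of_ereal) \<longlongrightarrow> ?F ?b) (at_left (ereal ?b))"
      unfolding ereal_tendsto_simps using Fc by (auto simp: isCont_def intro: filterlim_mono at_le)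
  qed (use ab in simp)
  also have "\<dots> = 0" by (simp only: p0 mult_zero_right mult_zero_left diff_self)
  finally show ?thesis
    using ab by (simp add: k_def interval_lebesgue_integral_def set_lebesgue_integral_def cell_def mult.assoc)
qed

text \<open>The weight is a product over the coordinates, so Fubini freezes all the others and
  leaves \<open>wt1_by_parts\<close> in coordinate \<open>u\<close>.\<close>

lemma wt_by_parts:
  assumes u: "u \<in> {1..n}" and s: "\<And>r. r \<in> {1..n+1} \<Longrightarrow> s r > 0" and H: "H \<in> poly_fun n"
  shows "(\<integral>\<nu>. wt s \<nu> * (pnod (n+1) lam (\<nu> u) * pd u H \<nu> + H \<nu> * (\<Sum>r\<in>{1..n+1}. s r * enod (n+1) lam r (\<nu> u))) \<partial>Rmeas n) = 0"
proof -
  let ?I = "{1..n} - {u}"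
  let ?G = "\<lambda>\<nu>. pnod (n+1) lam (\<nu> u) * pd u H \<nu> + H \<nu> * (\<Sum>r\<in>{1..n+1}. s r * enod (n+1) lam r (\<nu> u))"
  have G: "?G \<in> poly_fun n"
    unfolding pnod_def enod_def using H u poly_fun_pd
    by (intro poly_fun.padd poly_fun.pmult poly_fun_sum poly_fun_prod poly_fun_diff poly_fun.pconst poly_fun.pvar) auto
  have ins: "{1..n} = insert u ?I" using u by auto
  have int: "integrable (Rmeas n) (\<lambda>\<nu>. wt s \<nu> * ?G \<nu>)"
    using s G by (rule wt_poly_integrable)
  have inner: "(\<integral>t. wt s (\<nu>(u := t)) * ?G (\<nu>(u := t)) \<partial>lborel) = 0" for \<nu>
  proof -
    let ?c = "\<Prod>v\<in>?I. indicator (cell v) (\<nu> v) * wt1 s (\<nu> v)"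
    have "wt s (\<nu>(u := t)) = ?c * (indicator (cell u) t * wt1 s t)" for t
    proof -
      have "wt s (\<nu>(u := t)) = (\<Prod>v\<in>insert u ?I. indicator (cell v) ((\<nu>(u := t)) v) * wt1 s ((\<nu>(u := t)) v))"
        unfolding wt_def using ins by simp
      also have "\<dots> = (indicator (cell u) t * wt1 s t) * (\<Prod>v\<in>?I. indicator (cell v) ((\<nu>(u := t)) v) * wt1 s ((\<nu>(u := t)) v))"
        by (subst prod.insert) auto
      also have "(\<Prod>v\<in>?I. indicator (cell v) ((\<nu>(u := t)) v) * wt1 s ((\<nu>(u := t)) v)) = ?c"
        by (intro prod.cong) auto
      finally show ?thesis by (simp only: mult.commute)
    qed
    then have "(\<integral>t. wt s (\<nu>(u := t)) * ?G (\<nu>(u := t)) \<partial>lborel) = 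
      (\<integral>t. ?c * (indicator (cell u) t * wt1 s t * ?G (\<nu>(u := t))) \<partial>lborel)"
      by (simp only: mult_ac)
    also have "\<dots> = ?c * (\<integral>t. indicator (cell u) t * wt1 s t * ?G (\<nu>(u := t)) \<partial>lborel)"
      by simp
    also have "(\<integral>t. indicator (cell u) t * wt1 s t * ?G (\<nu>(u := t)) \<partial>lborel) = 0"
    proof -
      have c: "isCont (\<lambda>t. pd u H (\<nu>(u := t))) t" for t
        using poly_fun_has_derivative[OF poly_fun_pd[OF H]] DERIV_isCont by blast
      show ?thesis
        using wt1_by_parts[OF u s poly_fun_has_derivative[OF H] c] by simp
    qed
    finally show ?thesis by (simp only: mult_zero_right)
  qed
  have "(\<integral>\<nu>. wt s \<nu> * ?G \<nu> \<partial>Rmeas n) =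
     (\<integral>\<nu>. (\<integral>t. wt s (\<nu>(u := t)) * ?G (\<nu>(u := t)) \<partial>lborel) \<partial>PiM ?I (\<lambda>_. lborel))"
    using int ins by (subst ins, intro lb.product_integral_insert) auto
  also have "\<dots> = 0" unfolding inner by simp
  finally show ?thesis .
qed

end

section \<open>Interpolation and alternants\<close>

lemma lagrange_interpolation:
  fixes x :: "'a \<Rightarrow> real" and p :: "real poly"
  assumes S: "finite S" "inj_on x S" and deg: "degree p < card S"
  shows "(\<Sum>u\<in>S. poly p (x u) * (\<Prod>t\<in>S-{u}. (z - x t) / (x u - x t))) = poly p z"
proof -
  define q where "q = (\<Sum>u\<in>S. smult (poly p (x u) / (\<Prod>t\<in>S-{u}. x u - x t)) (\<Prod>t\<in>S-{u}. [:- x t, 1:]))"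
  have pq: "poly q z = (\<Sum>u\<in>S. poly p (x u) * (\<Prod>t\<in>S-{u}. (z - x t) / (x u - x t)))" for z
    unfolding q_def by (simp add: poly_sum poly_prod prod_dividef)
  have "p = q"
  proof (rule poly_eqI_degree[where A = "x ` S"])
    fix y assume "y \<in> x ` S"
    then obtain v where v: "v \<in> S" "y = x v" by auto
    have "poly q y = (\<Sum>u\<in>S. if u = v then poly p (x v) else 0)"
      unfolding pq
    proof (rule sum.cong)
      fix u assume u: "u \<in> S"
      show "poly p (x u) * (\<Prod>t\<in>S-{u}. (y - x t) / (x u - x t)) = (if u = v then poly p (x v) else 0)"
      proof (cases "u = v")
        case True
        have "(\<Prod>t\<in>S-{u}. (y - x t) / (x u - x t)) = 1"
          using S v True by (intro prod.neutral) (auto simp: inj_on_def)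
        then show ?thesis using True by simp
      next
        case False
        have "(\<Prod>t\<in>S-{u}. (y - x t) / (x u - x t)) = 0"
          using S v False by (intro prod_zero) auto
        then show ?thesis using False by simp
      qed
    qed simp
    then show "poly p y = poly q y" using v S by simp
  next
    show "degree p < card (x ` S)" using deg S by (simp add: card_image)
    have "degree q \<le> card S - 1"
      unfolding q_def
    proof (rule degree_sum_le[OF S(1)])
      fix u assume u: "u \<in> S"
      have "degree (\<Prod>t\<in>S-{u}. [:- x t, 1:]) \<le> (\<Sum>t\<in>S-{u}. degree [:- x t, 1:])"
        by (rule order.trans[OF degree_prod_sum_le]) (use S in auto)
      also have "\<dots> = card S - 1" using u S by simp
      finally show "degree (smult (poly p (x u) / (\<Prod>t\<in>S-{u}. x u - x t)) (\<Prod>t\<in>S-{u}. [:- x t, 1:])) \<le> card S - 1"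
        using degree_smult_le order.trans by blast
    qed
    then show "degree q < card (x ` S)" using deg S by (simp add: card_image)
  qed
  then show ?thesis using pq[of z] by simp
qed

lemma degree_prod_linear:
  fixes x :: "'a \<Rightarrow> real"
  assumes "finite S"
  shows "degree (\<Prod>t\<in>S. [:- x t, 1:]) = card S" "lead_coeff (\<Prod>t\<in>S. [:- x t, 1:]) = 1"
proof -
  show "degree (\<Prod>t\<in>S. [:- x t, 1:]) = card S"
    using assms by (simp add: degree_prod_eq_sum_degree)
  show "lead_coeff (\<Prod>t\<in>S. [:- x t, 1:]) = 1"
    by (simp only: lead_coeff_prod) simp
qed

text \<open>The product over T has degree \<open>card S\<close>, one too large for interpolation.
  Subtracting the monic node polynomial of S lowers the degree without changing the values at the
  nodes.\<close>

lemma lagrange_interpolation_monic: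
  fixes x y :: "'a \<Rightarrow> real"
  assumes S: "finite S" "inj_on x S" "S \<noteq> {}" and T: "finite T" "card T = card S"
  shows "(\<Sum>u\<in>S. (\<Prod>a\<in>T. x u - y a) * (\<Prod>t\<in>S-{u}. (z - x t) / (x u - x t))) =
    (\<Prod>a\<in>T. z - y a) - (\<Prod>t\<in>S. z - x t)"
proof -
  define p where "p = (\<Prod>a\<in>T. [:- y a, 1:])"
  define q where "q = (\<Prod>t\<in>S. [:- x t, 1:])"
  have "degree (p - q) < card S"
  proof (cases "p = q")
    case True
    then show ?thesis using S by (simp add: card_gt_0_iff)
  next
    case False
    have "degree p = card S" "degree q = card S" "lead_coeff p = 1" "lead_coeff q = 1"
      unfolding p_def q_def
      using degree_prod_linear[OF T(1), of y] degree_prod_linear[OF S(1), of x] T(2) by simp_all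
    then show ?thesis
      using False
      by (metis card_gt_0_iff coeff_diff degree_diff_le diff_self le_neq_implies_less
          leading_coeff_0_iff order_refl right_minus_eq)
  qed
  from lagrange_interpolation[OF S(1,2) this, of z]
  have "(\<Sum>u\<in>S. poly (p - q) (x u) * (\<Prod>t\<in>S-{u}. (z - x t) / (x u - x t))) = poly (p - q) z" .
  moreover have "poly (p - q) (x u) = (\<Prod>a\<in>T. x u - y a)" if "u \<in> S" for u
  proof -
    have "(\<Prod>t\<in>S. x u - x t) = 0" using that S by (intro prod_zero) auto
    then show ?thesis by (simp add: p_def q_def poly_prod)
  qed
  moreover have "poly (p - q) z = (\<Prod>a\<in>T. z - y a) - (\<Prod>t\<in>S. z - x t)"
    by (simp add: p_def q_def poly_prod)
  ultimately show ?thesis by (simp cong: sum.cong)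
qed

section \<open>Vandermonde products and their antisymmetry\<close>

definition vdm_on :: "nat set \<Rightarrow> (nat \<Rightarrow> real) \<Rightarrow> real" where
  "vdm_on X \<nu> = (\<Prod>(i, j)\<in>{(i, j). i \<in> X \<and> j \<in> X \<and> i < j}. \<nu> i - \<nu> j)"

abbreviation vdm :: "nat \<Rightarrow> (nat \<Rightarrow> real) \<Rightarrow> real" where
  "vdm m \<equiv> vdm_on {1..m}"

lemma vdm_altdef: "vdm m \<nu> = (\<Prod>i\<in>{1..m}. \<Prod>j\<in>{i+1..m}. \<nu> i - \<nu> j)"
proof -
  have "(SIGMA i:{1..m}. {i+1..m}) = {(i, j). i \<in> {1..m} \<and> j \<in> {1..m} \<and> i < j}" by auto
  then show ?thesis unfolding vdm_on_def by (subst prod.Sigma) auto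
qed

lemma pi_A_eq_vdm: "pi_A n lam = vdm (n + 1) lam"
  unfolding pi_A_def vdm_altdef ..

lemma vdm_on_cong: "(\<And>i. i \<in> X \<Longrightarrow> \<nu> i = \<mu> i) \<Longrightarrow> vdm_on X \<nu> = vdm_on X \<mu>"
  unfolding vdm_on_def by (rule prod.cong) auto

text \<open>Pairs (i, u) with i < u occur in \<open>vdm_on\<close> as
  \<open>\<nu> i - \<nu> u\<close>; reversing these factors produces the sign.\<close>

lemma vdm_on_remove:
  assumes "finite X" "u \<in> X"
  shows "vdm_on X \<nu> = (-1) ^ card {i\<in>X. i < u} * (\<Prod>t\<in>X-{u}. \<nu> u - \<nu> t) * vdm_on (X - {u}) \<nu>"
proof -
  let ?f = "\<lambda>(i, j). \<nu> i - \<nu> j"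
  let ?A = "{(i, j). i \<in> X - {u} \<and> j \<in> X - {u} \<and> i < j}"
  let ?L = "{i\<in>X. i < u}" and ?G = "{i\<in>X. u < i}"
  have fin: "finite ?A" "finite ?L" "finite ?G"
    using assms by (auto intro: finite_subset[of _ "X \<times> X"])
  have eq: "{(i, j). i \<in> X \<and> j \<in> X \<and> i < j} = ?A \<union> ((\<lambda>i. (i, u)) ` ?L \<union> (\<lambda>j. (u, j)) ` ?G)"
    using assms by auto
  have "vdm_on X \<nu> = prod ?f ?A * (prod ?f ((\<lambda>i. (i, u)) ` ?L) * prod ?f ((\<lambda>j. (u, j)) ` ?G))"
    unfolding vdm_on_def eq using fin by (subst prod.union_disjoint; (subst prod.union_disjoint)?) auto
  also have "prod ?f ((\<lambda>i. (i, u)) ` ?L) = (\<Prod>i\<in>?L. \<nu> i - \<nu> u)"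
    by (subst prod.reindex) (auto simp: inj_on_def)
  also have "\<dots> = (\<Prod>i\<in>?L. (-1) * (\<nu> u - \<nu> i))" by (intro prod.cong) auto
  also have "\<dots> = (-1) ^ card ?L * (\<Prod>i\<in>?L. \<nu> u - \<nu> i)" by (simp only: prod.distrib prod_constant)
  also have "prod ?f ((\<lambda>j. (u, j)) ` ?G) = (\<Prod>j\<in>?G. \<nu> u - \<nu> j)"
    by (subst prod.reindex) (auto simp: inj_on_def)
  finally have "vdm_on X \<nu> = (-1) ^ card ?L * ((\<Prod>i\<in>?L. \<nu> u - \<nu> i) * (\<Prod>j\<in>?G. \<nu> u - \<nu> j)) * prod ?f ?A"
    by (simp only: mult_ac)
  also have "(\<Prod>i\<in>?L. \<nu> u - \<nu> i) * (\<Prod>j\<in>?G. \<nu> u - \<nu> j) = (\<Prod>t\<in>?L \<union> ?G. \<nu> u - \<nu> t)"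
    using fin by (intro prod.union_disjoint[symmetric]) auto
  also have "?L \<union> ?G = X - {u}" by auto
  finally show ?thesis unfolding vdm_on_def .
qed

text \<open>Only the factors with index u change, so the quotient is a Lagrange basis polynomial in
  z. This turns sums of Vandermonde products into interpolation formulas.\<close>

lemma vdm_on_upd:
  assumes "finite X" "u \<in> X" "inj_on \<nu> X"
  shows "vdm_on X (\<nu>(u := z)) = vdm_on X \<nu> * (\<Prod>t\<in>X-{u}. (z - \<nu> t) / (\<nu> u - \<nu> t))"
proof -
  have "(\<Prod>t\<in>X-{u}. \<nu> u - \<nu> t) \<noteq> 0"
    using assms by (auto simp: inj_on_def)
  moreover have "vdm_on (X - {u}) (\<nu>(u := z)) = vdm_on (X - {u}) \<nu>"
    by (rule vdm_on_cong) auto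
  moreover have "(\<Prod>t\<in>X-{u}. (\<nu>(u := z)) u - (\<nu>(u := z)) t) = (\<Prod>t\<in>X-{u}. z - \<nu> t)"
    by (intro prod.cong) auto
  ultimately show ?thesis
    using vdm_on_remove[OF assms(1,2), of "\<nu>(u := z)"] vdm_on_remove[OF assms(1,2), of \<nu>]
    by (simp add: prod_dividef)
qed

lemma vdm_on_eq_0:
  assumes "finite X" "i \<in> X" "j \<in> X" "i \<noteq> j" "\<nu> i = \<nu> j"
  shows "vdm_on X \<nu> = 0"
proof -
  have "(\<Prod>t\<in>X-{i}. \<nu> i - \<nu> t) = 0" using assms by (intro prod_zero bexI[of _ j]) auto
  then show ?thesis using vdm_on_remove[OF assms(1,2), of \<nu>] by simp
qed

text \<open>Once a and b are split off, the remaining factors are symmetric in the two, and only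
  \<open>\<nu> a - \<nu> b\<close> changes sign.\<close>

lemma vdm_on_transpose:
  assumes X: "finite X" "a \<in> X" "b \<in> X" "a \<noteq> b"
  shows "vdm_on X (\<nu> \<circ> Transposition.transpose a b) = - vdm_on X \<nu>"
proof -
  let ?Y = "X - {a} - {b}"
  have *: "vdm_on X \<nu> = (-1) ^ card {i\<in>X. i < a} * (-1) ^ card {i\<in>X-{a}. i < b} *
     ((\<nu> a - \<nu> b) * (\<Prod>t\<in>?Y. (\<nu> a - \<nu> t) * (\<nu> b - \<nu> t))) * vdm_on ?Y \<nu>" for \<nu>
  proof -
    have "(\<Prod>t\<in>X-{a}. \<nu> a - \<nu> t) = (\<nu> a - \<nu> b) * (\<Prod>t\<in>?Y. \<nu> a - \<nu> t)"
      using X by (intro prod.remove) auto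
    moreover have "vdm_on (X - {a}) \<nu> = (-1) ^ card {i\<in>X-{a}. i < b} * (\<Prod>t\<in>?Y. \<nu> b - \<nu> t) * vdm_on ?Y \<nu>"
      using X by (intro vdm_on_remove) auto
    ultimately show ?thesis
      unfolding vdm_on_remove[OF X(1,2), of \<nu>] by (simp only: prod.distrib mult_ac)
  qed
  have "vdm_on ?Y (\<nu> \<circ> Transposition.transpose a b) = vdm_on ?Y \<nu>"
    by (rule vdm_on_cong) (auto simp: transpose_def)
  moreover have "(\<Prod>t\<in>?Y. ((\<nu> \<circ> Transposition.transpose a b) a - (\<nu> \<circ> Transposition.transpose a b) t) * ((\<nu> \<circ> Transposition.transpose a b) b - (\<nu> \<circ> Transposition.transpose a b) t))
     = (\<Prod>t\<in>?Y. (\<nu> a - \<nu> t) * (\<nu> b - \<nu> t))"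
    by (intro prod.cong) (auto simp: transpose_def)
  ultimately show ?thesis unfolding *[of "\<nu> \<circ> Transposition.transpose a b"] *[of \<nu>] by (simp add: algebra_simps)
qed

lemma vdm_on_permute:
  assumes "w permutes X" "finite X"
  shows "vdm_on X (\<nu> \<circ> w) = of_int (sign w) * vdm_on X \<nu>"
  using assms
proof (induction arbitrary: \<nu> rule: permutes_induct)
  case (swap a b p)
  have "vdm_on X (\<nu> \<circ> (Transposition.transpose a b \<circ> p)) = of_int (sign p) * vdm_on X (\<nu> \<circ> Transposition.transpose a b)"
    using swap.IH[of "\<nu> \<circ> Transposition.transpose a b"] by (simp only: comp_assoc)
  also have "\<dots> = - of_int (sign p) * vdm_on X \<nu>"
    using vdm_on_transpose[OF assms(2) swap.hyps(1-3)] by simp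
  also have "- of_int (sign p) = of_int (sign (Transposition.transpose a b \<circ> p))"
    using swap.hyps assms(2) permutes_imp_permutation
    by (subst sign_compose) (auto simp: sign_swap_id permutation_swap_id)
  finally show ?case .
qed simp

lemma vdm_poly_fun: "vdm m \<in> poly_fun m"
  unfolding vdm_altdef[abs_def]
  by (intro poly_fun_prod poly_fun_diff poly_fun.pvar) auto

text \<open>In a single coordinate the Vandermonde product has degree at most m - 1, so m nodes
  reproduce it exactly.\<close>

lemma vdm_lagrange:
  assumes "u \<in> {1..m}" "inj_on x {1..m}"
  shows "vdm m (\<nu>(u := z)) =
    (\<Sum>r\<in>{1..m}. vdm m (\<nu>(u := x r)) * (\<Prod>a\<in>{1..m}-{r}. (z - x a) / (x r - x a)))"
proof -
  define c where "c = (-1) ^ card {i\<in>{1..m}. i < u} * vdm_on ({1..m} - {u}) \<nu>"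
  define p where "p = smult c (\<Prod>t\<in>{1..m}-{u}. [:- \<nu> t, 1:])"
  have p: "vdm m (\<nu>(u := y)) = poly p y" for y
  proof -
    have "vdm_on ({1..m} - {u}) (\<nu>(u := y)) = vdm_on ({1..m} - {u}) \<nu>"
      by (rule vdm_on_cong) auto
    moreover have "(\<Prod>t\<in>{1..m}-{u}. (\<nu>(u := y)) u - (\<nu>(u := y)) t) = (\<Prod>t\<in>{1..m}-{u}. y - \<nu> t)"
      by (intro prod.cong) auto
    ultimately show ?thesis
      using vdm_on_remove[OF finite_atLeastAtMost assms(1), of "\<nu>(u := y)"]
      unfolding p_def c_def by (simp only: poly_smult poly_prod) simp
  qed
  have "degree p \<le> card ({1..m} - {u})"
    unfolding p_def by (rule order.trans[OF degree_smult_le eq_refl[OF degree_prod_linear(1)]]) simp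
  also have "\<dots> < card {1..m}" by (rule card_Diff1_less[OF finite_atLeastAtMost assms(1)])
  finally show ?thesis
    unfolding p by (rule lagrange_interpolation[OF finite_atLeastAtMost assms(2), symmetric])
qed

text \<open>Interpolates the coordinates in S one after another. The set S is the induction
  parameter and is later taken to be the whole index set.\<close>

lemma vdm_lagrange_multi:
  assumes x: "inj_on x {1..m}" and S: "S \<subseteq> {1..m}"
  shows "vdm m \<nu> = (\<Sum>\<phi>\<in>S \<rightarrow>\<^sub>E {1..m}. vdm m (\<lambda>i. if i \<in> S then x (\<phi> i) else \<nu> i) *
     (\<Prod>i\<in>S. \<Prod>a\<in>{1..m}-{\<phi> i}. (\<nu> i - x a) / (x (\<phi> i) - x a)))"
proof -
  have "finite S" using S finite_subset by blast
  then show ?thesis using S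
  proof (induction S arbitrary: \<nu>)
    case empty
    then show ?case by simp
  next
    case (insert u S)
    let ?L = "\<lambda>r z. \<Prod>a\<in>{1..m}-{r}. (z - x a) / (x r - x a)"
    have u: "u \<in> {1..m}" using insert by auto
    have upd: "(\<lambda>i. if i \<in> S then x (\<phi> i) else \<nu> i)(u := x r) = 
        (\<lambda>i. if i \<in> insert u S then x ((\<phi>(u := r)) i) else \<nu> i)" for \<phi> r
      using insert(2) by (auto simp: fun_eq_iff)
    have "vdm m \<nu> = (\<Sum>\<phi>\<in>S \<rightarrow>\<^sub>E {1..m}. vdm m (\<lambda>i. if i \<in> S then x (\<phi> i) else \<nu> i) * (\<Prod>i\<in>S. ?L (\<phi> i) (\<nu> i)))"
      by (rule insert.IH) (use insert.prems in auto)
    also have "\<dots> = (\<Sum>\<phi>\<in>S \<rightarrow>\<^sub>E {1..m}. \<Sum>r\<in>{1..m}.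
       vdm m (\<lambda>i. if i \<in> insert u S then x ((\<phi>(u := r)) i) else \<nu> i) * (\<Prod>i\<in>insert u S. ?L ((\<phi>(u := r)) i) (\<nu> i)))"
    proof (rule sum.cong)
      fix \<phi>
      let ?\<nu> = "\<lambda>i. if i \<in> S then x (\<phi> i) else \<nu> i"
      have pr: "?L r (\<nu> u) * (\<Prod>i\<in>S. ?L (\<phi> i) (\<nu> i)) = (\<Prod>i\<in>insert u S. ?L ((\<phi>(u := r)) i) (\<nu> i))" for r
      proof -
        have "(\<Prod>i\<in>S. ?L (\<phi> i) (\<nu> i)) = (\<Prod>i\<in>S. ?L ((\<phi>(u := r)) i) (\<nu> i))"
          using insert(2) by (intro prod.cong) auto
        then show ?thesis using insert(1,2) by simp
      qed
      have "vdm m ?\<nu> = vdm m (?\<nu>(u := \<nu> u))"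
        using insert(2) by (intro vdm_on_cong) auto
      also have "\<dots> = (\<Sum>r\<in>{1..m}. vdm m (\<lambda>i. if i \<in> insert u S then x ((\<phi>(u := r)) i) else \<nu> i) * ?L r (\<nu> u))"
        unfolding vdm_lagrange[OF u x] upd ..
      finally have "vdm m ?\<nu> * (\<Prod>i\<in>S. ?L (\<phi> i) (\<nu> i)) =
         (\<Sum>r\<in>{1..m}. vdm m (\<lambda>i. if i \<in> insert u S then x ((\<phi>(u := r)) i) else \<nu> i) * (?L r (\<nu> u) * (\<Prod>i\<in>S. ?L (\<phi> i) (\<nu> i))))"
        by (simp only: sum_distrib_right mult.assoc)
      then show "vdm m ?\<nu> * (\<Prod>i\<in>S. ?L (\<phi> i) (\<nu> i)) = (\<Sum>r\<in>{1..m}.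
         vdm m (\<lambda>i. if i \<in> insert u S then x ((\<phi>(u := r)) i) else \<nu> i) * (\<Prod>i\<in>insert u S. ?L ((\<phi>(u := r)) i) (\<nu> i)))"
        unfolding pr .
    qed simp
    also have "\<dots> = (\<Sum>(r, \<phi>)\<in>{1..m} \<times> (S \<rightarrow>\<^sub>E {1..m}).
       vdm m (\<lambda>i. if i \<in> insert u S then x ((\<phi>(u := r)) i) else \<nu> i) * (\<Prod>i\<in>insert u S. ?L ((\<phi>(u := r)) i) (\<nu> i)))"
      by (subst sum.swap, subst sum.cartesian_product) simp
    also have "\<dots> = (\<Sum>\<phi>\<in>insert u S \<rightarrow>\<^sub>E {1..m}.
       vdm m (\<lambda>i. if i \<in> insert u S then x (\<phi> i) else \<nu> i) * (\<Prod>i\<in>insert u S. ?L (\<phi> i) (\<nu> i)))"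
      unfolding PiE_insert_eq
      by (subst sum.reindex[OF inj_combinator[OF insert(2)]]) (auto intro!: sum.cong)
    finally show ?case .
  qed
qed

text \<open>The expansion of a determinant of Lagrange basis values: in
  \<open>vdm_lagrange_multi\<close> a map that is not injective repeats a node and contributes zero,
  while a permutation contributes its sign.\<close>

lemma vdm_eq_sum_permutations:
  assumes x: "inj_on x {1..m}"
  shows "vdm m \<nu> = vdm m x * (\<Sum>w | w permutes {1..m}. of_int (sign w) *
     (\<Prod>i\<in>{1..m}. \<Prod>a\<in>{1..m}-{i}. (\<nu> (w i) - x a) / (x i - x a)))"
proof -
  let ?X = "{1..m}"
  let ?L = "\<lambda>r z. \<Prod>a\<in>?X-{r}. (z - x a) / (x r - x a)"
  let ?F = "\<lambda>\<phi>. vdm m (\<lambda>i. if i \<in> ?X then x (\<phi> i) else \<nu> i) * (\<Prod>i\<in>?X. ?L (\<phi> i) (\<nu> i))"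
  let ?P = "{w. w permutes ?X}"
  have "vdm m \<nu> = (\<Sum>\<phi>\<in>?X \<rightarrow>\<^sub>E ?X. ?F \<phi>)"
    by (rule vdm_lagrange_multi[OF x order.refl])
  also have "\<dots> = (\<Sum>\<phi>\<in>(\<lambda>w. restrict w ?X) ` ?P. ?F \<phi>)"
  proof (rule sum.mono_neutral_right)
    show "finite (?X \<rightarrow>\<^sub>E ?X)" by (intro finite_PiE) auto
    show "(\<lambda>w. restrict w ?X) ` ?P \<subseteq> ?X \<rightarrow>\<^sub>E ?X"
      using permutes_in_image by fastforce
    show "\<forall>\<phi>\<in>(?X \<rightarrow>\<^sub>E ?X) - (\<lambda>w. restrict w ?X) ` ?P. ?F \<phi> = 0"
    proof
      fix \<phi> assume \<phi>: "\<phi> \<in> (?X \<rightarrow>\<^sub>E ?X) - (\<lambda>w. restrict w ?X) ` ?P"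
      have "\<not> inj_on \<phi> ?X"
      proof
        assume inj: "inj_on \<phi> ?X"
        then have "bij_betw \<phi> ?X ?X"
          using \<phi> endo_inj_surj[of ?X \<phi>] by (auto simp: bij_betw_def)
        then have "bij_betw (\<lambda>i. if i \<in> ?X then \<phi> i else i) ?X ?X"
          by (rule bij_betw_cong[THEN iffD1, rotated]) simp
        then have "(\<lambda>i. if i \<in> ?X then \<phi> i else i) permutes ?X"
          by (rule bij_imp_permutes) auto
        moreover have "\<phi> = restrict (\<lambda>i. if i \<in> ?X then \<phi> i else i) ?X"
          using \<phi> by (auto simp: fun_eq_iff PiE_def extensional_def)
        ultimately show False using \<phi> by blast
      qed
      then obtain i j where "i \<in> ?X" "j \<in> ?X" "i \<noteq> j" "\<phi> i = \<phi> j" by (auto simp: inj_on_def)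
      then have "vdm m (\<lambda>i. if i \<in> ?X then x (\<phi> i) else \<nu> i) = 0"
        by (intro vdm_on_eq_0[of _ i j]) auto
      then show "?F \<phi> = 0" by simp
    qed
  qed
  also have "\<dots> = (\<Sum>w\<in>?P. ?F (restrict w ?X))"
  proof (subst sum.reindex)
    show "inj_on (\<lambda>w. restrict w ?X) ?P"
    proof (rule inj_onI)
      fix v w assume vw: "v \<in> ?P" "w \<in> ?P" "restrict v ?X = restrict w ?X"
      show "v = w"
      proof
        fix i show "v i = w i"
          using vw permutes_not_in[of v ?X i] permutes_not_in[of w ?X i]
          by (cases "i \<in> ?X") (auto dest: fun_cong[of _ _ i])
      qed
    qed
  qed (simp only: comp_def)
  also have "\<dots> = (\<Sum>w\<in>?P. vdm m x * (of_int (sign w) * (\<Prod>i\<in>?X. ?L (w i) (\<nu> i))))"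
  proof (rule sum.cong)
    fix w assume "w \<in> ?P"
    then have w: "w permutes ?X" by simp
    have "vdm m (\<lambda>i. if i \<in> ?X then x (restrict w ?X i) else \<nu> i) = vdm m (x \<circ> w)"
      by (rule vdm_on_cong) auto
    then show "?F (restrict w ?X) = vdm m x * (of_int (sign w) * (\<Prod>i\<in>?X. ?L (w i) (\<nu> i)))"
      using vdm_on_permute[OF w, of x] by simp
  qed simp
  \<comment> \<open>Passing to inverses moves the permutation from the basis index to the
    variable.\<close>
  also have "\<dots> = (\<Sum>w\<in>?P. vdm m x * (of_int (sign w) * (\<Prod>i\<in>?X. ?L i (\<nu> (w i)))))"
  proof (rule sum.reindex_bij_witness[where i = inv and j = inv])
    fix w assume "w \<in> ?P"
    then have w: "w permutes ?X" by simp
    show "inv (inv w) = w" using w by (rule permutes_inv_inv)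
    show "inv w \<in> ?P" using w by (simp add: permutes_inv)
    have "(\<Prod>i\<in>?X. ?L i (\<nu> (inv w i))) = (\<Prod>i\<in>?X. ?L (w i) (\<nu> (inv w (w i))))"
      using w by (rule prod.permute[unfolded comp_def])
    also have "\<dots> = (\<Prod>i\<in>?X. ?L (w i) (\<nu> i))"
      using permutes_inverses(2)[OF w] by simp
    finally show "vdm m x * (of_int (sign (inv w)) * (\<Prod>i\<in>?X. ?L i (\<nu> (inv w i)))) =
       vdm m x * (of_int (sign w) * (\<Prod>i\<in>?X. ?L (w i) (\<nu> i)))"
      using w by (simp add: sign_inverse permutes_imp_permutation[OF finite_atLeastAtMost])
  qed (auto simp: permutes_inv permutes_inv_inv)
  finally show ?thesis by (simp only: sum_distrib_left)
qed

text \<open>Each pair with r different from s contributes exactly one factor to Q; for the s - 1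
  indices r < s it is written in the opposite order.\<close>

lemma Qf_eq_enod: "Qf n x y = (\<Prod>s\<in>{1..n}. (-1) ^ (s - 1) * enod (n+1) x s (y s))"
proof -
  have "Qf n x y = (\<Prod>r\<in>{1..n+1}. \<Prod>s\<in>{r+1..n}. x r - y s) * (\<Prod>r\<in>{1..n+1}. \<Prod>s\<in>{1..r-1}. y s - x r)"
    unfolding Qf_def by (rule prod.distrib)
  also have "(\<Prod>r\<in>{1..n+1}. \<Prod>s\<in>{r+1..n}. x r - y s) = (\<Prod>s\<in>{1..n}. \<Prod>r\<in>{1..s-1}. x r - y s)"
    by (subst (1 2) prod.Sigma) (auto intro!: prod.reindex_bij_witness[of _ prod.swap prod.swap])
  also have "\<dots> = (\<Prod>s\<in>{1..n}. \<Prod>r\<in>{1..s-1}. (-1) * (y s - x r))"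
    by (intro prod.cong) auto
  also have "\<dots> = (\<Prod>s\<in>{1..n}. (-1) ^ (s - 1) * (\<Prod>r\<in>{1..s-1}. (y s - x r)))"
    by (simp only: prod.distrib prod_constant card_atLeastAtMost) simp
  also have "(\<Prod>r\<in>{1..n+1}. \<Prod>s\<in>{1..r-1}. y s - x r) = (\<Prod>s\<in>{1..n}. \<Prod>r\<in>{s+1..n+1}. y s - x r)"
    by (subst (1 2) prod.Sigma) (auto intro!: prod.reindex_bij_witness[of _ prod.swap prod.swap])
  also have "(\<Prod>s\<in>{1..n}. (-1) ^ (s - 1) * (\<Prod>r\<in>{1..s-1}. (y s - x r))) * \<dots> =
     (\<Prod>s\<in>{1..n}. (-1) ^ (s - 1) * ((\<Prod>r\<in>{1..s-1}. (y s - x r)) * (\<Prod>r\<in>{s+1..n+1}. y s - x r)))"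
    by (simp only: prod.distrib mult_ac)
  also have "\<dots> = (\<Prod>s\<in>{1..n}. (-1) ^ (s - 1) * enod (n+1) x s (y s))"
  proof (rule prod.cong)
    fix s assume s: "s \<in> {1..n}"
    have "{1..n+1} - {s} = {1..s-1} \<union> {s+1..n+1}" using s by auto
    then have "enod (n+1) x s (y s) = (\<Prod>r\<in>{1..s-1}. (y s - x r)) * (\<Prod>r\<in>{s+1..n+1}. y s - x r)"
      unfolding enod_def by (simp only:) (subst prod.union_disjoint, auto)
    then show "(-1) ^ (s - 1) * ((\<Prod>r\<in>{1..s-1}. (y s - x r)) * (\<Prod>r\<in>{s+1..n+1}. y s - x r)) =
       (-1) ^ (s - 1) * enod (n+1) x s (y s)" by simp
  qed simp
  finally show ?thesis .
qed

text \<open>Each pair of indices occurs twice on the left, once in either order, and the signs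
  restore the order used by \<open>vdm_on\<close>. The inner products are the denominators of the
  Lagrange basis.\<close>

lemma vdm_square: "(\<Prod>s\<in>{1..m}. (-1) ^ (s - 1) * (\<Prod>a\<in>{1..m}-{s}. x s - x a)) = vdm m x * vdm m x"
proof -
  have "vdm m x = (\<Prod>i\<in>{1..m}. \<Prod>j\<in>{1..i-1}. x j - x i)"
    unfolding vdm_altdef
    by (subst (1 2) prod.Sigma) (auto intro!: prod.reindex_bij_witness[of _ prod.swap prod.swap])
  then have "vdm m x * vdm m x = (\<Prod>i\<in>{1..m}. (\<Prod>j\<in>{1..i-1}. x j - x i) * (\<Prod>j\<in>{i+1..m}. x i - x j))"
    by (simp only: prod.distrib vdm_altdef)
  also have "\<dots> = (\<Prod>s\<in>{1..m}. (-1) ^ (s - 1) * (\<Prod>a\<in>{1..m}-{s}. x s - x a))"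
  proof (rule prod.cong)
    fix s assume s: "s \<in> {1..m}"
    have "{1..m} - {s} = {1..s-1} \<union> {s+1..m}" using s by auto
    then have "(\<Prod>a\<in>{1..m}-{s}. x s - x a) = (\<Prod>r\<in>{1..s-1}. x s - x r) * (\<Prod>r\<in>{s+1..m}. x s - x r)"
      by (simp only:) (subst prod.union_disjoint, auto)
    moreover have "(\<Prod>j\<in>{1..s-1}. x j - x s) = (\<Prod>j\<in>{1..s-1}. (-1) * (x s - x j))" by simp
    then have "(\<Prod>j\<in>{1..s-1}. x j - x s) = (-1) ^ (s - 1) * (\<Prod>j\<in>{1..s-1}. x s - x j)"
      by (simp only: prod.distrib prod_constant card_atLeastAtMost) simp
    ultimately show "(\<Prod>j\<in>{1..s-1}. x j - x s) * (\<Prod>j\<in>{s+1..m}. x s - x j) =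
       (-1) ^ (s - 1) * (\<Prod>a\<in>{1..m}-{s}. x s - x a)" by simp
  qed simp
  finally show ?thesis by simp
qed

text \<open>Cauchy's determinant with denominators cleared.\<close>
lemma sum_sign_Qf:
  assumes x: "inj_on x {1..n}"
  shows "(\<Sum>w | w permutes {1..n}. of_int (sign w) * Qf n x (\<nu> \<circ> w)) =
    vdm n x * vdm n \<nu> * (\<Prod>s\<in>{1..n}. \<nu> s - x (n+1))"
proof -
  let ?X = "{1..n}"
  let ?L = "\<lambda>r z. \<Prod>a\<in>?X-{r}. (z - x a) / (x r - x a)"
  let ?c = "\<lambda>r. \<Prod>a\<in>?X-{r}. x r - x a"
  \<comment> \<open>The factor of node n + 1 is present for every s, since s is at most n. Without
    it \<open>enod\<close> is a multiple of the Lagrange basis polynomial at the first n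
    nodes.\<close>
  have e: "enod (n+1) x s y = (y - x (n+1)) * (?c s * ?L s y)" if "s \<in> ?X" for s y
  proof -
    have eq: "{1..n+1} - {s} = insert (n+1) (?X - {s})" using that by auto
    have "enod (n+1) x s y = (y - x (n+1)) * (\<Prod>a\<in>?X-{s}. y - x a)"
      unfolding enod_def eq by (subst prod.insert) auto
    moreover have "x s - x a \<noteq> 0" if "a \<in> ?X - {s}" for a
      using that \<open>s \<in> ?X\<close> inj_onD[OF x, of s a] by auto
    then have "?c s \<noteq> 0" by (subst prod_zero_iff) blast+
    ultimately show ?thesis by (simp add: prod_dividef)
  qed
  have "Qf n x (\<nu> \<circ> w) = (\<Prod>s\<in>?X. \<nu> s - x (n+1)) * (vdm n x * vdm n x) * (\<Prod>s\<in>?X. ?L s (\<nu> (w s)))"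
    if w: "w permutes ?X" for w
  proof -
    have "Qf n x (\<nu> \<circ> w) = (\<Prod>s\<in>?X. (-1) ^ (s - 1) * ((\<nu> (w s) - x (n+1)) * (?c s * ?L s (\<nu> (w s)))))"
      unfolding Qf_eq_enod using e by (intro prod.cong) auto
    also have "\<dots> = (\<Prod>s\<in>?X. \<nu> (w s) - x (n+1)) * (\<Prod>s\<in>?X. (-1) ^ (s - 1) * ?c s) * (\<Prod>s\<in>?X. ?L s (\<nu> (w s)))"
      by (simp only: prod.distrib mult_ac)
    also have "(\<Prod>s\<in>?X. \<nu> (w s) - x (n+1)) = (\<Prod>s\<in>?X. \<nu> s - x (n+1))"
      using prod.permute[OF w, of "\<lambda>s. \<nu> s - x (n+1)"] by (simp add: comp_def)
    finally show ?thesis unfolding vdm_square .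
  qed
  then have "(\<Sum>w | w permutes ?X. of_int (sign w) * Qf n x (\<nu> \<circ> w)) =
    (\<Sum>w | w permutes ?X. (\<Prod>s\<in>?X. \<nu> s - x (n+1)) * vdm n x * (vdm n x * (of_int (sign w) * (\<Prod>s\<in>?X. ?L s (\<nu> (w s))))))"
    by (intro sum.cong) auto
  also have "\<dots> = (\<Prod>s\<in>?X. \<nu> s - x (n+1)) * vdm n x * vdm n \<nu>"
    unfolding vdm_eq_sum_permutations[OF x, of \<nu>] by (simp only: sum_distrib_left)
  finally show ?thesis by simp
qed

section \<open>The Dixon--Anderson integral\<close>

lemma prod_abs_sign:
  fixes f :: "nat \<Rightarrow> real"
  assumes "finite S" and neg: "\<And>t. t \<in> S \<Longrightarrow> t < j \<Longrightarrow> f t \<le> 0" and pos: "\<And>t. t \<in> S \<Longrightarrow> j \<le> t \<Longrightarrow> f t \<ge> 0"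
  shows "(\<Prod>t\<in>S. \<bar>f t\<bar>) = (-1) ^ card {t\<in>S. t < j} * (\<Prod>t\<in>S. f t)"
proof -
  let ?L = "{t\<in>S. t < j}" and ?G = "{t\<in>S. j \<le> t}"
  have S: "S = ?L \<union> ?G" by auto
  have split: "prod g S = prod g ?L * prod g ?G" for g :: "nat \<Rightarrow> real"
    by (subst S, rule prod.union_disjoint) (use assms(1) in auto)
  have "(\<Prod>t\<in>?L. \<bar>f t\<bar>) = (\<Prod>t\<in>?L. (-1) * f t)"
    using neg by (intro prod.cong) auto
  then have "(\<Prod>t\<in>?L. \<bar>f t\<bar>) = (-1) ^ card ?L * prod f ?L"
    by (simp only: prod.distrib prod_constant)
  moreover have "(\<Prod>t\<in>?G. \<bar>f t\<bar>) = prod f ?G"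
    using pos by (intro prod.cong) auto
  ultimately show ?thesis
    unfolding split[of f] split[of "\<lambda>t. \<bar>f t\<bar>"] by simp
qed

text \<open>Hoelder's inequality with exponents 1/(1 - t) and 1/t, from Young's inequality after
  scaling both integrals to 1. The first alternative takes care of the points where the weight
  vanishes.\<close>

lemma integral_powr_le:
  fixes f g h :: "'a \<Rightarrow> real"
  assumes f: "integrable M f" and g: "integrable M g" and h: "integrable M h"
    and F: "integral\<^sup>L M f > 0" and G: "integral\<^sup>L M g > 0"
    and t: "0 < t" "t < 1"
    and le: "\<And>x. x \<in> space M \<Longrightarrow> h x = 0 \<and> f x \<ge> 0 \<and> g x \<ge> 0 \<or> (f x > 0 \<and> g x > 0 \<and> h x = f x powr (1 - t) * g x powr t)"
  shows "integral\<^sup>L M h \<le> integral\<^sup>L M f powr (1 - t) * integral\<^sup>L M g powr t"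
proof -
  let ?F = "integral\<^sup>L M f" and ?G = "integral\<^sup>L M g"
  let ?c = "?F powr (1 - t) * ?G powr t"
  have "integral\<^sup>L M h \<le> (\<integral>x. ?c * ((1 - t) * (f x / ?F) + t * (g x / ?G)) \<partial>M)"
  proof (rule integral_mono)
    show "integrable M (\<lambda>x. ?c * ((1 - t) * (f x / ?F) + t * (g x / ?G)))"
      using f g by (intro integrable_mult_right Bochner_Integration.integrable_add integrable_divide) auto
    fix x assume x: "x \<in> space M"
    show "h x \<le> ?c * ((1 - t) * (f x / ?F) + t * (g x / ?G))"
    proof (cases "h x = 0 \<and> f x \<ge> 0 \<and> g x \<ge> 0")
      case True
      then show ?thesis using F G t by simp
    next
      case False
      then have p: "f x > 0" "g x > 0" "h x = f x powr (1 - t) * g x powr t" using le[OF x] by auto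
      have "(f x / ?F) powr (1 - t) * (g x / ?G) powr t \<le> (1 - t) * (f x / ?F) + t * (g x / ?G)"
        using F G p t by (intro Youngs_inequality_0) auto
      then have "?c * ((f x / ?F) powr (1 - t) * (g x / ?G) powr t) \<le> ?c * ((1 - t) * (f x / ?F) + t * (g x / ?G))"
        by (intro mult_left_mono) auto
      moreover have "?c * ((f x / ?F) powr (1 - t) * (g x / ?G) powr t) = h x"
        using F G p by (simp add: powr_divide)
      ultimately show ?thesis by simp
    qed
  qed (rule h)
  also have "\<dots> = ?c * ((1 - t) * (?F / ?F) + t * (?G / ?G))"
    using f g by simp
  also have "\<dots> = ?c" using F G by simp
  finally show ?thesis .
qed

context chamber
begin

abbreviation inbox :: "(nat \<Rightarrow> real) \<Rightarrow> bool" where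
  "inbox \<nu> \<equiv> \<forall>u\<in>{1..n}. \<nu> u \<in> cell u"

lemma inbox_less:
  assumes "inbox \<nu>" "1 \<le> i" "i < j" "j \<le> n"
  shows "\<nu> j < \<nu> i"
proof -
  have "\<nu> j < lam j" "lam (i + 1) < \<nu> i" using assms by (auto simp: cell_def)
  moreover have "lam j \<le> lam (i + 1)" using assms by (intro lam_le) auto
  ultimately show ?thesis by simp
qed

lemma inbox_inj: "inbox \<nu> \<Longrightarrow> inj_on \<nu> {1..n}"
  by (rule linorder_inj_onI) (use inbox_less in fastforce)+

lemma vdm_pos: "inbox \<nu> \<Longrightarrow> vdm n \<nu> > 0"
  unfolding vdm_altdef using inbox_less by (intro prod_pos) auto

lemma vdm_lam_pos: "vdm (n + 1) lam > 0"
  unfolding vdm_altdef using lam_less by (intro prod_pos) auto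

text \<open>The weight vanishes off the box, so an identity that holds only in the box may be used
  under the integral at every point.\<close>

lemma wt_mult_cong:
  assumes "\<And>\<nu>. inbox \<nu> \<Longrightarrow> f \<nu> = g \<nu>"
  shows "wt s \<nu> * f \<nu> = wt s \<nu> * g \<nu>"
  using assms[of \<nu>] wt_zero[of _ \<nu> s] by (cases "inbox \<nu>") auto

definition DA :: "(nat \<Rightarrow> real) \<Rightarrow> real" where
  "DA s = (\<integral>\<nu>. wt s \<nu> * vdm n \<nu> \<partial>Rmeas n)"

text \<open>The modulus of the derivative of the node polynomial at its r-th zero.\<close>

definition cn :: "nat \<Rightarrow> real" where
  "cn r = \<bar>enod (n+1) lam r (lam r)\<bar>"

lemma cn_pos: "r \<in> {1..n+1} \<Longrightarrow> cn r > 0"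
  unfolding cn_def enod_def using inj_onD[OF lam_inj, of r] by auto

lemma enod_node: "r \<in> {1..n+1} \<Longrightarrow> j \<in> {1..n+1} \<Longrightarrow> r \<noteq> j \<Longrightarrow> enod (n+1) lam r (lam j) = 0"
  unfolding enod_def by (rule prod_zero) auto

text \<open>Interpolation, at the coordinates of \<nu>, of the monic polynomial \<open>enod\<close>
  of degree n; by \<open>vdm_on_upd\<close> the Vandermonde quotients are the Lagrange basis. The
  degree is one too large, which produces the correction product. For n = 0 there are no
  interpolation points.\<close>

lemma shift_pointwise:
  assumes \<nu>: "inbox \<nu>" and r: "r \<in> {1..n+1}"
  shows "(\<Sum>u\<in>{1..n}. vdm n (\<nu>(u := z)) * enod (n+1) lam r (\<nu> u)) =
    vdm n \<nu> * (enod (n+1) lam r z - (\<Prod>t\<in>{1..n}. z - \<nu> t))"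
proof (cases "n = 0")
  case True
  then show ?thesis using r by (simp add: enod_def)
next
  case False
  have card: "card ({1..n+1} - {r}) = card {1..n}" using r by simp
  have "(\<Sum>u\<in>{1..n}. vdm n (\<nu>(u := z)) * enod (n+1) lam r (\<nu> u)) =
     (\<Sum>u\<in>{1..n}. vdm n \<nu> * ((\<Prod>a\<in>{1..n+1}-{r}. \<nu> u - lam a) * (\<Prod>t\<in>{1..n}-{u}. (z - \<nu> t) / (\<nu> u - \<nu> t))))"
    using vdm_on_upd[OF finite_atLeastAtMost _ inbox_inj[OF \<nu>]]
    by (intro sum.cong refl) (simp only: enod_def mult_ac)
  also have "\<dots> = vdm n \<nu> * ((\<Prod>a\<in>{1..n+1}-{r}. z - lam a) - (\<Prod>t\<in>{1..n}. z - \<nu> t))"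
    unfolding sum_distrib_left[symmetric]
    using lagrange_interpolation_monic[OF finite_atLeastAtMost inbox_inj[OF \<nu>] _ _ card] False by simp
  finally show ?thesis by (simp only: enod_def)
qed

text \<open>The total derivative behind this is
  \<open>\<Sum>\<^sub>u \<partial>\<^sub>u (wt s \<nu> * pnod (\<nu>\<^sub>u) * vdm (\<nu>(u := \<lambda>\<^sub>j)))\<close>.\<close>
lemma DA_shift_aux:
  assumes s: "\<And>r. r \<in> {1..n+1} \<Longrightarrow> s r > 0" and j: "j \<in> {1..n+1}"
  shows "(\<Sum>r\<in>{1..n+1}. s r) * (\<integral>\<nu>. wt s \<nu> * (vdm n \<nu> * (\<Prod>t\<in>{1..n}. lam j - \<nu> t)) \<partial>Rmeas n) =
    s j * enod (n+1) lam j (lam j) * DA s"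
proof -
  let ?J = "{1..n+1}"
  let ?e = "\<lambda>r. enod (n+1) lam r"
  let ?P = "\<lambda>\<nu>. \<Prod>t\<in>{1..n}. lam j - \<nu> t"
  have P: "?P \<in> poly_fun n" by (intro poly_fun_prod poly_fun_diff poly_fun.intros) auto
  have H: "(\<lambda>\<nu>. vdm n (\<nu>(u := lam j))) \<in> poly_fun n" for u
    using poly_fun_upd[OF vdm_poly_fun] .
  have E: "(\<lambda>\<nu>. \<Sum>r\<in>?J. s r * ?e r (\<nu> u)) \<in> poly_fun n" if "u \<in> {1..n}" for u
    unfolding enod_def using that by (intro poly_fun_sum poly_fun_prod poly_fun_diff poly_fun.intros) auto
  have "(\<integral>\<nu>. wt s \<nu> * (vdm n (\<nu>(u := lam j)) * (\<Sum>r\<in>?J. s r * ?e r (\<nu> u))) \<partial>Rmeas n) = 0"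
    if u: "u \<in> {1..n}" for u
  proof -
    \<comment> \<open>Overwriting coordinate u makes the test function constant in the direction of
      differentiation, so only the derivative of the weight survives.\<close>
    have "pd u (\<lambda>\<nu>. vdm n (\<nu>(u := lam j))) \<nu> = 0" for \<nu>
      by (simp add: pd_def)
    then show ?thesis using wt_by_parts[where s = s, OF u s H[of u]] by simp
  qed
  then have "0 = (\<Sum>u\<in>{1..n}. \<integral>\<nu>. wt s \<nu> * (vdm n (\<nu>(u := lam j)) * (\<Sum>r\<in>?J. s r * ?e r (\<nu> u))) \<partial>Rmeas n)"
    by simp
  also have "\<dots> = (\<integral>\<nu>. (\<Sum>u\<in>{1..n}. wt s \<nu> * (vdm n (\<nu>(u := lam j)) * (\<Sum>r\<in>?J. s r * ?e r (\<nu> u)))) \<partial>Rmeas n)"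
    using s H E by (intro Bochner_Integration.integral_sum[symmetric] wt_poly_integrable poly_fun.pmult) auto
  also have "\<dots> = (\<integral>\<nu>. s j * ?e j (lam j) * (wt s \<nu> * vdm n \<nu>) - (\<Sum>r\<in>?J. s r) * (wt s \<nu> * (vdm n \<nu> * ?P \<nu>)) \<partial>Rmeas n)"
  proof (rule Bochner_Integration.integral_cong[OF refl])
    fix \<nu>
    have "(\<Sum>u\<in>{1..n}. wt s \<nu> * (vdm n (\<nu>(u := lam j)) * (\<Sum>r\<in>?J. s r * ?e r (\<nu> u)))) =
      wt s \<nu> * (\<Sum>u\<in>{1..n}. \<Sum>r\<in>?J. s r * (vdm n (\<nu>(u := lam j)) * ?e r (\<nu> u)))"
      by (simp only: sum_distrib_left mult_ac)
    also have "\<dots> = wt s \<nu> * (\<Sum>r\<in>?J. s r * (\<Sum>u\<in>{1..n}. vdm n (\<nu>(u := lam j)) * ?e r (\<nu> u)))"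
      by (subst sum.swap) (simp only: sum_distrib_left)
    also have "\<dots> = wt s \<nu> * (\<Sum>r\<in>?J. s r * (vdm n \<nu> * (?e r (lam j) - ?P \<nu>)))"
      by (rule wt_mult_cong, rule sum.cong[OF refl]) (simp only: shift_pointwise)
    also have "(\<Sum>r\<in>?J. s r * (vdm n \<nu> * (?e r (lam j) - ?P \<nu>))) =
       vdm n \<nu> * ((\<Sum>r\<in>?J. s r * ?e r (lam j)) - (\<Sum>r\<in>?J. s r) * ?P \<nu>)"
      by (simp add: sum_distrib_left sum_distrib_right sum_subtractf algebra_simps)
    \<comment> \<open>\<open>enod\<close> for index r vanishes at every node other than
      \<open>lam r\<close>; evaluating at \<open>lam j\<close> isolates the exponent
      \<open>s j\<close>.\<close>
    also have "(\<Sum>r\<in>?J. s r * ?e r (lam j)) = (\<Sum>r\<in>?J. if r = j then s j * ?e j (lam j) else 0)"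
      using enod_node j by (intro sum.cong) auto
    also have "\<dots> = s j * ?e j (lam j)" using j by simp
    finally show "(\<Sum>u\<in>{1..n}. wt s \<nu> * (vdm n (\<nu>(u := lam j)) * (\<Sum>r\<in>?J. s r * ?e r (\<nu> u)))) =
      s j * ?e j (lam j) * (wt s \<nu> * vdm n \<nu>) - (\<Sum>r\<in>?J. s r) * (wt s \<nu> * (vdm n \<nu> * ?P \<nu>))"
      by (simp only: right_diff_distrib mult_ac)
  qed
  also have "\<dots> = s j * ?e j (lam j) * DA s - (\<Sum>r\<in>?J. s r) * (\<integral>\<nu>. wt s \<nu> * (vdm n \<nu> * ?P \<nu>) \<partial>Rmeas n)"
    using wt_poly_integrable[of s, OF s vdm_poly_fun] wt_poly_integrable[of s, OF s poly_fun.pmult[OF vdm_poly_fun P]]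
    unfolding DA_def by (subst Bochner_Integration.integral_diff) simp_all
  finally show ?thesis by simp
qed

lemma enod_sign: "j \<in> {1..n+1} \<Longrightarrow> cn j = (-1) ^ (j - 1) * enod (n+1) lam j (lam j)"
proof -
  assume j: "j \<in> {1..n+1}"
  have "cn j = (\<Prod>a\<in>{1..n+1}-{j}. \<bar>lam j - lam a\<bar>)"
    unfolding cn_def enod_def by (rule abs_prod)
  also have "\<dots> = (-1) ^ card {t\<in>{1..n+1}-{j}. t < j} * (\<Prod>a\<in>{1..n+1}-{j}. lam j - lam a)"
    using j lam_le by (intro prod_abs_sign) auto
  also have "{t\<in>{1..n+1}-{j}. t < j} = {1..<j}" using j by auto
  finally show ?thesis by (simp add: enod_def)
qed

text \<open>In the box exactly the first j - 1 coordinates lie above \<open>lam j\<close>. The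
  resulting sign is the one in \<open>enod_sign\<close>, so the two cancel in
  \<open>DA_shift\<close>.\<close>

lemma node_prod_sign:
  assumes "inbox \<nu>" "j \<in> {1..n+1}"
  shows "(\<Prod>t\<in>{1..n}. \<bar>\<nu> t - lam j\<bar>) = (-1) ^ (j - 1) * (\<Prod>t\<in>{1..n}. lam j - \<nu> t)"
proof -
  have "(\<Prod>t\<in>{1..n}. \<bar>\<nu> t - lam j\<bar>) = (\<Prod>t\<in>{1..n}. \<bar>lam j - \<nu> t\<bar>)"
    by (simp add: abs_minus_commute)
  also have "\<dots> = (-1) ^ card {t\<in>{1..n}. t < j} * (\<Prod>t\<in>{1..n}. lam j - \<nu> t)"
  proof (rule prod_abs_sign)
    fix t assume t: "t \<in> {1..n}"
    then have c: "\<nu> t \<in> cell t" using assms(1) by blast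
    show "lam j - \<nu> t \<le> 0" if "t < j" using cell_cases(2)[OF t c assms(2) that] by simp
    show "lam j - \<nu> t \<ge> 0" if "j \<le> t" using cell_cases(1)[OF t c assms(2) that] by simp
  qed simp
  also have "{t\<in>{1..n}. t < j} = {1..<j}" using assms(2) by auto
  finally show ?thesis by simp
qed

lemma wt_shift:
  assumes j: "j \<in> {1..n+1}"
  shows "wt (s(j := s j + 1)) \<nu> = wt s \<nu> * (\<Prod>t\<in>{1..n}. \<bar>\<nu> t - lam j\<bar>)"
proof -
  have w1: "wt1 (s(j := s j + 1)) t = wt1 s t * \<bar>t - lam j\<bar>" if "u \<in> {1..n}" "t \<in> cell u" for t u
  proof -
    have "t \<noteq> lam j" using that j cell_neq by blast
    then have "\<bar>t - lam j\<bar> powr s j = \<bar>t - lam j\<bar> powr (s j - 1) * \<bar>t - lam j\<bar>"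
      by (simp add: powr_diff)
    moreover have "(\<Prod>r\<in>{1..n+1}-{j}. \<bar>t - lam r\<bar> powr ((s(j := s j + 1)) r - 1)) = (\<Prod>r\<in>{1..n+1}-{j}. \<bar>t - lam r\<bar> powr (s r - 1))"
      by (intro prod.cong) auto
    ultimately show ?thesis
      unfolding wt1_def prod.remove[OF finite_atLeastAtMost j] by simp
  qed
  have "wt (s(j := s j + 1)) \<nu> = (\<Prod>u\<in>{1..n}. (indicator (cell u) (\<nu> u) * wt1 s (\<nu> u)) * \<bar>\<nu> u - lam j\<bar>)"
    unfolding wt_def using w1 by (intro prod.cong) (auto simp: indicator_def)
  then show ?thesis unfolding wt_def prod.distrib .
qed

lemma DA_shift:
  assumes s: "\<And>r. r \<in> {1..n+1} \<Longrightarrow> s r > 0" and j: "j \<in> {1..n+1}"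
  shows "(\<Sum>r\<in>{1..n+1}. s r) * DA (s(j := s j + 1)) = s j * cn j * DA s"
proof -
  have "DA (s(j := s j + 1)) = (\<integral>\<nu>. (-1) ^ (j - 1) * (wt s \<nu> * (vdm n \<nu> * (\<Prod>t\<in>{1..n}. lam j - \<nu> t))) \<partial>Rmeas n)"
    unfolding DA_def
  proof (rule Bochner_Integration.integral_cong[OF refl])
    fix \<nu>
    have "wt (s(j := s j + 1)) \<nu> * vdm n \<nu> = wt s \<nu> * ((\<Prod>t\<in>{1..n}. \<bar>\<nu> t - lam j\<bar>) * vdm n \<nu>)"
      unfolding wt_shift[OF j] by (simp only: mult.assoc)
    also have "\<dots> = wt s \<nu> * ((-1) ^ (j - 1) * (\<Prod>t\<in>{1..n}. lam j - \<nu> t) * vdm n \<nu>)"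
      by (rule wt_mult_cong) (simp only: node_prod_sign[OF _ j])
    finally show "wt (s(j := s j + 1)) \<nu> * vdm n \<nu> = (-1) ^ (j - 1) * (wt s \<nu> * (vdm n \<nu> * (\<Prod>t\<in>{1..n}. lam j - \<nu> t)))"
      by (simp only: mult_ac)
  qed
  also have "\<dots> = (-1) ^ (j - 1) * (\<integral>\<nu>. wt s \<nu> * (vdm n \<nu> * (\<Prod>t\<in>{1..n}. lam j - \<nu> t)) \<partial>Rmeas n)"
    by simp
  finally have "(\<Sum>r\<in>{1..n+1}. s r) * DA (s(j := s j + 1)) =
     (-1) ^ (j - 1) * (s j * enod (n+1) lam j (lam j) * DA s)"
    using DA_shift_aux[where s = s, OF s j] by (simp only: mult_ac)
  then show ?thesis unfolding enod_sign[OF j] by (simp only: mult_ac)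
qed

end

text \<open>Induction by integrating out the last coordinate, which ranges between the two lowest
  nodes. Lagrange expansion at all nodes but the lowest separates it from the other coordinates,
  whose integrals are given by \<open>DA_shift_aux\<close> in the smaller rank. Stated outside the
  locale because two ranks occur: \<open>S\<close> has all nodes, \<open>C\<close> lacks the lowest
  one.\<close>

lemma DA_one_eq:
  assumes "chamber n lam"
  shows "chamber.DA n lam (\<lambda>_. 1) = vdm (n + 1) lam / fact n"
  using assms
proof (induction n)
  case 0
  then interpret chamber 0 lam .
  have 1: "vdm 1 lam = 1" unfolding vdm_altdef by simp
  have "wt (\<lambda>_. 1) \<nu> * vdm 0 \<nu> = 1" for \<nu> unfolding wt_def vdm_altdef by simp
  moreover have "measure (Rmeas 0) (space (Rmeas 0)) = 1"
    by (simp add: PiM_empty space_count_space)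
  ultimately show ?case using 1 by (simp add: DA_def)
next
  case (Suc n)
  interpret S: chamber "Suc n" lam by (rule Suc.prems)
  interpret C: chamber n lam by standard (use S.dec in auto)
  let ?X = "{1..n}" and ?J = "{1..n+1}" and ?m = "Suc n"
  let ?e = "\<lambda>r. enod (n+1) lam r"
  let ?a = "lam (?m + 1)" and ?b = "lam ?m"
  have ab: "?a < ?b" by (rule S.dec) simp
  have X: "{1..?m} = insert ?m ?X" "?m \<notin> ?X" "finite ?X" by auto
  \<comment> \<open>\<open>0 powr 0\<close> is 0, so with exponents 1 the weight equals 1 only off
    the nodes; the open cell excludes them.\<close>
  have ind1: "indicator (S.cell u) t * S.wt1 (\<lambda>_. 1) t = indicator (S.cell u) t" if "u \<in> {1..?m}" for u and t :: real
    using that S.cell_neq[of u t] by (auto simp: indicator_def S.wt1_def)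
  have ind2: "indicator (C.cell u) t * C.wt1 (\<lambda>_. 1) t = indicator (C.cell u) t" if "u \<in> ?X" for u and t :: real
    using that C.cell_neq[of u t] by (auto simp: indicator_def C.wt1_def)
  have wtS: "S.wt (\<lambda>_. 1) (\<nu>(?m := t)) = C.wt (\<lambda>_. 1) \<nu> * indicator (S.cell ?m) t" for \<nu> t
  proof -
    have "S.wt (\<lambda>_. 1) (\<nu>(?m := t)) = (\<Prod>u\<in>insert ?m ?X. indicator (S.cell u) ((\<nu>(?m := t)) u))"
      unfolding S.wt_def X(1)[symmetric] using ind1 by (intro prod.cong) auto
    also have "\<dots> = indicator (S.cell ?m) t * (\<Prod>u\<in>?X. indicator (S.cell u) (\<nu> u))"
      using X by (auto intro!: prod.cong)
    also have "(\<Prod>u\<in>?X. indicator (S.cell u) (\<nu> u)) = C.wt (\<lambda>_. 1) \<nu>"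
      unfolding C.wt_def using ind2 by (intro prod.cong) (auto simp: S.cell_def C.cell_def)
    finally show ?thesis by (simp only: mult.commute)
  qed
  have vS: "vdm ?m (\<nu>(?m := t)) = vdm n \<nu> * ((-1) ^ n * (\<Prod>s\<in>?X. t - \<nu> s))" for \<nu> t
  proof -
    have "vdm ?m (\<nu>(?m := t)) = (-1) ^ card {i\<in>{1..?m}. i < ?m} * (\<Prod>s\<in>{1..?m}-{?m}. (\<nu>(?m := t)) ?m - (\<nu>(?m := t)) s) * vdm_on ({1..?m}-{?m}) (\<nu>(?m := t))"
      by (rule vdm_on_remove) auto
    also have "{i\<in>{1..?m}. i < ?m} = ?X" by auto
    also have "{1..?m}-{?m} = ?X" by auto
    also have "vdm n (\<nu>(?m := t)) = vdm n \<nu>" by (rule vdm_on_cong) auto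
    also have "(\<Prod>s\<in>?X. (\<nu>(?m := t)) ?m - (\<nu>(?m := t)) s) = (\<Prod>s\<in>?X. t - \<nu> s)" by (intro prod.cong) auto
    finally show ?thesis by (simp only: mult_ac card_atLeastAtMost diff_Suc_1)
  qed
  \<comment> \<open>The product has degree n and there are n + 1 nodes, so interpolation is
    exact.\<close>
  have lagr: "(\<Prod>s\<in>?X. t - \<nu> s) = (\<Sum>r\<in>?J. (\<Prod>s\<in>?X. lam r - \<nu> s) * (?e r t / ?e r (lam r)))" for \<nu> t
  proof -
    define p where "p = (\<Prod>s\<in>?X. [:- \<nu> s, 1:])"
    have "degree p < card ?J" unfolding p_def by (subst degree_prod_linear) auto
    from lagrange_interpolation[OF finite_atLeastAtMost C.lam_inj this, of t] show ?thesis
      unfolding p_def enod_def by (simp add: poly_prod prod_dividef)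
  qed
  define I where "I = (\<lambda>r. \<integral>t. indicator (S.cell ?m) t * ?e r t \<partial>lborel)"
  have ecell: "set_integrable lborel {?a..?b} (?e r)" "(\<integral>t. indicator (S.cell ?m) t * ?e r t \<partial>lborel) = (LBINT t:{?a..?b}. ?e r t)"
    "integrable lborel (\<lambda>t. indicator (S.cell ?m) t * ?e r t)" for r
  proof -
    have c: "continuous_on UNIV (?e r)" unfolding enod_def by (intro continuous_intros)
    show si: "set_integrable lborel {?a..?b} (?e r)"
      by (rule borel_integrable_atLeastAtMost'[OF continuous_on_subset[OF c subset_UNIV]])
    have m: "?e r \<in> borel_measurable borel" using c by (rule borel_measurable_continuous_onI)
    show "(\<integral>t. indicator (S.cell ?m) t * ?e r t \<partial>lborel) = (LBINT t:{?a..?b}. ?e r t)"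
      unfolding set_lebesgue_integral_def real_scaleR_def
    proof (rule integral_cong_AE)
      have "AE t in lborel. t \<noteq> ?a" "AE t in lborel. t \<noteq> ?b" by (rule AE_lborel_singleton)+
      then show "AE t in lborel. indicator (S.cell ?m) t * ?e r t = indicator {?a..?b} t * ?e r t"
        by eventually_elim (auto simp: S.cell_def indicator_def)
    qed (use m in measurable)
    have "set_integrable lborel (S.cell ?m) (?e r)"
      by (rule set_integrable_subset[OF si]) (auto simp: S.cell_def)
    then show "integrable lborel (\<lambda>t. indicator (S.cell ?m) t * ?e r t)"
      by (simp add: set_integrable_def)
  qed
  \<comment> \<open>The sum of all \<open>enod\<close> is the derivative of \<open>pnod\<close>, and
    \<open>pnod\<close> vanishes at the upper end \<open>?b\<close>, which is the lowest node of the
    smaller chamber.\<close>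
  have sumI: "(\<Sum>r\<in>?J. I r) = - pnod (n+1) lam ?a"
  proof -
    have "(\<Sum>r\<in>?J. I r) = (\<Sum>r\<in>?J. LBINT t:{?a..?b}. ?e r t)"
      unfolding I_def ecell(2) ..
    also have "\<dots> = (LBINT t:{?a..?b}. \<Sum>r\<in>?J. ?e r t)"
      unfolding set_lebesgue_integral_def scaleR_sum_right
      using ecell(1) by (intro Bochner_Integration.integral_sum[symmetric]) (auto simp: set_integrable_def)
    also have "\<dots> = pnod (n+1) lam ?b - pnod (n+1) lam ?a"
    proof -
      have d: "(pnod (n+1) lam has_real_derivative (\<Sum>r\<in>?J. ?e r t)) (at t)" for t
      proof -
        have "((\<lambda>t. \<Prod>r\<in>?J. t - lam r) has_real_derivative (\<Sum>r\<in>?J. 1 * (\<Prod>a\<in>?J-{r}. t - lam a))) (at t)"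
          by (intro has_field_derivative_prod) (auto intro!: derivative_eq_intros)
        then show ?thesis by (simp add: pnod_def[abs_def] enod_def)
      qed
      have "(\<integral>t. (\<Sum>r\<in>?J. ?e r t) * indicator {?a..?b} t \<partial>lborel) = pnod (n+1) lam ?b - pnod (n+1) lam ?a"
        using ab d by (intro integral_FTC_Icc_real) (auto simp: enod_def intro!: continuous_intros)
      then show ?thesis by (simp add: set_lebesgue_integral_def mult.commute)
    qed
    also have "pnod (n+1) lam ?b = 0" unfolding pnod_def by (rule prod_zero) auto
    finally show ?thesis by simp
  qed
  \<comment> \<open>The value of \<open>pnod\<close> at the lower end is, up to sign, the product of
    all Vandermonde factors that involve the new node.\<close>
  have v: "vdm (?m + 1) lam = vdm (n + 1) lam * ((-1) ^ (n + 1) * pnod (n+1) lam ?a)"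
  proof -
    let ?k = "n + 2"
    have "vdm ?k lam = (-1) ^ card {i\<in>{1..?k}. i < ?k} * (\<Prod>s\<in>{1..?k}-{?k}. lam ?k - lam s) * vdm_on ({1..?k}-{?k}) lam"
      by (rule vdm_on_remove) auto
    also have "{i\<in>{1..?k}. i < ?k} = ?J" by auto
    also have "{1..?k}-{?k} = ?J" by auto
    finally show ?thesis by (simp add: pnod_def mult_ac)
  qed
  have int: "integrable (PiM (insert ?m ?X) (\<lambda>_. lborel)) (\<lambda>\<nu>. S.wt (\<lambda>_. 1) \<nu> * vdm ?m \<nu>)"
    unfolding X(1)[symmetric] by (rule S.wt_poly_integrable[OF _ vdm_poly_fun]) simp
  have "S.DA (\<lambda>_. 1) = (\<integral>\<nu>. (\<integral>t. S.wt (\<lambda>_. 1) (\<nu>(?m := t)) * vdm ?m (\<nu>(?m := t)) \<partial>lborel) \<partial>Rmeas n)"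
    unfolding S.DA_def using int X by (subst X(1), intro S.lb.product_integral_insert) auto
  also have "\<dots> = (\<integral>\<nu>. (\<Sum>r\<in>?J. (-1) ^ n * (I r / ?e r (lam r)) * (C.wt (\<lambda>_. 1) \<nu> * (vdm n \<nu> * (\<Prod>s\<in>?X. lam r - \<nu> s)))) \<partial>Rmeas n)"
  proof (rule Bochner_Integration.integral_cong[OF refl])
    fix \<nu>
    have "(\<integral>t. S.wt (\<lambda>_. 1) (\<nu>(?m := t)) * vdm ?m (\<nu>(?m := t)) \<partial>lborel) =
      (\<integral>t. (\<Sum>r\<in>?J. (-1) ^ n / ?e r (lam r) * (C.wt (\<lambda>_. 1) \<nu> * (vdm n \<nu> * (\<Prod>s\<in>?X. lam r - \<nu> s))) * (indicator (S.cell ?m) t * ?e r t)) \<partial>lborel)"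
    proof (rule Bochner_Integration.integral_cong[OF refl])
      fix t
      have "S.wt (\<lambda>_. 1) (\<nu>(?m := t)) * vdm ?m (\<nu>(?m := t)) =
         (C.wt (\<lambda>_. 1) \<nu> * indicator (S.cell ?m) t) * (vdm n \<nu> * ((-1) ^ n * (\<Sum>r\<in>?J. (\<Prod>s\<in>?X. lam r - \<nu> s) * (?e r t / ?e r (lam r)))))"
        by (simp only: wtS vS lagr[of t \<nu>])
      also have "\<dots> = (\<Sum>r\<in>?J. (-1) ^ n / ?e r (lam r) * (C.wt (\<lambda>_. 1) \<nu> * (vdm n \<nu> * (\<Prod>s\<in>?X. lam r - \<nu> s))) * (indicator (S.cell ?m) t * ?e r t))"
        unfolding sum_distrib_left by (rule sum.cong[OF refl]) simp
      finally show "S.wt (\<lambda>_. 1) (\<nu>(?m := t)) * vdm ?m (\<nu>(?m := t)) = \<dots>" .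
    qed
    also have "\<dots> = (\<Sum>r\<in>?J. (-1) ^ n / ?e r (lam r) * (C.wt (\<lambda>_. 1) \<nu> * (vdm n \<nu> * (\<Prod>s\<in>?X. lam r - \<nu> s))) * I r)"
      unfolding I_def using ecell(3)
      by (subst Bochner_Integration.integral_sum) (auto intro!: integrable_mult_right)
    finally show "(\<integral>t. S.wt (\<lambda>_. 1) (\<nu>(?m := t)) * vdm ?m (\<nu>(?m := t)) \<partial>lborel) =
       (\<Sum>r\<in>?J. (-1) ^ n * (I r / ?e r (lam r)) * (C.wt (\<lambda>_. 1) \<nu> * (vdm n \<nu> * (\<Prod>s\<in>?X. lam r - \<nu> s))))"
      by (simp only: mult_ac divide_inverse)
  qed
  also have "\<dots> = (\<Sum>r\<in>?J. (-1) ^ n * (I r / ?e r (lam r)) * (\<integral>\<nu>. C.wt (\<lambda>_. 1) \<nu> * (vdm n \<nu> * (\<Prod>s\<in>?X. lam r - \<nu> s)) \<partial>Rmeas n))"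
  proof (subst Bochner_Integration.integral_sum)
    fix r
    have "(\<lambda>\<nu>. vdm n \<nu> * (\<Prod>s\<in>?X. lam r - \<nu> s)) \<in> poly_fun n"
      by (intro poly_fun.pmult vdm_poly_fun poly_fun_prod poly_fun_diff poly_fun.intros) auto
    then show "integrable (Rmeas n) (\<lambda>\<nu>. (-1) ^ n * (I r / ?e r (lam r)) * (C.wt (\<lambda>_. 1) \<nu> * (vdm n \<nu> * (\<Prod>s\<in>?X. lam r - \<nu> s))))"
      by (intro integrable_mult_right C.wt_poly_integrable) auto
  qed simp
  also have "\<dots> = (\<Sum>r\<in>?J. (-1) ^ n * I r * C.DA (\<lambda>_. 1) / (n + 1))"
  proof (rule sum.cong[OF refl])
    fix r assume r: "r \<in> ?J"
    have "?e r (lam r) \<noteq> 0" using C.cn_pos[OF r] by (auto simp: C.cn_def)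
    moreover have "(n + 1) * (\<integral>\<nu>. C.wt (\<lambda>_. 1) \<nu> * (vdm n \<nu> * (\<Prod>s\<in>?X. lam r - \<nu> s)) \<partial>Rmeas n) = ?e r (lam r) * C.DA (\<lambda>_. 1)"
      using C.DA_shift_aux[where s = "\<lambda>_. 1", OF _ r] by simp
    then have "(\<integral>\<nu>. C.wt (\<lambda>_. 1) \<nu> * (vdm n \<nu> * (\<Prod>s\<in>?X. lam r - \<nu> s)) \<partial>Rmeas n) = ?e r (lam r) * C.DA (\<lambda>_. 1) / (n + 1)"
      by (simp add: field_simps)
    ultimately show "(-1) ^ n * (I r / ?e r (lam r)) * (\<integral>\<nu>. C.wt (\<lambda>_. 1) \<nu> * (vdm n \<nu> * (\<Prod>s\<in>?X. lam r - \<nu> s)) \<partial>Rmeas n) =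
       (-1) ^ n * I r * C.DA (\<lambda>_. 1) / (n + 1)" by simp
  qed
  also have "\<dots> = (\<Sum>r\<in>?J. I r) * ((-1) ^ n * C.DA (\<lambda>_. 1) / (n + 1))"
    unfolding sum_distrib_right by (intro sum.cong) auto
  also have "\<dots> = vdm (?m + 1) lam / fact ?m"
    unfolding sumI v Suc.IH[OF C.chamber_axioms] by (simp add: mult_ac)
  finally show ?case .
qed

section \<open>Log-convexity in the exponents and the closed formula\<close>

lemma convex_on_eqI: "convex_on S f \<Longrightarrow> (\<And>x. x \<in> S \<Longrightarrow> f x = g x) \<Longrightarrow> convex_on S g"
  by (auto simp: convex_on_def convex_def)

context chamber
begin

text \<open>Shows that at a fixed point the logarithm of the weight is affine in the exponents.
  Hoelder's inequality then makes the integral log-convex in each of them.\<close>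

lemma wt_exp:
  assumes "inbox \<nu>"
  shows "wt s \<nu> = exp (\<Sum>u\<in>{1..n}. \<Sum>r\<in>{1..n+1}. (s r - 1) * ln \<bar>\<nu> u - lam r\<bar>)"
proof -
  have "wt s \<nu> = (\<Prod>u\<in>{1..n}. \<Prod>r\<in>{1..n+1}. exp ((s r - 1) * ln \<bar>\<nu> u - lam r\<bar>))"
    unfolding wt_def wt1_def
  proof (rule prod.cong[OF refl])
    fix u assume u: "u \<in> {1..n}"
    then have c: "\<nu> u \<in> cell u" using assms by blast
    have "(\<Prod>r\<in>{1..n+1}. \<bar>\<nu> u - lam r\<bar> powr (s r - 1)) = (\<Prod>r\<in>{1..n+1}. exp ((s r - 1) * ln \<bar>\<nu> u - lam r\<bar>))"
      using cell_neq[OF u c] by (intro prod.cong) (auto simp: powr_def)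
    then show "indicator (cell u) (\<nu> u) * (\<Prod>r\<in>{1..n+1}. \<bar>\<nu> u - lam r\<bar> powr (s r - 1)) =
        (\<Prod>r\<in>{1..n+1}. exp ((s r - 1) * ln \<bar>\<nu> u - lam r\<bar>))"
      using c by simp
  qed
  then show ?thesis by (simp only: exp_sum finite_atLeastAtMost)
qed

lemma DA_integrable:
  "(\<And>r. r \<in> {1..n+1} \<Longrightarrow> s r > 0) \<Longrightarrow> integrable (Rmeas n) (\<lambda>\<nu>. wt s \<nu> * vdm n \<nu>)"
  by (rule wt_poly_integrable[OF _ vdm_poly_fun])

lemma wt_vdm_nonneg: "wt s \<nu> * vdm n \<nu> \<ge> 0"
proof (cases "inbox \<nu>")
  case True
  then show ?thesis using wt_nonneg[of s \<nu>] vdm_pos[of \<nu>] by simp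
next
  case False
  then show ?thesis using wt_zero by auto
qed

text \<open>Inside the box the integrand is positive for any exponents. If the integral vanished,
  the box would be a null set and the integral with exponents 1 would vanish too, against
  \<open>DA_one_eq\<close>.\<close>

lemma DA_pos:
  assumes s: "\<And>r. r \<in> {1..n+1} \<Longrightarrow> s r > 0"
  shows "DA s > 0"
proof (rule ccontr)
  assume "\<not> DA s > 0"
  moreover have "DA s \<ge> 0" unfolding DA_def using wt_vdm_nonneg by (intro integral_nonneg_AE) auto
  ultimately have "DA s = 0" by simp
  then have "AE \<nu> in Rmeas n. wt s \<nu> * vdm n \<nu> = 0"
    unfolding DA_def using integral_nonneg_eq_0_iff_AE[OF DA_integrable[of s, OF s]] wt_vdm_nonneg by auto
  then have "AE \<nu> in Rmeas n. wt (\<lambda>_. 1) \<nu> * vdm n \<nu> = 0"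
  proof eventually_elim
    case (elim \<nu>)
    have "wt s \<nu> * vdm n \<nu> > 0" if "inbox \<nu>"
      using that by (intro mult_pos_pos wt_pos vdm_pos) auto
    with elim have "\<not> inbox \<nu>" by force
    then show ?case using wt_zero by auto
  qed
  then have "DA (\<lambda>_. 1) = 0" unfolding DA_def by (rule integral_eq_zero_AE)
  then show False using DA_one_eq[OF chamber_axioms] vdm_lam_pos by simp
qed

lemma DA_log_convex:
  assumes s: "\<And>r. r \<in> {1..n+1} \<Longrightarrow> s r > 0"
  shows "convex_on {0<..} (\<lambda>x. ln (DA (s(j := x))))"
proof (rule convex_onI)
  fix t x y :: real assume t: "0 < t" "t < 1" and xy: "x \<in> {0<..}" "y \<in> {0<..}"
  let ?z = "(1 - t) *\<^sub>R x + t *\<^sub>R y"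
  have z: "?z > 0" using t xy by (auto intro!: add_pos_pos)
  have pos: "(s(j := a)) r > 0" if "a > 0" "r \<in> {1..n+1}" for a r using s that by auto
  have "DA (s(j := ?z)) \<le> DA (s(j := x)) powr (1 - t) * DA (s(j := y)) powr t"
    unfolding DA_def
  proof (rule integral_powr_le)
    show "integrable (Rmeas n) (\<lambda>\<nu>. wt (s(j := x)) \<nu> * vdm n \<nu>)"
      "integrable (Rmeas n) (\<lambda>\<nu>. wt (s(j := y)) \<nu> * vdm n \<nu>)"
      "integrable (Rmeas n) (\<lambda>\<nu>. wt (s(j := ?z)) \<nu> * vdm n \<nu>)"
      using xy z by (simp_all only: DA_integrable[OF pos] greaterThan_iff)
    show "0 < (\<integral>\<nu>. wt (s(j := x)) \<nu> * vdm n \<nu> \<partial>Rmeas n)" "0 < (\<integral>\<nu>. wt (s(j := y)) \<nu> * vdm n \<nu> \<partial>Rmeas n)"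
      unfolding DA_def[symmetric] using xy by (simp_all only: DA_pos[OF pos] greaterThan_iff)
    fix \<nu>
    show "wt (s(j := ?z)) \<nu> * vdm n \<nu> = 0 \<and> 0 \<le> wt (s(j := x)) \<nu> * vdm n \<nu> \<and> 0 \<le> wt (s(j := y)) \<nu> * vdm n \<nu> \<or>
       0 < wt (s(j := x)) \<nu> * vdm n \<nu> \<and> 0 < wt (s(j := y)) \<nu> * vdm n \<nu> \<and>
       wt (s(j := ?z)) \<nu> * vdm n \<nu> = (wt (s(j := x)) \<nu> * vdm n \<nu>) powr (1 - t) * (wt (s(j := y)) \<nu> * vdm n \<nu>) powr t"
    proof (cases "inbox \<nu>")
      case False
      then show ?thesis using wt_zero by auto
    next
      case True
      let ?E = "\<lambda>a. \<Sum>u\<in>{1..n}. \<Sum>r\<in>{1..n+1}. ((s(j := a)) r - 1) * ln \<bar>\<nu> u - lam r\<bar>"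
      have v: "vdm n \<nu> > 0" using True by (rule vdm_pos)
      have e: "wt (s(j := a)) \<nu> = exp (?E a)" for a using True by (rule wt_exp)
      have "?E ?z = (1 - t) * ?E x + t * ?E y"
        unfolding sum_distrib_left sum.distrib[symmetric]
        by (intro sum.cong refl) (auto simp: algebra_simps)
      then have "wt (s(j := ?z)) \<nu> = wt (s(j := x)) \<nu> powr (1 - t) * wt (s(j := y)) \<nu> powr t"
        unfolding e by (simp only: exp_powr_real exp_add mult.commute)
      moreover have "vdm n \<nu> powr (1 - t) * vdm n \<nu> powr t = vdm n \<nu>"
        using v by (simp flip: powr_add)
      moreover have "wt (s(j := a)) \<nu> > 0" for a using True by (intro wt_pos) auto
      ultimately show ?thesis using v
        by (simp add: powr_mult less_imp_le mult_ac)
    qed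
  qed (use t in auto)
  moreover have "DA (s(j := x)) > 0" "DA (s(j := y)) > 0" "DA (s(j := ?z)) > 0"
    using xy z by (simp_all only: DA_pos[OF pos] greaterThan_iff)
  ultimately have "ln (DA (s(j := ?z))) \<le> ln (DA (s(j := x)) powr (1 - t) * DA (s(j := y)) powr t)"
    by (subst ln_le_cancel_iff) auto
  also have "\<dots> = (1 - t) * ln (DA (s(j := x))) + t * ln (DA (s(j := y)))"
    using \<open>DA (s(j := x)) > 0\<close> \<open>DA (s(j := y)) > 0\<close> by (simp add: ln_mult ln_powr)
  finally show "ln (DA (s(j := ?z))) \<le> (1 - t) * ln (DA (s(j := x))) + t * ln (DA (s(j := y)))" .
qed simp

text \<open>Bohr--Mollerup in the parameter \<open>s\<^sub>j\<close>.\<close>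
lemma DA_Gamma:
  assumes s: "\<And>r. r \<in> {1..n+1} \<Longrightarrow> s r > 0" and j: "j \<in> {1..n+1}" and x: "x > 0"
    and T: "T = (\<Sum>r\<in>{1..n+1}-{j}. s r)"
  shows "DA (s(j := x)) * Gamma (T + x) / (Gamma x * cn j powr x) = DA (s(j := 1)) * Gamma (T + 1) / cn j"
proof -
  \<comment> \<open>The value that makes \<open>G 1 = 1\<close>, as Bohr--Mollerup demands.\<close>
  define K where "K = DA (s(j := 1)) * Gamma (T + 1) / cn j"
  \<comment> \<open>By \<open>DA_shift\<close> the integral is multiplied by a cn_j / (T + a) when
    the exponent a grows by one. The factors Gamma(T + x) and the power of cn_j remove all of this
    except a.\<close>
  define G where "G = (\<lambda>x. DA (s(j := x)) * Gamma (T + x) / cn j powr x / K)"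
  have T0: "T \<ge> 0" unfolding T using s by (intro sum_nonneg) (auto intro: less_imp_le)
  have pos: "(s(j := a)) r > 0" if "a > 0" "r \<in> {1..n+1}" for a r using s that by auto
  have c: "cn j > 0" using j by (rule cn_pos)
  have Dp: "DA (s(j := a)) > 0" if "a > 0" for a using pos[OF that] by (rule DA_pos)
  have K: "K > 0" unfolding K_def using Dp[of 1] c T0 by (simp add: Gamma_real_pos)
  have GT: "Gamma (T + a) > 0" if "a > 0" for a using T0 that by (intro Gamma_real_pos) auto
  have "G x = Gamma x"
  proof (rule Gamma_pos_real_unique[OF _ _ _ _ x])
    show "G 1 = 1" unfolding G_def using K c Dp[of 1] GT[of 1] by (simp add: K_def)
    show "G a > 0" if "a > 0" for a unfolding G_def using Dp GT K c that by simp
    show "G (a + 1) = a * G a" if a: "a > 0" for a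
    proof -
      have "(\<Sum>r\<in>{1..n+1}-{j}. (s(j := a)) r) = T" unfolding T by (intro sum.cong) auto
      then have sum: "(\<Sum>r\<in>{1..n+1}. (s(j := a)) r) = T + a"
        unfolding sum.remove[OF finite_atLeastAtMost j] by simp
      have sh: "(T + a) * DA (s(j := a + 1)) = a * cn j * DA (s(j := a))"
        using DA_shift[where s = "s(j := a)", OF pos[OF a] j] unfolding sum by simp
      have "Gamma (T + (a + 1)) = (T + a) * Gamma (T + a)"
        using Gamma_plus1[of "T + a"] nonpos_Ints_nonpos[of "T + a"] T0 a by (force simp: add.assoc)
      moreover have "cn j powr (a + 1) = cn j powr a * cn j" using c by (simp add: powr_add)
      ultimately have "G (a + 1) = ((T + a) * DA (s(j := a + 1))) * Gamma (T + a) / (cn j powr a * cn j) / K"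
        unfolding G_def by (simp only: mult_ac)
      also have "\<dots> = (a * cn j * DA (s(j := a))) * Gamma (T + a) / (cn j powr a * cn j) / K"
        unfolding sh ..
      also have "\<dots> = a * G a" unfolding G_def using c by simp
      finally show ?thesis .
    qed
    \<comment> \<open>The logarithm of \<open>G\<close> is a sum of three convex functions: that of
      the integral, a shifted log Gamma, and an affine function.\<close>
    have Gc: "convex_on {0<..} (\<lambda>x. ln (Gamma (T + x)))"
    proof (rule convex_onI)
      fix t x y :: real assume *: "0 < t" "t < 1" "x \<in> {0<..}" "y \<in> {0<..}"
      have "T + ((1 - t) *\<^sub>R x + t *\<^sub>R y) = (1 - t) *\<^sub>R (T + x) + t *\<^sub>R (T + y)" by (simp add: algebra_simps)
      then show "ln (Gamma (T + ((1 - t) *\<^sub>R x + t *\<^sub>R y))) \<le> (1 - t) * ln (Gamma (T + x)) + t * ln (Gamma (T + y))"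
        using convex_onD[OF log_convex_Gamma_real, of t "T + x" "T + y"] * T0 by simp
    qed simp
    have Lc: "convex_on {0<..} (\<lambda>x. - x * ln (cn j) - ln K)"
      by (rule convex_onI) (auto simp: algebra_simps)
    have cF: "convex_on {0<..} (\<lambda>x. ln (DA (s(j := x))) + ln (Gamma (T + x)) + (- x * ln (cn j) - ln K))"
      using DA_log_convex[of s j, OF s] Gc Lc by (intro convex_on_add) auto
    show "convex_on {0<..} (ln \<circ> G)"
    proof (rule convex_on_eqI[OF cF])
      fix x :: real assume "x \<in> {0<..}"
      then show "ln (DA (s(j := x))) + ln (Gamma (T + x)) + (- x * ln (cn j) - ln K) = (ln \<circ> G) x"
        unfolding G_def comp_def using Dp[of x] GT[of x] K c by (simp add: ln_mult ln_div ln_powr)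
    qed
  qed
  then have "DA (s(j := x)) * Gamma (T + x) / cn j powr x = Gamma x * K"
    unfolding G_def using K by (simp add: divide_eq_eq)
  moreover have "Gamma x > 0" using x by (rule Gamma_real_pos)
  ultimately have "DA (s(j := x)) * Gamma (T + x) / (Gamma x * cn j powr x) = K"
    using c by (simp add: divide_eq_eq mult_ac)
  then show ?thesis unfolding K_def .
qed

text \<open>The integral divided by its expected closed form, up to a constant that depends only on
  the nodes.\<close>

definition DAn :: "(nat \<Rightarrow> real) \<Rightarrow> real" where
  "DAn s = DA s * Gamma (\<Sum>r\<in>{1..n+1}. s r) / (\<Prod>r\<in>{1..n+1}. Gamma (s r) * cn r powr s r)"

lemma DAn_upd:
  assumes s: "\<And>r. r \<in> {1..n+1} \<Longrightarrow> s r > 0" and j: "j \<in> {1..n+1}"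
  shows "DAn s = DAn (s(j := 1))"
proof -
  let ?T = "\<Sum>r\<in>{1..n+1}-{j}. s r" and ?P = "\<Prod>r\<in>{1..n+1}-{j}. Gamma (s r) * cn r powr s r"
  have *: "DAn (s(j := x)) = DA (s(j := x)) * Gamma (?T + x) / (Gamma x * cn j powr x) / ?P" for x
  proof -
    have "(\<Sum>r\<in>{1..n+1}-{j}. (s(j := x)) r) = ?T" by (intro sum.cong) auto
    then have "(\<Sum>r\<in>{1..n+1}. (s(j := x)) r) = ?T + x"
      unfolding sum.remove[OF finite_atLeastAtMost j] by simp
    moreover have "(\<Prod>r\<in>{1..n+1}-{j}. Gamma ((s(j := x)) r) * cn r powr (s(j := x)) r) = ?P"
      by (intro prod.cong) auto
    ultimately show ?thesis
      unfolding DAn_def prod.remove[OF finite_atLeastAtMost j] by simp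
  qed
  have "DAn (s(j := s j)) = DAn (s(j := 1))"
    unfolding * using DA_Gamma[where s = s, OF s j s[OF j] refl] cn_pos[OF j] by simp
  then show ?thesis by simp
qed

lemma DAn_eq_one:
  assumes s: "\<And>r. r \<in> {1..n+1} \<Longrightarrow> s r > 0"
  shows "DAn s = DAn (\<lambda>_. 1)"
proof -
  have "DAn s = DAn (\<lambda>r. if r \<in> S then 1 else s r)" if "S \<subseteq> {1..n+1}" for S
    using finite_subset[OF that finite_atLeastAtMost] that
  proof (induction S)
    case (insert j S)
    have "DAn (\<lambda>r. if r \<in> S then 1 else s r) = DAn ((\<lambda>r. if r \<in> S then 1 else s r)(j := 1))"
      using insert.prems s by (intro DAn_upd) auto
    also have "(\<lambda>r. if r \<in> S then 1 else s r)(j := 1) = (\<lambda>r. if r \<in> insert j S then 1 else s r)"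
      by auto
    finally show ?case using insert by simp
  qed simp
  then have "DAn s = DAn (\<lambda>r. if r \<in> {1..n+1} then 1 else s r)" by blast
  also have "\<dots> = DAn (\<lambda>_. 1)"
  proof -
    have "wt (\<lambda>r. if r \<in> {1..n+1} then 1 else s r) \<nu> = wt (\<lambda>_. 1) \<nu>" for \<nu>
      unfolding wt_def wt1_def by (intro prod.cong refl arg_cong2[where f = "(*)"]) auto
    then have "DA (\<lambda>r. if r \<in> {1..n+1} then 1 else s r) = DA (\<lambda>_. 1)"
      unfolding DA_def by (simp only:)
    moreover have "(\<Sum>r\<in>{1..n+1}. if r \<in> {1..n+1} then 1 else s r) = (\<Sum>r\<in>{1..n+1}. 1)"
      by (intro sum.cong) auto
    moreover have "(\<Prod>r\<in>{1..n+1}. Gamma (if r \<in> {1..n+1} then 1 else s r) * cn r powr (if r \<in> {1..n+1} then 1 else s r)) =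
       (\<Prod>r\<in>{1..n+1}. Gamma 1 * cn r powr 1)"
      by (intro prod.cong) auto
    ultimately show ?thesis unfolding DAn_def by (simp only:)
  qed
  finally show ?thesis .
qed

lemma prod_cn: "(\<Prod>r\<in>{1..n+1}. cn r) = vdm (n + 1) lam * vdm (n + 1) lam"
  unfolding vdm_square[symmetric] by (rule prod.cong) (auto simp: enod_sign enod_def)

text \<open>The case of all exponents 1 fixes the constant: in it Gamma(n + 1) cancels
  \<open>fact n\<close>, and \<open>prod_cn\<close> turns the product of the \<open>cn\<close> into
  the square of the Vandermonde product.\<close>

lemma DA_eq:
  assumes s: "\<And>r. r \<in> {1..n+1} \<Longrightarrow> s r > 0"
  shows "DA s = (\<Prod>r\<in>{1..n+1}. Gamma (s r) * cn r powr s r) / (Gamma (\<Sum>r\<in>{1..n+1}. s r) * vdm (n + 1) lam)"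
proof -
  have "DAn (\<lambda>_. 1) = DA (\<lambda>_. 1) * Gamma (real (n + 1)) / (\<Prod>r\<in>{1..n+1}. cn r)"
  proof -
    have "(\<Prod>r\<in>{1..n+1}. Gamma (1::real) * cn r powr 1) = (\<Prod>r\<in>{1..n+1}. cn r)"
      using cn_pos by (intro prod.cong) (auto intro!: abs_of_pos)
    then show ?thesis unfolding DAn_def by simp
  qed
  also have "\<dots> = 1 / vdm (n + 1) lam"
    unfolding DA_one_eq[OF chamber_axioms] prod_cn using vdm_lam_pos Gamma_fact[of n, where 'a = real]
    by (simp add: add.commute)
  finally have "DAn s = 1 / vdm (n + 1) lam" using DAn_eq_one[of s, OF s] by simp
  moreover have "(\<Prod>r\<in>{1..n+1}. Gamma (s r) * cn r powr s r) > 0"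
  proof (intro prod_pos mult_pos_pos)
    fix r assume r: "r \<in> {1..n+1}"
    show "Gamma (s r) > 0" using s[OF r] by (rule Gamma_real_pos)
    show "cn r powr s r > 0" using cn_pos[OF r] by simp
  qed
  moreover have "Gamma (\<Sum>r\<in>{1..n+1}. s r) > 0"
    using s by (intro Gamma_real_pos sum_pos) auto
  ultimately show ?thesis using vdm_lam_pos unfolding DAn_def by (simp add: field_simps)
qed

text \<open>By \<open>sum_sign_Qf\<close> the integrand carries a further factor
  \<open>\<nu> s - lam (n+1)\<close> for each s, positive in the box, so the integral is
  \<open>DA\<close> with exponent k at the first n nodes and k + 1 at the last. The Gamma quotient
  then reduces to the inverse of \<open>c_nk\<close>, and \<open>prod_cn\<close> yields the power 2
  k of the Vandermonde product.\<close>

lemma normalisation: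
  assumes k: "k > 0"
  shows "c_nk n k / vdm (n + 1) lam powr (2 * k) *
    (\<integral>\<nu>. wt (\<lambda>_. k) \<nu> * (\<Sum>w | w permutes {1..n}. of_int (sign w) * Qf n lam (\<nu> \<circ> w)) \<partial>Rmeas n) = 1"
proof -
  let ?s = "(\<lambda>_. k)(n + 1 := k + 1) :: nat \<Rightarrow> real"
  let ?V = "vdm (n + 1) lam"
  have inj: "inj_on lam {1..n}" using lam_inj by (rule inj_on_subset) auto
  have J: "n + 1 \<in> {1..n+1}" by simp
  have rem: "{1..n+1} - {n+1} = {1..n}" by auto
  \<comment> \<open>The factor \<open>vdm n lam\<close> left by Cauchy's determinant and the extra
    \<open>cn (n + 1)\<close> from the raised exponent together cancel the Vandermonde product in
    the denominator of \<open>DA_eq\<close>.\<close>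
  have V: "?V = vdm n lam * cn (n + 1)"
  proof -
    have "?V = (-1) ^ card {i\<in>{1..n+1}. i < n+1} * (\<Prod>s\<in>{1..n+1}-{n+1}. lam (n+1) - lam s) * vdm_on ({1..n+1}-{n+1}) lam"
      by (rule vdm_on_remove) auto
    also have "{i\<in>{1..n+1}. i < n+1} = {1..n}" by auto
    finally show ?thesis unfolding enod_sign[OF J] enod_def rem by simp
  qed
  have "(\<integral>\<nu>. wt (\<lambda>_. k) \<nu> * (\<Sum>w | w permutes {1..n}. of_int (sign w) * Qf n lam (\<nu> \<circ> w)) \<partial>Rmeas n) =
     (\<integral>\<nu>. vdm n lam * (wt ?s \<nu> * vdm n \<nu>) \<partial>Rmeas n)"
  proof (rule Bochner_Integration.integral_cong[OF refl])
    fix \<nu>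
    have "wt (\<lambda>_. k) \<nu> * (\<Sum>w | w permutes {1..n}. of_int (sign w) * Qf n lam (\<nu> \<circ> w)) =
      wt (\<lambda>_. k) \<nu> * (vdm n lam * vdm n \<nu> * (\<Prod>s\<in>{1..n}. \<nu> s - lam (n+1)))"
      unfolding sum_sign_Qf[OF inj] ..
    also have "\<dots> = wt (\<lambda>_. k) \<nu> * (vdm n lam * vdm n \<nu> * (\<Prod>s\<in>{1..n}. \<bar>\<nu> s - lam (n+1)\<bar>))"
    proof (rule wt_mult_cong)
      fix \<nu> assume \<nu>: "inbox \<nu>"
      have "\<nu> s > lam (n+1)" if "s \<in> {1..n}" for s
        using \<nu> that cell_cases(2)[OF that, of "\<nu> s" "n+1"] by auto
      then have "(\<Prod>s\<in>{1..n}. \<nu> s - lam (n+1)) = (\<Prod>s\<in>{1..n}. \<bar>\<nu> s - lam (n+1)\<bar>)"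
        by (intro prod.cong) fastforce+
      then show "vdm n lam * vdm n \<nu> * (\<Prod>s\<in>{1..n}. \<nu> s - lam (n+1)) = vdm n lam * vdm n \<nu> * (\<Prod>s\<in>{1..n}. \<bar>\<nu> s - lam (n+1)\<bar>)"
        by simp
    qed
    finally show "wt (\<lambda>_. k) \<nu> * (\<Sum>w | w permutes {1..n}. of_int (sign w) * Qf n lam (\<nu> \<circ> w)) = vdm n lam * (wt ?s \<nu> * vdm n \<nu>)"
      unfolding wt_shift[OF J, of "\<lambda>_. k"] by (simp only: mult_ac)
  qed
  also have "\<dots> = vdm n lam * DA ?s" by (simp add: DA_def)
  also have "DA ?s = (Gamma k ^ n * Gamma (k + 1)) * (?V powr (2 * k) * cn (n + 1)) / (Gamma ((n + 1) * k + 1) * ?V)"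
  proof -
    have "(\<Prod>r\<in>{1..n+1}. Gamma (?s r) * cn r powr ?s r) = (\<Prod>r\<in>{1..n+1}. Gamma (?s r)) * (\<Prod>r\<in>{1..n+1}. cn r powr ?s r)"
      by (rule prod.distrib)
    also have "(\<Prod>r\<in>{1..n+1}. Gamma (?s r)) = Gamma k ^ n * Gamma (k + 1)"
    proof -
      have "(\<Prod>r\<in>{1..n}. Gamma (?s r)) = (\<Prod>r\<in>{1..n}. Gamma k)" by (intro prod.cong) auto
      then show ?thesis unfolding prod.remove[OF finite_atLeastAtMost J] rem by simp
    qed
    also have "(\<Prod>r\<in>{1..n+1}. cn r powr ?s r) = (\<Prod>r\<in>{1..n+1}. cn r powr k) * cn (n + 1)"
    proof -
      have "(\<Prod>r\<in>{1..n}. cn r powr ?s r) = (\<Prod>r\<in>{1..n}. cn r powr k)" by (intro prod.cong) auto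
      then show ?thesis
        unfolding prod.remove[OF finite_atLeastAtMost J] rem using cn_pos[OF J] by (simp add: powr_add)
    qed
    also have "(\<Prod>r\<in>{1..n+1}. cn r powr k) = (\<Prod>r\<in>{1..n+1}. cn r) powr k"
      by (intro prod_powr_distrib[symmetric])
    also have "\<dots> = ?V powr (2 * k)"
      unfolding prod_cn mult_2 powr_add using vdm_lam_pos by (intro powr_mult)
    finally have P: "(\<Prod>r\<in>{1..n+1}. Gamma (?s r) * cn r powr ?s r) = (Gamma k ^ n * Gamma (k + 1)) * (?V powr (2 * k) * cn (n + 1))" .
    have "(\<Sum>r\<in>{1..n}. ?s r) = (\<Sum>r\<in>{1..n}. k)" by (intro sum.cong) auto
    then have "(\<Sum>r\<in>{1..n+1}. ?s r) = (k + 1) + n * k"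
      unfolding sum.remove[OF finite_atLeastAtMost J] rem by simp
    also have "\<dots> = (n + 1) * k + 1" by (simp add: algebra_simps)
    finally have "(\<Sum>r\<in>{1..n+1}. ?s r) = (n + 1) * k + 1" .
    moreover have "?s r > 0" for r using k by auto
    ultimately show ?thesis using DA_eq[of ?s] unfolding P by metis
  qed
  finally have I: "(\<integral>\<nu>. wt (\<lambda>_. k) \<nu> * (\<Sum>w | w permutes {1..n}. of_int (sign w) * Qf n lam (\<nu> \<circ> w)) \<partial>Rmeas n) =
     (vdm n lam * cn (n + 1) / ?V) * (Gamma k ^ n * Gamma (k + 1) * ?V powr (2 * k) / Gamma ((n + 1) * k + 1))"
    by (simp only: mult_ac times_divide_eq_right times_divide_eq_left divide_divide_eq_left)
  have G1: "Gamma (k + 1) = k * Gamma k"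
    using k nonpos_Ints_nonpos[of k] by (intro Gamma_plus1) auto
  have G2: "Gamma ((n + 1) * k + 1) = ((n + 1) * k) * Gamma ((n + 1) * k)"
    using k nonpos_Ints_nonpos[of "(n + 1) * k"] by (intro Gamma_plus1) (force simp: mult_le_0_iff)
  have v1: "vdm n lam * cn (n + 1) / ?V = 1" using vdm_lam_pos unfolding V[symmetric] by simp
  have alg: "N * h / g ^ (n + 1) / v * (1 * (g ^ n * (k * g) * v / (N * k * h))) = 1"
    if "g > 0" "h > 0" "v > 0" "N > 0" for g h v N :: real
    using that k by simp
  show ?thesis
    unfolding I c_nk_def G1 G2 v1
    by (rule alg) (use k vdm_lam_pos in \<open>auto intro!: Gamma_real_pos\<close>)
qed

end

section \<open>The Euler relation for the averaging operator\<close>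

lemma swapc_eq_comp: "swapc i j x = x \<circ> Transposition.transpose i j"
  by (auto simp: swapc_def transpose_def fun_eq_iff)

lemma pnod_permute:
  assumes "p permutes {1..m}"
  shows "pnod m (x \<circ> p) t = pnod m x t"
  unfolding pnod_def using prod.permute[OF assms, of "\<lambda>r. t - x r"] by (simp add: comp_def)

lemma sum_enod_permute:
  assumes "p permutes {1..m}"
  shows "(\<Sum>r\<in>{1..m}. enod m (x \<circ> p) r t) = (\<Sum>r\<in>{1..m}. enod m x r t)"
proof -
  have "enod m (x \<circ> p) r t = enod m x (p r) t" if "r \<in> {1..m}" for r
  proof -
    have "inj_on p ({1..m}-{r})" using permutes_inj[OF assms] by (rule inj_on_subset) auto
    moreover have "p ` ({1..m}-{r}) = {1..m}-{p r}"
      using permutes_image[OF assms] permutes_inj[OF assms] by (subst image_set_diff) auto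
    ultimately have "bij_betw p ({1..m}-{r}) ({1..m}-{p r})" by (simp add: bij_betw_def)
    then show ?thesis unfolding enod_def comp_def by (rule prod.reindex_bij_betw)
  qed
  then have "(\<Sum>r\<in>{1..m}. enod m (x \<circ> p) r t) = (\<Sum>r\<in>{1..m}. enod m x (p r) t)" by simp
  also have "\<dots> = (\<Sum>r\<in>{1..m}. enod m x r t)"
    using sum.permute[OF assms, of "\<lambda>r. enod m x r t"] by (simp add: comp_def)
  finally show ?thesis .
qed

lemma enod_eq_pnod: "r \<in> {1..m} \<Longrightarrow> t \<noteq> x r \<Longrightarrow> enod m x r t = pnod m x t / (t - x r)"
  unfolding pnod_def enod_def by (subst prod.remove[of _ r]) auto

text \<open>One pair for each transposition, so sums over it are sums over the reflections of the
  root system.\<close>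

definition prs :: "nat \<Rightarrow> (nat \<times> nat) set" where
  "prs m = {(i, j). i \<in> {1..m} \<and> j \<in> {1..m} \<and> i < j}"

lemma finite_prs [simp]: "finite (prs m)"
  by (rule finite_subset[of _ "{1..m} \<times> {1..m}"]) (auto simp: prs_def)

lemma sum_offdiag:
  fixes F :: "nat \<Rightarrow> nat \<Rightarrow> real"
  shows "(\<Sum>j\<in>{1..m}. \<Sum>i\<in>{1..m}-{j}. F i j) = (\<Sum>(i, j)\<in>prs m. F i j + F j i)"
proof -
  let ?S = "SIGMA j:{1..m}. {1..m}-{j}"
  have S: "?S = prs m \<union> prod.swap ` prs m" by (auto simp: prs_def image_iff)
  have dis: "prs m \<inter> prod.swap ` prs m = {}" by (auto simp: prs_def)
  have "(\<Sum>j\<in>{1..m}. \<Sum>i\<in>{1..m}-{j}. F i j) = (\<Sum>(j, i)\<in>?S. F i j)"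
    by (rule sum.Sigma) auto
  also have "\<dots> = (\<Sum>(j, i)\<in>prs m. F i j) + (\<Sum>(j, i)\<in>prod.swap ` prs m. F i j)"
    unfolding S using sum.union_disjoint[OF finite_prs finite_imageI[OF finite_prs] dis] .
  also have "(\<Sum>(j, i)\<in>prod.swap ` prs m. F i j) = (\<Sum>(i, j)\<in>prs m. F i j)"
    by (subst sum.reindex) (auto simp: case_prod_unfold)
  finally show ?thesis by (simp add: sum.distrib case_prod_unfold add.commute)
qed

lemma sum_prs_Suc:
  fixes F :: "nat \<Rightarrow> nat \<Rightarrow> real"
  shows "(\<Sum>(i, j)\<in>prs (n + 1). F i j) = (\<Sum>(i, j)\<in>prs n. F i j) + (\<Sum>i\<in>{1..n}. F i (n + 1))"
proof -
  have eq: "prs (n + 1) = prs n \<union> (\<lambda>i. (i, n + 1)) ` {1..n}" by (auto simp: prs_def image_iff)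
  have dis: "prs n \<inter> (\<lambda>i. (i, n + 1)) ` {1..n} = {}" by (auto simp: prs_def)
  have "(\<Sum>(i, j)\<in>prs (n + 1). F i j) = (\<Sum>(i, j)\<in>prs n. F i j) + (\<Sum>(i, j)\<in>(\<lambda>i. (i, n + 1)) ` {1..n}. F i j)"
    unfolding eq using sum.union_disjoint[OF finite_prs finite_imageI[OF finite_atLeastAtMost] dis] .
  also have "(\<Sum>(i, j)\<in>(\<lambda>i. (i, n + 1)) ` {1..n}. F i j) = (\<Sum>i\<in>{1..n}. F i (n + 1))"
    by (subst sum.reindex) (auto simp: inj_on_def)
  finally show ?thesis .
qed

text \<open>The numerator is symmetric in the y and in the nodes, so the effect of an exchange can
  be read off from the denominator alone.\<close>

lemma Qf_quotient:
  assumes "\<And>s. s \<in> {1..n} \<Longrightarrow> y s \<noteq> x s"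
  shows "Qf n x y = (\<Prod>s\<in>{1..n}. (-1) ^ (s - 1)) * (\<Prod>s\<in>{1..n}. pnod (n+1) x (y s)) / (\<Prod>s\<in>{1..n}. y s - x s)"
proof -
  have "Qf n x y = (\<Prod>s\<in>{1..n}. (-1) ^ (s - 1) * (pnod (n+1) x (y s) / (y s - x s)))"
    unfolding Qf_eq_enod using assms by (intro prod.cong refl) (simp add: enod_eq_pnod)
  then show ?thesis by (simp only: prod.distrib prod_dividef times_divide_eq_right)
qed

text \<open>By \<open>Qf_quotient\<close> only the denominator changes, and exchanging two of the x
  changes it in the same way as exchanging two of the y.\<close>

lemma Qf_swap:
  assumes ij: "i \<in> {1..n}" "j \<in> {1..n}" "i \<noteq> j"
    and ne: "\<And>s r. s \<in> {1..n} \<Longrightarrow> r \<in> {1..n+1} \<Longrightarrow> y s \<noteq> x r"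
  shows "Qf n (swapc i j x) y = Qf n x y * ((y i - x i) * (y j - x j) / ((y i - x j) * (y j - x i)))"
    and "Qf n x (swapc i j y) = Qf n x y * ((y i - x i) * (y j - x j) / ((y i - x j) * (y j - x i)))"
proof -
  let ?c = "\<Prod>s\<in>{1..n}. (-1::real) ^ (s - 1)" and ?P = "\<Prod>s\<in>{1..n}. pnod (n+1) x (y s)"
  let ?R = "\<Prod>s\<in>{1..n}-{i}-{j}. y s - x s"
  have split: "prod f {1..n} = f i * (f j * prod f ({1..n}-{i}-{j}))" for f :: "nat \<Rightarrow> real"
    using ij by (subst prod.remove[of _ i], simp, simp, subst prod.remove[of _ j]) auto
  have pij: "Transposition.transpose i j permutes {1..n+1}" "Transposition.transpose i j permutes {1..n}"
    using ij by (auto intro: permutes_swap_id)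
  have Q: "Qf n x y = ?c * ?P / (\<Prod>s\<in>{1..n}. y s - x s)"
    using ne by (intro Qf_quotient) auto
  have q: "(\<Prod>s\<in>{1..n}. y s - x s) = (y i - x i) * ((y j - x j) * ?R)" by (rule split)
  have nz: "y i - x i \<noteq> 0" "y j - x j \<noteq> 0" "y i - x j \<noteq> 0" "y j - x i \<noteq> 0" using ne ij by auto
  have fin: "?c * ?P / ((y i - x j) * ((y j - x i) * ?R)) = Qf n x y * ((y i - x i) * (y j - x j) / ((y i - x j) * (y j - x i)))"
    unfolding Q q using nz by (simp add: divide_simps)
  have "Qf n (swapc i j x) y = ?c * (\<Prod>s\<in>{1..n}. pnod (n+1) (swapc i j x) (y s)) / (\<Prod>s\<in>{1..n}. y s - swapc i j x s)"
  proof (rule Qf_quotient)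
    fix s assume "s \<in> {1..n}"
    then show "y s \<noteq> swapc i j x s" using ne[of s s] ne[of s i] ne[of s j] ij by (auto simp: swapc_def)
  qed
  also have "(\<Prod>s\<in>{1..n}. y s - swapc i j x s) = (y i - x j) * ((y j - x i) * ?R)"
    unfolding split[of "\<lambda>s. y s - swapc i j x s"]
    using ij by (auto simp: swapc_def intro!: prod.cong)
  also have "(\<Prod>s\<in>{1..n}. pnod (n+1) (swapc i j x) (y s)) = ?P"
    unfolding swapc_eq_comp pnod_permute[OF pij(1)] ..
  finally show "Qf n (swapc i j x) y = Qf n x y * ((y i - x i) * (y j - x j) / ((y i - x j) * (y j - x i)))"
    unfolding fin .
  have "Qf n x (swapc i j y) = ?c * (\<Prod>s\<in>{1..n}. pnod (n+1) x (swapc i j y s)) / (\<Prod>s\<in>{1..n}. swapc i j y s - x s)"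
  proof (rule Qf_quotient)
    fix s assume "s \<in> {1..n}"
    then show "swapc i j y s \<noteq> x s" using ne[of s s] ne[of i s] ne[of j s] ij by (auto simp: swapc_def)
  qed
  also have "(\<Prod>s\<in>{1..n}. swapc i j y s - x s) = (y i - x j) * ((y j - x i) * ?R)"
    unfolding split[of "\<lambda>s. swapc i j y s - x s"]
    using ij by (auto simp: swapc_def intro!: prod.cong)
  also have "(\<Prod>s\<in>{1..n}. pnod (n+1) x (swapc i j y s)) = ?P"
    unfolding swapc_eq_comp using prod.permute[OF pij(2), of "\<lambda>s. pnod (n+1) x (y s)"] by (simp add: comp_def)
  finally show "Qf n x (swapc i j y) = Qf n x y * ((y i - x i) * (y j - x j) / ((y i - x j) * (y j - x i)))"
    unfolding fin .
qed

text \<open>The index n + 1 has no partner among the y, so a single factor of the denominator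
  changes.\<close>

lemma Qf_swap_last:
  assumes i: "i \<in> {1..n}"
    and ne: "\<And>s r. s \<in> {1..n} \<Longrightarrow> r \<in> {1..n+1} \<Longrightarrow> y s \<noteq> x r"
  shows "Qf n (swapc i (n+1) x) y = Qf n x y * ((y i - x i) / (y i - x (n+1)))"
proof -
  let ?c = "\<Prod>s\<in>{1..n}. (-1::real) ^ (s - 1)" and ?P = "\<Prod>s\<in>{1..n}. pnod (n+1) x (y s)"
  let ?R = "\<Prod>s\<in>{1..n}-{i}. y s - x s"
  have split: "prod f {1..n} = f i * prod f ({1..n}-{i})" for f :: "nat \<Rightarrow> real"
    using i by (intro prod.remove) auto
  have pij: "Transposition.transpose i (n+1) permutes {1..n+1}"
    using i by (auto intro: permutes_swap_id)
  have Q: "Qf n x y = ?c * ?P / (\<Prod>s\<in>{1..n}. y s - x s)"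
    using ne by (intro Qf_quotient) auto
  have q: "(\<Prod>s\<in>{1..n}. y s - x s) = (y i - x i) * ?R" by (rule split)
  have nz: "y i - x i \<noteq> 0" "y i - x (n+1) \<noteq> 0" using ne i by auto
  have "Qf n (swapc i (n+1) x) y = ?c * (\<Prod>s\<in>{1..n}. pnod (n+1) (swapc i (n+1) x) (y s)) / (\<Prod>s\<in>{1..n}. y s - swapc i (n+1) x s)"
  proof (rule Qf_quotient)
    fix s assume "s \<in> {1..n}"
    then show "y s \<noteq> swapc i (n+1) x s" using ne[of s s] ne[of s i] ne[of s "n+1"] i by (auto simp: swapc_def)
  qed
  also have "(\<Prod>s\<in>{1..n}. y s - swapc i (n+1) x s) = (y i - x (n+1)) * ?R"
    unfolding split[of "\<lambda>s. y s - swapc i (n+1) x s"]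
    by (auto simp: swapc_def intro!: prod.cong)
  also have "(\<Prod>s\<in>{1..n}. pnod (n+1) (swapc i (n+1) x) (y s)) = ?P"
    unfolding swapc_eq_comp pnod_permute[OF pij(1)] ..
  also have "?c * ?P / ((y i - x (n+1)) * ?R) = Qf n x y * ((y i - x i) / (y i - x (n+1)))"
    unfolding Q q using nz by (simp add: divide_simps)
  finally show ?thesis .
qed

text \<open>Applied with p = y_i, q = y_j, a = x_i, b = x_j. Over the common denominator (p - b)(q -
  a), one minus the exchange ratio has the factor p - q, which cancels the last denominator; the
  rest is a polynomial identity.\<close>

lemma pair_identity:
  fixes p q a b :: real
  assumes "p \<noteq> q" "p \<noteq> b" "q \<noteq> a"
  shows "1 + (p - a) * (q - b) / ((p - b) * (q - a)) =
    (p - a) / (p - b) + (q - b) / (q - a) + (a - b) * (1 - (p - a) * (q - b) / ((p - b) * (q - a))) / (p - q)"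
proof -
  have nz: "p - q \<noteq> 0" "p - b \<noteq> 0" "q - a \<noteq> 0" using assms by auto
  have "1 - (p - a) * (q - b) / ((p - b) * (q - a)) = ((p - b) * (q - a) - (p - a) * (q - b)) / ((p - b) * (q - a))"
    using nz by (simp add: diff_divide_distrib)
  also have "(p - b) * (q - a) - (p - a) * (q - b) = - (a - b) * (p - q)" by algebra
  finally have "(a - b) * (1 - (p - a) * (q - b) / ((p - b) * (q - a))) / (p - q) = - (a - b) * (a - b) / ((p - b) * (q - a))"
    using nz by simp
  moreover have "(p - a) / (p - b) + (q - b) / (q - a) = ((p - a) * (q - a) + (q - b) * (p - b)) / ((p - b) * (q - a))"
    using nz by (simp add: add_divide_distrib)
  moreover have "1 + (p - a) * (q - b) / ((p - b) * (q - a)) = ((p - b) * (q - a) + (p - a) * (q - b)) / ((p - b) * (q - a))"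
    using nz by (simp add: add_divide_distrib)
  moreover have "(p - b) * (q - a) + (p - a) * (q - b) = (p - a) * (q - a) + (q - b) * (p - b) + - (a - b) * (a - b)"
    by algebra
  ultimately show ?thesis by (simp add: add_divide_distrib)
qed

text \<open>All terms are \<open>Qf n x y\<close> times rational functions. Pairs inside {1..n}
  reduce to \<open>pair_identity\<close>; a pair (i, n+1) matches the two terms r = i and r = n+1
  for s = i.\<close>

lemma Qf_identity:
  assumes inj: "inj_on y {1..n}"
    and ne: "\<And>s r. s \<in> {1..n} \<Longrightarrow> r \<in> {1..n+1} \<Longrightarrow> y s \<noteq> x r"
  shows "(\<Sum>(i, j)\<in>prs (n+1). Qf n x y + Qf n (swapc i j x) y) =
    (\<Sum>s\<in>{1..n}. \<Sum>r\<in>{1..n+1}. Qf n x y * ((y s - x s) / (y s - x r))) +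
    (\<Sum>(s, t)\<in>prs n. (x s - x t) * ((Qf n x y - Qf n x (swapc s t y)) / (y s - y t)))"
proof -
  let ?Q = "Qf n x y"
  let ?X = "\<lambda>i j. (y i - x i) * (y j - x j) / ((y i - x j) * (y j - x i))"
  let ?f = "\<lambda>s r. (y s - x s) / (y s - x r)"
  have p: "i \<in> {1..n}" "j \<in> {1..n}" "i \<noteq> j" if "(i, j) \<in> prs n" for i j using that by (auto simp: prs_def)
  have L: "(\<Sum>(i, j)\<in>prs (n+1). ?Q + Qf n (swapc i j x) y) =
     (\<Sum>(i, j)\<in>prs n. ?Q * (1 + ?X i j)) + (\<Sum>i\<in>{1..n}. ?Q * (1 + ?f i (n+1)))"
    unfolding sum_prs_Suc using Qf_swap(1)[OF p ne] Qf_swap_last[OF _ ne]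
    by (intro arg_cong2[where f = "(+)"] sum.cong refl) (auto simp: distrib_left)
  have "(\<Sum>r\<in>{1..n+1}. ?Q * ?f s r) = ?Q * (1 + ?f s (n+1)) + (\<Sum>r\<in>{1..n}-{s}. ?Q * ?f s r)" if s: "s \<in> {1..n}" for s
  proof -
    have "{1..n+1} = insert s (insert (n+1) ({1..n}-{s}))" using s by auto
    moreover have "s \<notin> insert (n+1) ({1..n}-{s})" using s by auto
    moreover have "?f s s = 1" using ne[of s s] s by simp
    ultimately show ?thesis using ne[of s s] s by (simp add: distrib_left)
  qed
  then have "(\<Sum>s\<in>{1..n}. \<Sum>r\<in>{1..n+1}. ?Q * ?f s r) =
     (\<Sum>s\<in>{1..n}. ?Q * (1 + ?f s (n+1))) + (\<Sum>s\<in>{1..n}. \<Sum>r\<in>{1..n}-{s}. ?Q * ?f s r)"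
    by (simp add: sum.distrib)
  also have "(\<Sum>s\<in>{1..n}. \<Sum>r\<in>{1..n}-{s}. ?Q * ?f s r) = (\<Sum>(i, j)\<in>prs n. ?Q * ?f j i + ?Q * ?f i j)"
    by (rule sum_offdiag)
  finally have R: "(\<Sum>s\<in>{1..n}. \<Sum>r\<in>{1..n+1}. ?Q * ?f s r) =
     (\<Sum>s\<in>{1..n}. ?Q * (1 + ?f s (n+1))) + (\<Sum>(i, j)\<in>prs n. ?Q * ?f j i + ?Q * ?f i j)" .
  have "?Q * (1 + ?X i j) = (?Q * ?f j i + ?Q * ?f i j) + (x i - x j) * ((?Q - Qf n x (swapc i j y)) / (y i - y j))"
    if ij: "(i, j) \<in> prs n" for i j
  proof -
    have "y i \<noteq> y j" using inj_onD[OF inj, of i j] p[OF ij] by blast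
    then have *: "1 + ?X i j = ?f i j + ?f j i + (x i - x j) * (1 - ?X i j) / (y i - y j)"
      using ne p[OF ij] by (intro pair_identity) auto
    have sw: "?Q - Qf n x (swapc i j y) = ?Q * (1 - ?X i j)"
      using Qf_swap(2)[OF p[OF ij], of y x] ne by (simp add: right_diff_distrib)
    have "?Q * (1 + ?X i j) = ?Q * (?f i j + ?f j i + (x i - x j) * (1 - ?X i j) / (y i - y j))"
      using * by (rule arg_cong)
    also have "\<dots> = (?Q * ?f j i + ?Q * ?f i j) + (x i - x j) * (?Q * (1 - ?X i j) / (y i - y j))"
      by (simp only: distrib_left times_divide_eq_right mult_ac add_ac)
    finally show ?thesis unfolding sw .
  qed
  then have "(\<Sum>(i, j)\<in>prs n. ?Q * (1 + ?X i j)) = (\<Sum>(i, j)\<in>prs n. ?Q * ?f j i + ?Q * ?f i j) +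
     (\<Sum>(i, j)\<in>prs n. (x i - x j) * ((?Q - Qf n x (swapc i j y)) / (y i - y j)))"
    unfolding sum.distrib[symmetric] by (intro sum.cong refl) auto
  then show ?thesis unfolding L R by simp
qed


section \<open>Antisymmetrised integrals over the box\<close>

lemma Qf_poly_fun: "Qf n x \<in> poly_fun n"
  unfolding Qf_eq_enod[abs_def] enod_def
  by (intro poly_fun_prod poly_fun.pmult poly_fun_diff poly_fun.pvar poly_fun.pconst) auto

definition alt :: "nat \<Rightarrow> ((nat \<Rightarrow> real) \<Rightarrow> real) \<Rightarrow> (nat \<Rightarrow> real) \<Rightarrow> real" where
  "alt n g \<nu> = (\<Sum>w | w permutes {1..n}. of_int (sign w) * g (\<nu> \<circ> w))"

lemma alt_poly_fun: "g \<in> poly_fun n \<Longrightarrow> alt n g \<in> poly_fun n"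
  unfolding alt_def[abs_def]
  by (intro poly_fun_sum poly_fun.pmult poly_fun.pconst poly_fun_permute) auto

lemma alt_add: "alt n (\<lambda>y. g y + h y) \<nu> = alt n g \<nu> + alt n h \<nu>"
  unfolding alt_def by (simp add: distrib_left sum.distrib)

lemma alt_diff: "alt n (\<lambda>y. g y - h y) \<nu> = alt n g \<nu> - alt n h \<nu>"
  unfolding alt_def by (simp add: right_diff_distrib sum_subtractf)

lemma alt_cmult: "alt n (\<lambda>y. c * g y) \<nu> = c * alt n g \<nu>"
  unfolding alt_def sum_distrib_left by (simp only: mult_ac)

lemma alt_sum: "alt n (\<lambda>y. \<Sum>i\<in>I. g i y) \<nu> = (\<Sum>i\<in>I. alt n (g i) \<nu>)"
  unfolding alt_def sum_distrib_left by (rule sum.swap)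

lemma alt_cong: "(\<And>w. w permutes {1..n} \<Longrightarrow> g (\<nu> \<circ> w) = h (\<nu> \<circ> w)) \<Longrightarrow> alt n g \<nu> = alt n h \<nu>"
  unfolding alt_def by (intro sum.cong) auto

text \<open>Right multiplication by a transposition permutes the group and reverses the sign. Hence
  \<open>alt\<close> annihilates a function plus its exchange, which is how \<open>AA_euler\<close>
  uses it.\<close>

lemma alt_swapc:
  assumes st: "s \<in> {1..n}" "t \<in> {1..n}" "s \<noteq> t"
  shows "alt n (\<lambda>y. g (swapc s t y)) \<nu> = - alt n g \<nu>"
proof -
  let ?\<tau> = "Transposition.transpose s t"
  let ?P = "{w. w permutes {1..n}}"
  have \<tau>: "?\<tau> permutes {1..n}" using st by (intro permutes_swap_id)
  have "- alt n g \<nu> = (\<Sum>w\<in>?P. - of_int (sign w) * g (\<nu> \<circ> w))"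
    unfolding alt_def by (simp add: sum_negf)
  also have "\<dots> = (\<Sum>w\<in>?P. of_int (sign w) * g (swapc s t (\<nu> \<circ> w)))"
  proof (rule sum.reindex_bij_witness[where i = "\<lambda>w. w \<circ> ?\<tau>" and j = "\<lambda>w. w \<circ> ?\<tau>"])
    fix w assume "w \<in> ?P"
    then have w: "w permutes {1..n}" by simp
    show "w \<circ> ?\<tau> \<circ> ?\<tau> = w" by (simp add: comp_assoc)
    show "w \<circ> ?\<tau> \<in> ?P" using permutes_compose[OF \<tau> w] by simp
    have "sign (w \<circ> ?\<tau>) = - sign w"
      using st permutes_imp_permutation[OF _ w]
      by (subst sign_compose) (auto simp: sign_swap_id permutation_swap_id)
    moreover have "swapc s t (\<nu> \<circ> (w \<circ> ?\<tau>)) = \<nu> \<circ> w"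
      by (simp add: swapc_eq_comp comp_assoc)
    ultimately show "of_int (sign (w \<circ> ?\<tau>)) * g (swapc s t (\<nu> \<circ> (w \<circ> ?\<tau>))) = - of_int (sign w) * g (\<nu> \<circ> w)"
      by simp
  next
    fix w assume "w \<in> ?P"
    then have w: "w permutes {1..n}" by simp
    show "w \<circ> ?\<tau> \<circ> ?\<tau> = w" by (simp add: comp_assoc)
    show "w \<circ> ?\<tau> \<in> ?P" using permutes_compose[OF \<tau> w] by simp
  qed
  finally show ?thesis unfolding alt_def by simp
qed

context chamber
begin

text \<open>Only \<open>Qf\<close> sees the orbit point \<open>x\<close>. The sign of the
  permutation is attached later, in \<open>power_formula\<close>.\<close>

definition AA :: "real \<Rightarrow> (nat \<Rightarrow> real) \<Rightarrow> ((nat \<Rightarrow> real) \<Rightarrow> real) \<Rightarrow> real" where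
  "AA k x g = (\<integral>\<nu>. wt (\<lambda>_. k) \<nu> * alt n (\<lambda>y. Qf n x y * g y) \<nu> \<partial>Rmeas n)"

lemma wt_alt_integrable:
  "k > 0 \<Longrightarrow> g \<in> poly_fun n \<Longrightarrow> integrable (Rmeas n) (\<lambda>\<nu>. wt (\<lambda>_. k) \<nu> * alt n g \<nu>)"
  by (intro wt_poly_integrable alt_poly_fun)

text \<open>The product over s' is \<open>Qf\<close> without its s-th factor; it does not involve
  coordinate s and passes through the derivative. Each permutation w of the antisymmetrisation is an
  instance of \<open>wt_by_parts\<close> in direction \<open>w s\<close>.\<close>

lemma alt_by_parts:
  assumes k: "k > 0" and g: "g \<in> poly_fun n" and s: "s \<in> {1..n}"
  shows "(\<integral>\<nu>. wt (\<lambda>_. k) \<nu> * alt n (\<lambda>y. (\<Prod>s'\<in>{1..n}-{s}. (-1) ^ (s' - 1) * enod (n+1) x s' (y s')) *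
     (pnod (n+1) lam (y s) * pd s g y + g y * (\<Sum>r\<in>{1..n+1}. k * enod (n+1) lam r (y s)))) \<nu> \<partial>Rmeas n) = 0"
proof -
  define C where "C = (\<lambda>y::nat\<Rightarrow>real. \<Prod>s'\<in>{1..n}-{s}. (-1) ^ (s' - 1) * enod (n+1) x s' (y s'))"
  let ?G = "\<lambda>y. C y * (pnod (n+1) lam (y s) * pd s g y + g y * (\<Sum>r\<in>{1..n+1}. k * enod (n+1) lam r (y s)))"
  have Cp: "C \<in> poly_fun n"
    unfolding C_def enod_def by (intro poly_fun_prod poly_fun.pmult poly_fun_diff poly_fun.pvar poly_fun.pconst) auto
  have Gp: "?G \<in> poly_fun n"
    unfolding enod_def pnod_def using Cp g s
    by (intro poly_fun.pmult poly_fun.padd poly_fun_pd poly_fun_sum poly_fun_prod poly_fun_diff poly_fun.pvar poly_fun.pconst) auto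
  have 0: "(\<integral>\<nu>. wt (\<lambda>_. k) \<nu> * ?G (\<nu> \<circ> w) \<partial>Rmeas n) = 0" if w: "w permutes {1..n}" for w
  proof -
    let ?u = "w s" and ?H = "\<lambda>\<nu>. C (\<nu> \<circ> w) * g (\<nu> \<circ> w)"
    have u: "?u \<in> {1..n}" using s permutes_in_image[OF w] by simp
    have H: "?H \<in> poly_fun n" using poly_fun_permute[OF poly_fun.pmult[OF Cp g] w] .
    \<comment> \<open>A derivative of the composed function in coordinate \<open>w s\<close> becomes
      a derivative of the original one in coordinate s.\<close>
    have upd: "(\<nu>(?u := t)) \<circ> w = (\<nu> \<circ> w)(s := t)" for \<nu> :: "nat \<Rightarrow> real" and t
      using permutes_inj[OF w] by (auto simp: fun_eq_iff inj_def)
    have "pd ?u ?H \<nu> = C (\<nu> \<circ> w) * pd s g (\<nu> \<circ> w)" for \<nu>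
    proof -
      have "C ((\<nu> \<circ> w)(s := t)) = C (\<nu> \<circ> w)" for t
        unfolding C_def by (intro prod.cong) auto
      then have "pd ?u ?H \<nu> = deriv (\<lambda>t. C (\<nu> \<circ> w) * g ((\<nu> \<circ> w)(s := t))) ((\<nu> \<circ> w) s)"
        unfolding pd_def upd by simp
      also have "\<dots> = C (\<nu> \<circ> w) * pd s g ((\<nu> \<circ> w)(s := (\<nu> \<circ> w) s))"
        by (rule DERIV_imp_deriv, rule DERIV_cmult, rule poly_fun_has_derivative[OF g])
      also have "(\<nu> \<circ> w)(s := (\<nu> \<circ> w) s) = \<nu> \<circ> w" by (rule fun_upd_triv)
      finally show ?thesis .
    qed
    then have eq: "wt (\<lambda>_. k) \<nu> * ?G (\<nu> \<circ> w) = wt (\<lambda>_. k) \<nu> * (pnod (n+1) lam (\<nu> ?u) * pd ?u ?H \<nu> + ?H \<nu> * (\<Sum>r\<in>{1..n+1}. k * enod (n+1) lam r (\<nu> ?u)))" for \<nu>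
      by (simp only: comp_def distrib_left mult_ac)
    show ?thesis
      unfolding eq by (rule wt_by_parts[where s = "\<lambda>_. k", OF u _ H]) (use k in simp)
  qed
  have "(\<integral>\<nu>. wt (\<lambda>_. k) \<nu> * alt n ?G \<nu> \<partial>Rmeas n) =
     (\<integral>\<nu>. (\<Sum>w | w permutes {1..n}. of_int (sign w) * (wt (\<lambda>_. k) \<nu> * ?G (\<nu> \<circ> w))) \<partial>Rmeas n)"
    unfolding alt_def sum_distrib_left by (simp only: mult_ac)
  also have "\<dots> = (\<Sum>w | w permutes {1..n}. of_int (sign w) * (\<integral>\<nu>. wt (\<lambda>_. k) \<nu> * ?G (\<nu> \<circ> w) \<partial>Rmeas n))"
  proof (subst Bochner_Integration.integral_sum)
    fix w assume "w \<in> {w. w permutes {1..n}}"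
    then have "(\<lambda>\<nu>. ?G (\<nu> \<circ> w)) \<in> poly_fun n" using poly_fun_permute[OF Gp] by simp
    then show "integrable (Rmeas n) (\<lambda>\<nu>. of_int (sign w) * (wt (\<lambda>_. k) \<nu> * ?G (\<nu> \<circ> w)))"
      using k by (intro integrable_mult_right wt_poly_integrable) auto
  qed simp
  also have "\<dots> = 0" using 0 by (intro sum.neutral) simp
  finally show ?thesis unfolding C_def .
qed

text \<open>The Euler part of the intertwining relation: after symmetrisation the total derivatives of
  \<open>alt_by_parts\<close> and \<open>Qf_identity\<close> cancel all terms pointwise.\<close>
lemma AA_euler:
  assumes k: "k > 0" and \<sigma>: "\<sigma> permutes {1..n+1}" and g: "g \<in> poly_fun n" and \<rho>: "\<rho> \<in> poly_fun n"
    and x: "x = lam \<circ> \<sigma>"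
    and rho: "\<And>y. y \<in> Rsp n \<Longrightarrow> inj_on y {1..n} \<Longrightarrow> \<rho> y = (\<Sum>s\<in>{1..n}. (x s - y s) * pd s g y) +
       k * (\<Sum>(s, t)\<in>prs n. (x s - x t) * ((g y - g (swapc s t y)) / (y s - y t)))"
  shows "k * (\<Sum>(i, j)\<in>prs (n+1). AA k x g + AA k (swapc i j x) g) = AA k x \<rho>"
proof -
  define C where "C = (\<lambda>s (y::nat\<Rightarrow>real). \<Prod>s'\<in>{1..n}-{s}. (-1) ^ (s' - 1) * enod (n+1) x s' (y s'))"
  define G where "G = (\<lambda>s y. C s y * (pnod (n+1) lam (y s) * pd s g y + g y * (\<Sum>r\<in>{1..n+1}. k * enod (n+1) lam r (y s))))"
  define h where "h = (\<lambda>s t y. Qf n x y * g (swapc s t y) / (y s - y t))"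
  have Cp: "C s \<in> poly_fun n" for s
    unfolding C_def enod_def by (intro poly_fun_prod poly_fun.pmult poly_fun_diff poly_fun.pvar poly_fun.pconst) auto
  have Gp: "G s \<in> poly_fun n" if "s \<in> {1..n}" for s
    unfolding enod_def pnod_def G_def using Cp g that
    by (intro poly_fun.pmult poly_fun.padd poly_fun_pd poly_fun_sum poly_fun_prod poly_fun_diff poly_fun.pvar poly_fun.pconst) auto
  have pw: "k * (\<Sum>(i, j)\<in>prs (n+1). Qf n x y + Qf n (swapc i j x) y) * g y - Qf n x y * \<rho> y =
      (\<Sum>s\<in>{1..n}. (-1) ^ (s - 1) * G s y) + k * (\<Sum>(s, t)\<in>prs n. (x s - x t) * (h s t y + h s t (swapc s t y)))"
    if y: "y \<in> Rsp n" "inj_on y {1..n}" and ne: "\<And>s r. s \<in> {1..n} \<Longrightarrow> r \<in> {1..n+1} \<Longrightarrow> y s \<noteq> x r" for y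
  proof -
    let ?Q = "Qf n x y"
    have Gs: "(-1) ^ (s - 1) * G s y = k * (\<Sum>r\<in>{1..n+1}. ?Q * ((y s - x s) / (y s - x r))) * g y - ?Q * ((x s - y s) * pd s g y)"
      if s: "s \<in> {1..n}" for s
    proof -
      \<comment> \<open>The node polynomial is symmetric in its nodes, so that of the orbit point
        \<open>x\<close> is that of \<open>lam\<close>, to which the weight belongs.\<close>
      have e: "enod (n+1) x r (y s) = pnod (n+1) lam (y s) / (y s - x r)" if "r \<in> {1..n+1}" for r
        using enod_eq_pnod[of r "n+1" "y s" x] ne[OF s that] that pnod_permute[OF \<sigma>, of lam] x by simp
      have "?Q = (-1) ^ (s - 1) * enod (n+1) x s (y s) * C s y"
        unfolding Qf_eq_enod C_def using s by (intro prod.remove) auto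
      also have "\<dots> = (-1) ^ (s - 1) * C s y * (pnod (n+1) lam (y s) / (y s - x s))"
        using e[of s] s by simp
      finally have Q: "?Q * (y s - x s) = (-1) ^ (s - 1) * C s y * pnod (n+1) lam (y s)"
        using ne[OF s, of s] s by simp
      have "(\<Sum>r\<in>{1..n+1}. k * enod (n+1) lam r (y s)) = k * (\<Sum>r\<in>{1..n+1}. enod (n+1) x r (y s))"
        unfolding x sum_enod_permute[OF \<sigma>] sum_distrib_left ..
      also have "(\<Sum>r\<in>{1..n+1}. enod (n+1) x r (y s)) = (\<Sum>r\<in>{1..n+1}. pnod (n+1) lam (y s) / (y s - x r))"
        using e by (intro sum.cong) auto
      finally have "(-1) ^ (s - 1) * G s y = ((-1) ^ (s - 1) * C s y * pnod (n+1) lam (y s)) * pd s g y +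
         k * (\<Sum>r\<in>{1..n+1}. ((-1) ^ (s - 1) * C s y * pnod (n+1) lam (y s)) / (y s - x r)) * g y"
        unfolding G_def by (simp add: sum_distrib_left algebra_simps)
      then show ?thesis unfolding Q[symmetric] by (simp add: algebra_simps)
    qed
    \<comment> \<open>The exchange reverses the sign of the denominator. The weighted sum of these
      terms is exactly the discrepancy between the difference quotients of Q and those of
      \<open>g\<close>, in a form that \<open>alt\<close> annihilates.\<close>
    have hs: "h s t y + h s t (swapc s t y) = (?Q * g (swapc s t y) - Qf n x (swapc s t y) * g y) / (y s - y t)"
      if "(s, t) \<in> prs n" for s t
    proof -
      have "s \<noteq> t" using that by (auto simp: prs_def)
      moreover have "swapc s t (swapc s t y) = y" by (auto simp: swapc_def fun_eq_iff)
      moreover have "swapc s t y s = y t" "swapc s t y t = y s" using \<open>s \<noteq> t\<close> by (auto simp: swapc_def)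
      ultimately have "h s t (swapc s t y) = Qf n x (swapc s t y) * g y / (- (y s - y t))"
        unfolding h_def by simp
      also have "\<dots> = - (Qf n x (swapc s t y) * g y / (y s - y t))" by (rule divide_minus_right)
      finally show ?thesis unfolding h_def by (simp add: diff_divide_distrib)
    qed
    let ?A = "\<Sum>s\<in>{1..n}. \<Sum>r\<in>{1..n+1}. ?Q * ((y s - x s) / (y s - x r))"
    let ?B = "\<Sum>(s, t)\<in>prs n. (x s - x t) * ((?Q - Qf n x (swapc s t y)) / (y s - y t))"
    let ?D = "\<Sum>s\<in>{1..n}. (x s - y s) * pd s g y"
    let ?E = "\<Sum>(s, t)\<in>prs n. (x s - x t) * ((g y - g (swapc s t y)) / (y s - y t))"
    have S: "(\<Sum>s\<in>{1..n}. (-1) ^ (s - 1) * G s y) = k * ?A * g y - ?Q * ?D"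
      using Gs by (simp add: sum_subtractf sum_distrib_left sum_distrib_right mult_ac)
    have "?B * g y - ?Q * ?E = (\<Sum>(s, t)\<in>prs n. (x s - x t) * (h s t y + h s t (swapc s t y)))"
      unfolding sum_distrib_left sum_distrib_right sum_subtractf[symmetric]
    proof (rule sum.cong[OF refl])
      fix p assume p: "p \<in> prs n"
      obtain s t where st: "p = (s, t)" by fastforce
      have "(?Q - Qf n x (swapc s t y)) * g y - ?Q * (g y - g (swapc s t y)) = ?Q * g (swapc s t y) - Qf n x (swapc s t y) * g y"
        by (simp add: algebra_simps)
      then have "(x s - x t) * ((?Q - Qf n x (swapc s t y)) / (y s - y t)) * g y - ?Q * ((x s - x t) * ((g y - g (swapc s t y)) / (y s - y t)))
         = (x s - x t) * ((?Q * g (swapc s t y) - Qf n x (swapc s t y) * g y) / (y s - y t))"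
        by (simp add: right_diff_distrib[symmetric] diff_divide_distrib[symmetric] mult_ac flip: times_divide_eq_right)
           (simp add: algebra_simps diff_divide_distrib add_divide_distrib)
      then show "(case p of (s, t) \<Rightarrow> (x s - x t) * ((?Q - Qf n x (swapc s t y)) / (y s - y t))) * g y -
         ?Q * (case p of (s, t) \<Rightarrow> (x s - x t) * ((g y - g (swapc s t y)) / (y s - y t))) =
         (case p of (s, t) \<Rightarrow> (x s - x t) * (h s t y + h s t (swapc s t y)))"
        using hs p unfolding st by simp
    qed
    moreover have id: "(\<Sum>(i, j)\<in>prs (n+1). ?Q + Qf n (swapc i j x) y) = ?A + ?B"
      using y(2) ne by (rule Qf_identity)
    have "k * (\<Sum>(i, j)\<in>prs (n+1). ?Q + Qf n (swapc i j x) y) * g y - ?Q * \<rho> y = (k * ?A * g y - ?Q * ?D) + k * (?B * g y - ?Q * ?E)"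
      unfolding id rho[OF y] by (simp only: algebra_simps)
    ultimately show ?thesis unfolding S by simp
  qed
  have alt_pw: "k * (\<Sum>(i, j)\<in>prs (n+1). alt n (\<lambda>y. Qf n x y * g y) \<nu> + alt n (\<lambda>y. Qf n (swapc i j x) y * g y) \<nu>) - alt n (\<lambda>y. Qf n x y * \<rho> y) \<nu>
      = (\<Sum>s\<in>{1..n}. (-1) ^ (s - 1) * alt n (G s) \<nu>)" if \<nu>: "inbox \<nu>" "\<nu> \<in> Rsp n" for \<nu>
  proof -
    have "k * (\<Sum>(i, j)\<in>prs (n+1). alt n (\<lambda>y. Qf n x y * g y) \<nu> + alt n (\<lambda>y. Qf n (swapc i j x) y * g y) \<nu>) - alt n (\<lambda>y. Qf n x y * \<rho> y) \<nu>
       = alt n (\<lambda>y. k * (\<Sum>p\<in>prs (n+1). (Qf n x y * g y + Qf n (swapc (fst p) (snd p) x) y * g y)) - Qf n x y * \<rho> y) \<nu>"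
      unfolding alt_diff alt_cmult alt_sum alt_add by (simp only: case_prod_unfold)
    also have "\<dots> = alt n (\<lambda>y. (\<Sum>s\<in>{1..n}. (-1) ^ (s - 1) * G s y) + k * (\<Sum>p\<in>prs n. (x (fst p) - x (snd p)) * (h (fst p) (snd p) y + h (fst p) (snd p) (swapc (fst p) (snd p) y)))) \<nu>"
    \<comment> \<open>The rational identity is required only at rearrangements of box points, and
      these have distinct coordinates and avoid every node.\<close>
    proof (rule alt_cong)
      fix w assume w: "w permutes {1..n}"
      let ?y = "\<nu> \<circ> w"
      have wi: "w s \<in> {1..n}" if "s \<in> {1..n}" for s using that permutes_in_image[OF w] by simp
      have y1: "?y \<in> Rsp n" using \<nu>(2) permutes_not_in[OF w] by (auto simp: PiE_def extensional_def)
      have y2: "inj_on ?y {1..n}"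
        using comp_inj_on[of w "{1..n}" \<nu>] permutes_inj_on[OF w] permutes_image[OF w] inbox_inj[OF \<nu>(1)] by simp
      have y3: "?y s \<noteq> x r" if "s \<in> {1..n}" "r \<in> {1..n+1}" for s r
      proof -
        have "\<sigma> r \<in> {1..n+1}" using that(2) permutes_in_image[OF \<sigma>] by simp
        then show ?thesis using cell_neq[OF wi[OF that(1)], of "\<nu> (w s)" "\<sigma> r"] \<nu>(1) wi[OF that(1)] x by simp
      qed
      show "k * (\<Sum>p\<in>prs (n+1). (Qf n x ?y * g ?y + Qf n (swapc (fst p) (snd p) x) ?y * g ?y)) - Qf n x ?y * \<rho> ?y =
        (\<Sum>s\<in>{1..n}. (-1) ^ (s - 1) * G s ?y) + k * (\<Sum>p\<in>prs n. (x (fst p) - x (snd p)) * (h (fst p) (snd p) ?y + h (fst p) (snd p) (swapc (fst p) (snd p) ?y)))"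
        using pw[OF y1 y2 y3] by (simp only: case_prod_unfold distrib_right[symmetric] sum_distrib_right[symmetric] mult.assoc)
    qed
    also have "\<dots> = (\<Sum>s\<in>{1..n}. (-1) ^ (s - 1) * alt n (G s) \<nu>) + k * (\<Sum>p\<in>prs n. (x (fst p) - x (snd p)) * (alt n (h (fst p) (snd p)) \<nu> + alt n (\<lambda>y. h (fst p) (snd p) (swapc (fst p) (snd p) y)) \<nu>))"
      unfolding alt_cmult alt_sum alt_add ..
    also have "(\<Sum>p\<in>prs n. (x (fst p) - x (snd p)) * (alt n (h (fst p) (snd p)) \<nu> + alt n (\<lambda>y. h (fst p) (snd p) (swapc (fst p) (snd p) y)) \<nu>)) = 0"
    proof (rule sum.neutral, rule ballI)
      fix p assume "p \<in> prs n"
      then have "fst p \<in> {1..n}" "snd p \<in> {1..n}" "fst p \<noteq> snd p" by (auto simp: prs_def)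
      then show "(x (fst p) - x (snd p)) * (alt n (h (fst p) (snd p)) \<nu> + alt n (\<lambda>y. h (fst p) (snd p) (swapc (fst p) (snd p) y)) \<nu>) = 0"
        by (subst alt_swapc) auto
    qed
    finally show ?thesis by simp
  qed
  let ?W = "wt (\<lambda>_. k)"
  let ?q = "\<lambda>z (g::(nat\<Rightarrow>real)\<Rightarrow>real) y. Qf n z y * g y"
  have qi: "integrable (Rmeas n) (\<lambda>\<nu>. ?W \<nu> * alt n (?q z g) \<nu>)" if "g \<in> poly_fun n" for z g
    using that k by (intro wt_alt_integrable poly_fun.pmult Qf_poly_fun)
  have "k * (\<Sum>(i, j)\<in>prs (n+1). AA k x g + AA k (swapc i j x) g) - AA k x \<rho> =
     (\<integral>\<nu>. k * (\<Sum>p\<in>prs (n+1). ?W \<nu> * alt n (?q x g) \<nu> + ?W \<nu> * alt n (?q (swapc (fst p) (snd p) x) g) \<nu>) - ?W \<nu> * alt n (?q x \<rho>) \<nu> \<partial>Rmeas n)"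
    unfolding AA_def case_prod_unfold using qi g \<rho>
    by (subst Bochner_Integration.integral_diff Bochner_Integration.integral_mult_right_zero Bochner_Integration.integral_sum Bochner_Integration.integral_add; (intro integrable_mult_right Bochner_Integration.integrable_sum Bochner_Integration.integrable_add)?)+ simp_all
  also have "\<dots> = (\<integral>\<nu>. (\<Sum>s\<in>{1..n}. (-1) ^ (s - 1) * (?W \<nu> * alt n (G s) \<nu>)) \<partial>Rmeas n)"
  proof (rule Bochner_Integration.integral_cong[OF refl])
    fix \<nu> assume "\<nu> \<in> space (Rmeas n)"
    then have \<nu>: "\<nu> \<in> Rsp n" by (simp add: space_PiM)
    show "k * (\<Sum>p\<in>prs (n+1). ?W \<nu> * alt n (?q x g) \<nu> + ?W \<nu> * alt n (?q (swapc (fst p) (snd p) x) g) \<nu>) - ?W \<nu> * alt n (?q x \<rho>) \<nu> =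
       (\<Sum>s\<in>{1..n}. (-1) ^ (s - 1) * (?W \<nu> * alt n (G s) \<nu>))"
    proof (cases "inbox \<nu>")
      case True
      have "k * (\<Sum>p\<in>prs (n+1). ?W \<nu> * alt n (?q x g) \<nu> + ?W \<nu> * alt n (?q (swapc (fst p) (snd p) x) g) \<nu>) - ?W \<nu> * alt n (?q x \<rho>) \<nu>
         = ?W \<nu> * (k * (\<Sum>(i, j)\<in>prs (n+1). alt n (?q x g) \<nu> + alt n (?q (swapc i j x) g) \<nu>) - alt n (?q x \<rho>) \<nu>)"
        by (simp add: case_prod_unfold sum_distrib_left right_diff_distrib distrib_left mult_ac)
      also have "\<dots> = (\<Sum>s\<in>{1..n}. (-1) ^ (s - 1) * (?W \<nu> * alt n (G s) \<nu>))"
        unfolding alt_pw[OF True \<nu>] by (simp only: sum_distrib_left mult_ac)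
      finally show ?thesis .
    next
      case False
      then have "?W \<nu> = 0" using wt_zero by blast
      then show ?thesis by simp
    qed
  qed
  also have "\<dots> = (\<Sum>s\<in>{1..n}. (-1) ^ (s - 1) * (\<integral>\<nu>. ?W \<nu> * alt n (G s) \<nu> \<partial>Rmeas n))"
  proof (subst Bochner_Integration.integral_sum)
    fix s assume "s \<in> {1..n}"
    then show "integrable (Rmeas n) (\<lambda>\<nu>. (-1) ^ (s - 1) * (?W \<nu> * alt n (G s) \<nu>))"
      by (intro integrable_mult_right wt_alt_integrable[OF k Gp])
  qed simp
  also have "\<dots> = 0"
    unfolding G_def C_def using alt_by_parts[OF k g] by (intro sum.neutral) simp
  finally show ?thesis by simp
qed

end

section \<open>The intertwining operator on powers of linear forms\<close>

lemma max_principle: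
  fixes e :: "'a \<Rightarrow> real"
  assumes W: "finite W" "\<sigma> \<in> W" and sw: "\<And>p \<sigma>. p \<in> P \<Longrightarrow> \<sigma> \<in> W \<Longrightarrow> sw p \<sigma> \<in> W"
    and d: "d > 0" and k: "k \<ge> 0"
    and le: "\<And>\<sigma>. \<sigma> \<in> W \<Longrightarrow> d * e \<sigma> + k * (\<Sum>p\<in>P. e \<sigma> - e (sw p \<sigma>)) \<le> d * B"
  shows "e \<sigma> \<le> B"
proof -
  have ne: "W \<noteq> {}" using W by auto
  have "Max (e ` W) \<in> e ` W" using W(1) ne by (intro Max_in) auto
  then obtain \<sigma>0 where s0: "\<sigma>0 \<in> W" "e \<sigma>0 = Max (e ` W)" by auto
  have mx: "e \<tau> \<le> e \<sigma>0" if "\<tau> \<in> W" for \<tau> using s0(2) W(1) that by simp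
  have "0 \<le> k * (\<Sum>p\<in>P. e \<sigma>0 - e (sw p \<sigma>0))"
    using k mx sw s0(1) by (intro mult_nonneg_nonneg sum_nonneg) auto
  then have "d * e \<sigma>0 \<le> d * B" using le[OF s0(1)] by linarith
  then have "e \<sigma>0 \<le> B" using d by simp
  then show ?thesis using mx[OF W(2)] by simp
qed

text \<open>The bound B is kept general: zero gives the uniqueness in \<open>power_formula\<close>,
  a power of the coordinate bound gives \<open>mom_unit_bound\<close>.\<close>

lemma max_principle_abs:
  fixes e :: "'a \<Rightarrow> real"
  assumes W: "finite W" "\<sigma> \<in> W" and sw: "\<And>p \<sigma>. p \<in> P \<Longrightarrow> \<sigma> \<in> W \<Longrightarrow> sw p \<sigma> \<in> W"
    and d: "d > 0" and k: "k \<ge> 0"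
    and le: "\<And>\<sigma>. \<sigma> \<in> W \<Longrightarrow> \<bar>d * e \<sigma> + k * (\<Sum>p\<in>P. e \<sigma> - e (sw p \<sigma>))\<bar> \<le> d * B"
  shows "\<bar>e \<sigma>\<bar> \<le> B"
proof -
  have "e \<sigma> \<le> B"
  proof (rule max_principle[where P = P and sw = sw, OF W sw d k])
    fix \<tau> assume "\<tau> \<in> W"
    then show "d * e \<tau> + k * (\<Sum>p\<in>P. e \<tau> - e (sw p \<tau>)) \<le> d * B"
      using le[of \<tau>] by (simp add: abs_le_iff)
  qed auto
  moreover have "- e \<sigma> \<le> B"
  proof (rule max_principle[where P = P and sw = sw, OF W sw d k])
    fix \<tau> assume "\<tau> \<in> W"
    have "d * - e \<tau> + k * (\<Sum>p\<in>P. - e \<tau> - - e (sw p \<tau>)) = - (d * e \<tau> + k * (\<Sum>p\<in>P. e \<tau> - e (sw p \<tau>)))"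
      by (simp add: sum_subtractf sum_negf algebra_simps)
    then show "d * - e \<tau> + k * (\<Sum>p\<in>P. - e \<tau> - - e (sw p \<tau>)) \<le> d * B"
      using le[OF \<open>\<tau> \<in> W\<close>] by (simp add: abs_le_iff)
  qed auto
  ultimately show ?thesis by simp
qed

abbreviation (input) perms :: "nat \<Rightarrow> (nat \<Rightarrow> nat) set" where
  "perms m \<equiv> {\<sigma>. \<sigma> permutes {1..m}}"

definition swp :: "nat \<times> nat \<Rightarrow> (nat \<Rightarrow> nat) \<Rightarrow> nat \<Rightarrow> nat" where
  "swp p \<sigma> = \<sigma> \<circ> Transposition.transpose (fst p) (snd p)"

lemma comp_swp: "x \<circ> swp p \<sigma> = swapc (fst p) (snd p) (x \<circ> \<sigma>)"
  unfolding swp_def swapc_eq_comp by (simp only: comp_assoc)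

lemma swp_perms: "p \<in> prs m \<Longrightarrow> \<sigma> \<in> perms m \<Longrightarrow> swp p \<sigma> \<in> perms m"
  unfolding swp_def by (auto simp: prs_def intro!: permutes_compose permutes_swap_id)

lemma sign_swp: "p \<in> prs m \<Longrightarrow> \<sigma> \<in> perms m \<Longrightarrow> sign (swp p \<sigma>) = - sign \<sigma>"
  unfolding swp_def using permutes_imp_permutation[of "{1..m}" \<sigma>]
  by (subst sign_compose) (auto simp: sign_swap_id permutation_swap_id prs_def)

text \<open>The substitute for the maximum principle in degree 0. At a maximum all differences
  vanish, so the maximum spreads along transpositions, and these generate the group.\<close>

lemma harmonic_perms_constant:
  fixes e :: "(nat \<Rightarrow> nat) \<Rightarrow> real"
  assumes eq: "\<And>\<sigma>. \<sigma> \<in> perms m \<Longrightarrow> (\<Sum>p\<in>prs m. e \<sigma> - e (swp p \<sigma>)) = 0"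
    and "\<sigma> \<in> perms m" "\<tau> \<in> perms m"
  shows "e \<sigma> = e \<tau>"
proof -
  have fin: "finite (perms m)" by (rule finite_permutations) simp
  have "Max (e ` perms m) \<in> e ` perms m" using fin assms(2) by (intro Max_in) auto
  then obtain \<sigma>0 where s0: "\<sigma>0 \<in> perms m" "e \<sigma>0 = Max (e ` perms m)" by auto
  have mx: "e \<tau> \<le> e \<sigma>0" if "\<tau> \<in> perms m" for \<tau> using s0(2) fin that by simp
  have nb: "e (swp p \<sigma>) = e \<sigma>0" if "\<sigma> \<in> perms m" "e \<sigma> = e \<sigma>0" "p \<in> prs m" for p \<sigma>
  proof -
    have "e \<sigma> - e (swp p \<sigma>) = 0"
      using sum_nonneg_eq_0_iff[of "prs m" "\<lambda>p. e \<sigma> - e (swp p \<sigma>)"] eq[OF that(1)] mx swp_perms that by force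
    then show ?thesis using that by simp
  qed
  have "e (\<sigma>0 \<circ> p) = e \<sigma>0" if "p permutes {1..m}" for p
    using finite_atLeastAtMost[of 1 m] that
  proof (induction rule: permutes_rev_induct)
    case (swap a b p)
    define i j where "i = min a b" and "j = max a b"
    have ij: "(i, j) \<in> prs m" using swap.hyps by (auto simp: prs_def i_def j_def)
    have tr: "Transposition.transpose i j = Transposition.transpose a b"
      by (auto simp: i_def j_def min_def max_def transpose_commute)
    have "\<sigma>0 \<circ> p \<in> perms m" using s0(1) swap.hyps permutes_compose by auto
    from nb[OF this swap.IH ij] show ?case
      unfolding swp_def by (simp add: tr comp_def)
  qed simp
  note all = this
  have "e \<sigma> = e \<sigma>0" if "\<sigma> \<in> perms m" for \<sigma>
  proof -
    have p0: "\<sigma>0 permutes {1..m}" using s0(1) by simp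
    have "inv \<sigma>0 \<circ> \<sigma> permutes {1..m}" using that by (intro permutes_compose permutes_inv p0) simp
    then have "e (\<sigma>0 \<circ> (inv \<sigma>0 \<circ> \<sigma>)) = e \<sigma>0" by (rule all)
    moreover have "\<sigma>0 \<circ> (inv \<sigma>0 \<circ> \<sigma>) = \<sigma>"
      using permutes_inv_o(1)[OF p0] by (simp add: comp_assoc[symmetric])
    ultimately show ?thesis by simp
  qed
  then show ?thesis using assms by simp
qed

section \<open>Moments of the intertwining measures\<close>

lemma Rsp_comp: "x \<in> Rsp m \<Longrightarrow> \<sigma> permutes {1..m} \<Longrightarrow> x \<circ> \<sigma> \<in> Rsp m"
  using permutes_not_in[of \<sigma> "{1..m}"] by (auto simp: PiE_def extensional_def)

lemma Rsp_swapc: "x \<in> Rsp m \<Longrightarrow> i \<in> {1..m} \<Longrightarrow> j \<in> {1..m} \<Longrightarrow> swapc i j x \<in> Rsp m"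
  unfolding swapc_eq_comp by (intro Rsp_comp permutes_swap_id)

lemma inj_on_comp_perm: "inj_on x {1..m} \<Longrightarrow> \<sigma> permutes {1..m} \<Longrightarrow> inj_on (x \<circ> \<sigma>) {1..m}"
  using comp_inj_on[of \<sigma> "{1..m}" x] permutes_inj_on[of \<sigma>] permutes_image[of \<sigma> "{1..m}"] by simp

definition lin :: "nat \<Rightarrow> (nat \<Rightarrow> real) \<Rightarrow> (nat \<Rightarrow> real) \<Rightarrow> real" where
  "lin m a y = (\<Sum>i\<in>{1..m}. a i * y i)"

lemma lin_poly_fun: "lin m a \<in> poly_fun m"
  unfolding lin_def[abs_def] by (intro poly_fun_sum poly_fun.pmult poly_fun.pconst poly_fun.pvar) auto

lemma lin_unit:
  assumes "i \<in> {1..m}"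
  shows "lin m (\<lambda>j. if j = i then 1 else 0) y = y i"
proof -
  have "lin m (\<lambda>j. if j = i then 1 else 0) y = (\<Sum>j\<in>{1..m}. if j = i then y i else 0)"
    unfolding lin_def by (intro sum.cong) auto
  then show ?thesis using assms by simp
qed

lemma hom_poly_lin_power: "hom_poly m d (\<lambda>y. lin m a y ^ d)"
proof -
  have "lin m a (restrict (\<lambda>i. t * x i) {1..m}) = t * lin m a x" for t x
    unfolding lin_def sum_distrib_left by (intro sum.cong) auto
  then show ?thesis
    unfolding hom_poly_def using lin_poly_fun by (auto simp: power_mult_distrib)
qed

lemma pd_lin_power:
  assumes "j \<in> {1..m}"
  shows "pd j (\<lambda>y. lin m a y ^ d) y = real d * a j * lin m a y ^ (d - 1)"
proof -
  have "lin m a (y(j := t)) = a j * t + (\<Sum>i\<in>{1..m}-{j}. a i * y i)" for t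
  proof -
    have "(\<Sum>i\<in>{1..m}-{j}. a i * (y(j := t)) i) = (\<Sum>i\<in>{1..m}-{j}. a i * y i)" by (intro sum.cong) auto
    then show ?thesis unfolding lin_def using sum.remove[OF finite_atLeastAtMost assms, of "\<lambda>i. a i * (y(j := t)) i"] by simp
  qed
  then have "((\<lambda>t. lin m a (y(j := t))) has_real_derivative a j) (at (y j))"
    by (auto intro!: derivative_eq_intros)
  from DERIV_power[OF this, of d] show ?thesis
    unfolding pd_def by (intro DERIV_imp_deriv) (simp add: mult_ac)
qed

text \<open>The chain rule along a ray, by induction over polynomials so that only the coordinate
  derivatives \<open>pd\<close> occur; \<open>restrict\<close> keeps the scaled point
  extensional.\<close>

lemma poly_fun_radial_derivative:
  assumes "p \<in> poly_fun m"
  shows "((\<lambda>t. p (restrict (\<lambda>i. t * x i) {1..m})) has_real_derivative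
     (\<Sum>j\<in>{1..m}. x j * pd j p (restrict (\<lambda>i. t * x i) {1..m}))) (at t)"
  using assms
proof induction
  case (pconst c)
  have "pd j (\<lambda>_. c) = (\<lambda>_. 0)" for j :: nat by (auto simp: pd_def)
  then show ?case by simp
next
  case (pvar i)
  have "pd j (\<lambda>x. x i) = (\<lambda>_. if j = i then 1 else 0)" for j :: nat
    by (auto simp: pd_def fun_eq_iff)
  then have "(\<Sum>j\<in>{1..m}. x j * pd j (\<lambda>x. x i) (restrict (\<lambda>i. t * x i) {1..m})) = (\<Sum>j\<in>{1..m}. if j = i then x i else 0)"
    by (intro sum.cong) auto
  also have "\<dots> = x i" using pvar by simp
  finally have "(\<Sum>j\<in>{1..m}. x j * pd j (\<lambda>x. x i) (restrict (\<lambda>i. t * x i) {1..m})) = x i" .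
  moreover have "(\<lambda>t. restrict (\<lambda>i. t * x i) {1..m} i) = (\<lambda>t. t * x i)" using pvar by auto
  ultimately show ?case by (simp only:) (auto intro!: derivative_eq_intros)
next
  case (padd p q)
  have "pd j (\<lambda>x. p x + q x) z = pd j p z + pd j q z" for j z
    using DERIV_add[OF poly_fun_has_derivative[OF padd(1), of z j "z j"] poly_fun_has_derivative[OF padd(2), of z j "z j"]]
    unfolding pd_def[of j "\<lambda>x. p x + q x"] by (intro DERIV_imp_deriv) simp
  then show ?case using DERIV_add[OF padd.IH] by (simp add: distrib_left sum.distrib)
next
  case (pmult p q)
  have "pd j (\<lambda>x. p x * q x) z = pd j p z * q z + pd j q z * p z" for j z
    using DERIV_mult[OF poly_fun_has_derivative[OF pmult(1), of z j "z j"] poly_fun_has_derivative[OF pmult(2), of z j "z j"]]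
    unfolding pd_def[of j "\<lambda>x. p x * q x"] by (intro DERIV_imp_deriv) simp
  then show ?case using DERIV_mult[OF pmult.IH]
    by (simp add: distrib_left sum.distrib sum_distrib_left sum_distrib_right mult_ac)
qed

lemma hom_poly_euler:
  assumes q: "hom_poly m d q" and x: "x \<in> Rsp m"
  shows "(\<Sum>j\<in>{1..m}. x j * pd j q x) = d * q x"
proof -
  have r: "restrict (\<lambda>i. 1 * x i) {1..m} = x" using x by (auto simp: PiE_def extensional_def fun_eq_iff)
  have "((\<lambda>t. q (restrict (\<lambda>i. t * x i) {1..m})) has_real_derivative (\<Sum>j\<in>{1..m}. x j * pd j q x)) (at 1)"
    using poly_fun_radial_derivative[of q m x 1] q r by (simp add: hom_poly_def)
  moreover have "(\<lambda>t. q (restrict (\<lambda>i. t * x i) {1..m})) = (\<lambda>t. t ^ d * q x)"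
    using q x by (auto simp: hom_poly_def)
  moreover have "((\<lambda>t. t ^ d * q x) has_real_derivative real d * q x) (at 1)"
    by (auto intro!: derivative_eq_intros)
  ultimately show ?thesis using DERIV_unique by metis
qed

lemma intertwining_measuresD:
  assumes "intertwining_measures m k \<mu>" "x \<in> Rsp m"
  shows "prob_space (\<mu> x)" "sets (\<mu> x) = sets (Rmeas m)" "\<exists>R. AE y in \<mu> x. \<forall>i\<in>{1..m}. \<bar>y i\<bar> \<le> R"
  using assms unfolding intertwining_measures_def by auto

lemma intertwining_poly_integrable:
  assumes \<mu>: "intertwining_measures m k \<mu>" "x \<in> Rsp m" and p: "p \<in> poly_fun m"
  shows "integrable (\<mu> x) p"
proof -
  interpret prob_space "\<mu> x" using intertwining_measuresD(1)[OF \<mu>] .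
  obtain R where R: "AE y in \<mu> x. \<forall>i\<in>{1..m}. \<bar>y i\<bar> \<le> R"
    using intertwining_measuresD(3)[OF \<mu>] by blast
  obtain B where B: "\<And>y. (\<forall>i\<in>{1..m}. \<bar>y i\<bar> \<le> R) \<Longrightarrow> \<bar>p y\<bar> \<le> B"
    using poly_fun_bounded[OF p] by blast
  have "p \<in> borel_measurable (\<mu> x)"
    using poly_fun_measurable[OF p] measurable_cong_sets[OF intertwining_measuresD(2)[OF \<mu>] refl] by blast
  moreover have "AE y in \<mu> x. norm (p y) \<le> B" using R by eventually_elim (use B in auto)
  ultimately show ?thesis by (rule integrable_const_bound[rotated])
qed

definition mom :: "((nat \<Rightarrow> real) \<Rightarrow> (nat \<Rightarrow> real) measure) \<Rightarrow> nat \<Rightarrow> (nat \<Rightarrow> real) \<Rightarrow> nat \<Rightarrow> (nat \<Rightarrow> real) \<Rightarrow> real" where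
  "mom \<mu> m a d x = (\<integral>y. lin m a y ^ d \<partial>\<mu> x)"

lemma mom_0: "intertwining_measures m k \<mu> \<Longrightarrow> x \<in> Rsp m \<Longrightarrow> mom \<mu> m a 0 x = 1"
  unfolding mom_def using prob_space.prob_space[OF intertwining_measuresD(1)] by simp

lemma mom_poly:
  assumes "intertwining_measures m k \<mu>"
  shows "\<exists>q. hom_poly m d q \<and> (\<forall>x\<in>Rsp m. mom \<mu> m a d x = q x) \<and>
     (\<forall>j\<in>{1..m}. \<forall>x\<in>Rsp m. inj_on x {1..m} \<longrightarrow> dunkl_T m k j q x = d * a j * mom \<mu> m a (d - 1) x)"
proof -
  obtain q where q: "hom_poly m d q" "\<forall>x\<in>Rsp m. mom \<mu> m a d x = q x"
    "\<forall>j\<in>{1..m}. \<forall>x\<in>Rsp m. inj_on x {1..m} \<longrightarrow> dunkl_T m k j q x = (\<integral>y. pd j (\<lambda>y. lin m a y ^ d) y \<partial>\<mu> x)"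
    using assms[unfolded intertwining_measures_def, THEN conjunct2, THEN spec, THEN spec, THEN mp, OF hom_poly_lin_power[of m d a]]
    unfolding mom_def[symmetric] by (elim exE conjE)
  have "(\<integral>y. pd j (\<lambda>y. lin m a y ^ d) y \<partial>\<mu> x) = d * a j * mom \<mu> m a (d - 1) x" if "j \<in> {1..m}" for j x
    unfolding pd_lin_power[OF that] mom_def by simp
  then show ?thesis using q by (intro exI[of _ q]) auto
qed

text \<open>Multiply the j-th Dunkl equation by x_j and sum. Homogeneity turns the derivatives into
  the factor d, and for each pair x_j/(x_j - x_i) + x_i/(x_i - x_j) = 1 removes the
  denominators.\<close>

lemma mom_euler:
  assumes \<mu>: "intertwining_measures m k \<mu>" and x: "x \<in> Rsp m" "inj_on x {1..m}"
  shows "d * mom \<mu> m a d x + k * (\<Sum>(i, j)\<in>prs m. mom \<mu> m a d x - mom \<mu> m a d (swapc i j x)) =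
    d * (lin m a x * mom \<mu> m a (d - 1) x)"
proof -
  obtain q where q: "hom_poly m d q" "\<forall>x\<in>Rsp m. mom \<mu> m a d x = q x"
    "\<forall>j\<in>{1..m}. \<forall>x\<in>Rsp m. inj_on x {1..m} \<longrightarrow> dunkl_T m k j q x = d * a j * mom \<mu> m a (d - 1) x"
    using mom_poly[OF \<mu>] by blast
  have "d * (lin m a x * mom \<mu> m a (d - 1) x) = (\<Sum>j\<in>{1..m}. x j * dunkl_T m k j q x)"
    using q(3) x unfolding lin_def by (simp add: sum_distrib_left sum_distrib_right mult_ac)
  also have "\<dots> = (\<Sum>j\<in>{1..m}. x j * pd j q x) + k * (\<Sum>j\<in>{1..m}. \<Sum>i\<in>{1..m}-{j}. x j * ((q x - q (swapc i j x)) / (x j - x i)))"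
    unfolding dunkl_T_def by (simp add: distrib_left sum.distrib sum_distrib_left mult_ac)
  also have "(\<Sum>j\<in>{1..m}. \<Sum>i\<in>{1..m}-{j}. x j * ((q x - q (swapc i j x)) / (x j - x i))) =
     (\<Sum>(i, j)\<in>prs m. x j * ((q x - q (swapc i j x)) / (x j - x i)) + x i * ((q x - q (swapc j i x)) / (x i - x j)))"
    by (rule sum_offdiag)
  also have "\<dots> = (\<Sum>(i, j)\<in>prs m. q x - q (swapc i j x))"
  proof (rule sum.cong[OF refl])
    fix p assume p: "p \<in> prs m"
    obtain i j where ij: "p = (i, j)" by fastforce
    have "x i \<noteq> x j" using p inj_onD[OF x(2), of i j] unfolding ij prs_def by force
    then have "x j - x i \<noteq> 0" by simp
    moreover have "swapc j i x = swapc i j x" by (auto simp: swapc_def fun_eq_iff)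
    moreover have "u / (x i - x j) = - (u / (x j - x i))" for u
      by (metis minus_diff_eq divide_minus_right)
    ultimately show "(case p of (i, j) \<Rightarrow> x j * ((q x - q (swapc i j x)) / (x j - x i)) + x i * ((q x - q (swapc j i x)) / (x i - x j))) =
       (case p of (i, j) \<Rightarrow> q x - q (swapc i j x))"
      unfolding ij by (simp add: left_diff_distrib[symmetric] diff_divide_distrib[symmetric])
  qed
  also have "\<dots> = (\<Sum>(i, j)\<in>prs m. mom \<mu> m a d x - mom \<mu> m a d (swapc i j x))"
    using q(2) x(1) Rsp_swapc[OF x(1)] by (intro sum.cong refl) (auto simp: prs_def)
  finally show ?thesis using hom_poly_euler[OF q(1) x(1)] q(2) x(1) by simp
qed

lemma mom_euler_perm:
  assumes \<mu>: "intertwining_measures m k \<mu>" and x: "x \<in> Rsp m" "inj_on x {1..m}" and \<sigma>: "\<sigma> \<in> perms m"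
  shows "d * mom \<mu> m a d (x \<circ> \<sigma>) + k * (\<Sum>p\<in>prs m. mom \<mu> m a d (x \<circ> \<sigma>) - mom \<mu> m a d (x \<circ> swp p \<sigma>)) =
    d * (lin m a (x \<circ> \<sigma>) * mom \<mu> m a (d - 1) (x \<circ> \<sigma>))"
proof -
  have s: "\<sigma> permutes {1..m}" using \<sigma> by simp
  show ?thesis
    unfolding comp_swp using mom_euler[OF \<mu> Rsp_comp[OF x(1) s] inj_on_comp_perm[OF x(2) s], of d a]
    by (simp only: case_prod_unfold)
qed

text \<open>Induction on the degree by the maximum principle: for a coordinate form the right-hand
  side of \<open>mom_euler\<close> is d times a coordinate of modulus at most B times the previous
  moment.\<close>

lemma mom_unit_bound:
  assumes \<mu>: "intertwining_measures m k \<mu>" and x: "x \<in> Rsp m" "inj_on x {1..m}" and k: "k \<ge> 0"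
    and i: "i \<in> {1..m}" and B: "\<And>j. j \<in> {1..m} \<Longrightarrow> \<bar>x j\<bar> \<le> B" and "\<sigma> \<in> perms m"
  shows "\<bar>mom \<mu> m (\<lambda>j. if j = i then 1 else 0) d (x \<circ> \<sigma>)\<bar> \<le> B ^ d"
  using \<open>\<sigma> \<in> perms m\<close>
proof (induction d arbitrary: \<sigma>)
  case 0
  then have "mom \<mu> m (\<lambda>j. if j = i then 1 else 0) 0 (x \<circ> \<sigma>) = 1"
    using mom_0[OF \<mu> Rsp_comp[OF x(1)]] by blast
  then show ?case by (simp only: power_0 abs_one order_refl)
next
  case (Suc d)
  let ?a = "\<lambda>j. if j = i then 1 else 0 :: real"
  have "\<bar>mom \<mu> m ?a (Suc d) (x \<circ> \<sigma>)\<bar> \<le> B ^ Suc d"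
  proof (rule max_principle_abs[where W = "perms m" and P = "prs m" and sw = swp and d = "real (Suc d)" and k = k
        and e = "\<lambda>\<sigma>. mom \<mu> m ?a (Suc d) (x \<circ> \<sigma>)"])
    show "finite (perms m)" by (rule finite_permutations) simp
    fix \<tau> assume \<tau>: "\<tau> \<in> perms m"
    have l: "lin m ?a (x \<circ> \<tau>) = x (\<tau> i)" using lin_unit[OF i, of "x \<circ> \<tau>"] by simp
    have "\<tau> i \<in> {1..m}" using \<tau> i permutes_in_image[of \<tau> "{1..m}" i] by simp
    then have "\<bar>x (\<tau> i) * mom \<mu> m ?a d (x \<circ> \<tau>)\<bar> \<le> B * B ^ d"
      unfolding abs_mult using B Suc.IH[OF \<tau>] order.trans[OF abs_ge_zero B]
      by (intro mult_mono) (auto simp: comp_def)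
    then have "real (Suc d) * \<bar>x (\<tau> i) * mom \<mu> m ?a d (x \<circ> \<tau>)\<bar> \<le> real (Suc d) * B ^ Suc d"
      by (intro mult_left_mono) auto
    then show "\<bar>real (Suc d) * mom \<mu> m ?a (Suc d) (x \<circ> \<tau>) + k * (\<Sum>p\<in>prs m. mom \<mu> m ?a (Suc d) (x \<circ> \<tau>) - mom \<mu> m ?a (Suc d) (x \<circ> swp p \<tau>))\<bar> \<le> real (Suc d) * B ^ Suc d"
      unfolding mom_euler_perm[OF \<mu> x \<tau>] l diff_Suc_1 abs_mult[of "real (Suc d)"] by simp
  qed (use Suc.prems swp_perms k in auto)
  then show ?case by (simp add: comp_def)
qed

text \<open>The hypothesis supplies some radius at each point, with no uniformity. The moment bounds
  give one that depends only on the size of the coordinates: mass beyond B + 1 would make the even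
  moments grow like (B + 1)^(2d) instead of B^(2d).\<close>

lemma intertwining_support:
  assumes \<mu>: "intertwining_measures m k \<mu>" and x: "x \<in> Rsp m" "inj_on x {1..m}" and k: "k \<ge> 0"
    and B: "\<And>j. j \<in> {1..m} \<Longrightarrow> \<bar>x j\<bar> \<le> B" and B0: "B > 0"
  shows "AE y in \<mu> x. \<forall>i\<in>{1..m}. \<bar>y i\<bar> \<le> B + 1"
proof (rule AE_finite_allI)
  fix i assume i: "i \<in> {1..m}"
  interpret prob_space "\<mu> x" using intertwining_measuresD(1)[OF \<mu> x(1)] .
  let ?a = "\<lambda>j. if j = i then 1 else 0 :: real"
  note l = lin_unit[OF i]
  have ms: "(\<lambda>y. y i) \<in> borel_measurable (\<mu> x)"
    using poly_fun_measurable[OF poly_fun.pvar[OF i]] measurable_cong_sets[OF intertwining_measuresD(2)[OF \<mu> x(1)] refl] by blast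
  define S where "S = {y\<in>space (\<mu> x). \<not> \<bar>y i\<bar> \<le> B + 1}"
  have S: "S \<in> sets (\<mu> x)" unfolding S_def using ms by measurable
  \<comment> \<open>Chebyshev's inequality with exponent 2d. The margin 1 makes the ratio exceed 1,
    so letting d grow forces the mass to be zero.\<close>
  have le: "prob S * ((B + 1) / B) ^ (2 * d) \<le> 1" for d
  proof -
    have "prob S * (B + 1) ^ (2 * d) = (\<integral>y. (B + 1) ^ (2 * d) * indicator S y \<partial>\<mu> x)"
      using S by simp
    also have "\<dots> \<le> (\<integral>y. y i ^ (2 * d) \<partial>\<mu> x)"
    proof (rule integral_mono)
      show "integrable (\<mu> x) (\<lambda>y. (B + 1) ^ (2 * d) * indicator S y)"
        using S by (intro integrable_mult_right integrable_real_indicator) (auto simp: emeasure_eq_measure)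
      show "integrable (\<mu> x) (\<lambda>y. y i ^ (2 * d))"
        using intertwining_poly_integrable[OF \<mu> x(1) poly_fun_power[OF poly_fun.pvar[OF i]]] .
      fix y
      show "(B + 1) ^ (2 * d) * indicator S y \<le> y i ^ (2 * d)"
      proof (cases "y \<in> S")
        case True
        then have "(B + 1) ^ (2 * d) \<le> \<bar>y i\<bar> ^ (2 * d)" using B0 by (intro power_mono) (auto simp: S_def)
        then show ?thesis using True by (simp add: power_even_abs)
      next
        case False
        then show ?thesis by simp
      qed
    qed
    also have "\<dots> \<le> B ^ (2 * d)"
      using mom_unit_bound[OF \<mu> x k i B, of id "2 * d"] unfolding mom_def l by (simp add: permutes_id abs_le_iff)
    finally show ?thesis using B0 by (simp add: power_divide field_simps)
  qed
  have "prob S = 0"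
  proof (rule ccontr)
    assume "prob S \<noteq> 0"
    then have p: "prob S > 0" by (simp add: measure_nonneg less_le)
    have "((B + 1) / B) > 1" using B0 by simp
    then obtain d where d: "1 / prob S < ((B + 1) / B) ^ d" using real_arch_pow by blast
    also have "\<dots> \<le> ((B + 1) / B) ^ (2 * d)" using B0 by (intro power_increasing) auto
    finally show False using le[of d] p by (simp add: field_simps)
  qed
  then have "S \<in> null_sets (\<mu> x)" using S by (simp add: null_sets_def emeasure_eq_measure)
  then show "AE y in \<mu> x. \<bar>y i\<bar> \<le> B + 1"
    by (rule AE_I') (auto simp: S_def)
qed simp

section \<open>Binomial expansion of powers of affine forms\<close>

lemma pd_lincomb:
  assumes "\<And>e. e \<in> E \<Longrightarrow> q e \<in> poly_fun m"
  shows "pd s (\<lambda>y. \<Sum>e\<in>E. c e * q e y) y = (\<Sum>e\<in>E. c e * pd s (q e) y)"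
proof -
  have "((\<lambda>t. \<Sum>e\<in>E. c e * q e (y(s := t))) has_real_derivative (\<Sum>e\<in>E. c e * pd s (q e) (y(s := y s)))) (at (y s))"
    using assms by (intro DERIV_sum DERIV_cmult poly_fun_has_derivative) auto
  then show ?thesis unfolding pd_def[of s "\<lambda>y. \<Sum>e\<in>E. c e * q e y"] by (intro DERIV_imp_deriv) simp
qed

lemma dunkl_T_lincomb:
  assumes "\<And>e. e \<in> E \<Longrightarrow> q e \<in> poly_fun m"
  shows "dunkl_T m k s (\<lambda>y. \<Sum>e\<in>E. c e * q e y) y = (\<Sum>e\<in>E. c e * dunkl_T m k s (q e) y)"
proof -
  let ?D = "\<lambda>e i. (q e y - q e (swapc i s y)) / (y s - y i)"
  have "(\<Sum>i\<in>{1..m}-{s}. ((\<Sum>e\<in>E. c e * q e y) - (\<Sum>e\<in>E. c e * q e (swapc i s y))) / (y s - y i)) =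
     (\<Sum>i\<in>{1..m}-{s}. \<Sum>e\<in>E. c e * ?D e i)"
    by (simp only: sum_subtractf[symmetric] sum_divide_distrib right_diff_distrib[symmetric] times_divide_eq_right)
  also have "\<dots> = (\<Sum>e\<in>E. c e * (\<Sum>i\<in>{1..m}-{s}. ?D e i))"
    by (subst sum.swap) (simp only: sum_distrib_left)
  finally have D: "(\<Sum>i\<in>{1..m}-{s}. ((\<Sum>e\<in>E. c e * q e y) - (\<Sum>e\<in>E. c e * q e (swapc i s y))) / (y s - y i)) =
     (\<Sum>e\<in>E. c e * (\<Sum>i\<in>{1..m}-{s}. ?D e i))" .
  have P: "pd s (\<lambda>y. \<Sum>e\<in>E. c e * q e y) y = (\<Sum>e\<in>E. c e * pd s (q e) y)"
    using assms by (rule pd_lincomb)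
  show ?thesis
    unfolding dunkl_T_def P D by (simp only: sum.distrib sum_distrib_left distrib_left mult_ac)
qed

text \<open>The value of the lower-rank operator on (lin + z)^d when \<open>q e\<close> is its value
  on lin^e. The sequence \<open>q\<close> is a parameter so that the moments and the polynomials
  representing them are treated alike.\<close>

definition binpoly :: "(nat \<Rightarrow> 'a \<Rightarrow> real) \<Rightarrow> real \<Rightarrow> nat \<Rightarrow> 'a \<Rightarrow> real" where
  "binpoly q z d y = (\<Sum>e\<le>d. (real (d choose e) * z ^ (d - e)) * q e y)"

text \<open>A formal derivative in the linear form, by e (d choose e) = d (d-1 choose e-1). The
  index \<open>e - 1\<close> at e = 0 is harmless because of the factor
  \<open>real e\<close>.\<close>

lemma binpoly_lower: "(\<Sum>e\<le>d. (real (d choose e) * z ^ (d - e)) * (real e * r * q (e - 1) y)) = real d * r * binpoly q z (d - 1) y"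
proof (cases d)
  case (Suc d')
  have "(\<Sum>e\<le>d. (real (d choose e) * z ^ (d - e)) * (real e * r * q (e - 1) y)) =
     (\<Sum>e\<le>d'. (real (Suc d' choose Suc e) * z ^ (d' - e)) * (real (Suc e) * r * q e y))"
    unfolding Suc by (subst sum.atMost_Suc_shift) simp
  also have "\<dots> = (\<Sum>e\<le>d'. real d * r * ((real (d' choose e) * z ^ (d' - e)) * q e y))"
  proof (rule sum.cong[OF refl])
    fix e
    have "real (Suc d' choose Suc e) * real (Suc e) = real d * real (d' choose e)"
      using Suc_times_binomial[of e d'] unfolding Suc by (metis mult.commute of_nat_mult)
    then show "(real (Suc d' choose Suc e) * z ^ (d' - e)) * (real (Suc e) * r * q e y) = real d * r * ((real (d' choose e) * z ^ (d' - e)) * q e y)"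
      by (simp only: mult_ac) (metis mult.assoc mult.commute)
  qed
  finally show ?thesis unfolding binpoly_def Suc sum_distrib_left by simp
qed simp

text \<open>A formal derivative in z, by (d - e) (d choose e) = d (d-1 choose e). It measures how
  far the inhomogeneous sum is from satisfying Euler's identity.\<close>

lemma binpoly_euler: "real d * binpoly q z d y - (\<Sum>e\<le>d. (real (d choose e) * z ^ (d - e)) * (real e * q e y)) = real d * z * binpoly q z (d - 1) y"
proof (cases d)
  case (Suc d')
  have "real d * binpoly q z d y - (\<Sum>e\<le>d. (real (d choose e) * z ^ (d - e)) * (real e * q e y)) =
     (\<Sum>e\<le>Suc d'. (real (Suc d' choose e) * z ^ (Suc d' - e)) * ((real (Suc d') - real e) * q e y))"
    unfolding binpoly_def Suc sum_distrib_left sum_subtractf[symmetric] by (intro sum.cong refl) (simp add: algebra_simps)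
  also have "\<dots> = (\<Sum>e\<le>d'. (real (Suc d' choose e) * z ^ (Suc d' - e)) * ((real (Suc d') - real e) * q e y))"
    by simp
  also have "\<dots> = (\<Sum>e\<le>d'. real d * z * ((real (d' choose e) * z ^ (d' - e)) * q e y))"
  proof (rule sum.cong[OF refl])
    fix e assume e: "e \<in> {..d'}"
    have "(Suc d' - e) * (Suc d' choose e) = Suc d' * (d' choose e)"
      using binomial_absorb_comp[of "Suc d'" e] by simp
    then have "real (Suc d' - e) * real (Suc d' choose e) = real d * real (d' choose e)"
      unfolding Suc by (metis of_nat_mult)
    moreover have "real (Suc d' - e) = real (Suc d') - real e" using e by (simp add: of_nat_diff)
    ultimately have *: "(real (Suc d') - real e) * real (Suc d' choose e) = real d * real (d' choose e)" by simp
    have "z ^ (Suc d' - e) = z * z ^ (d' - e)" using e by (simp add: Suc_diff_le)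
    then have "(real (Suc d' choose e) * z ^ (Suc d' - e)) * ((real (Suc d') - real e) * q e y) =
       ((real (Suc d') - real e) * real (Suc d' choose e)) * (z * z ^ (d' - e) * q e y)" by (simp only: mult_ac)
    then show "(real (Suc d' choose e) * z ^ (Suc d' - e)) * ((real (Suc d') - real e) * q e y) = real d * z * ((real (d' choose e) * z ^ (d' - e)) * q e y)"
      unfolding * by (simp only: mult_ac)
  qed
  finally show ?thesis unfolding binpoly_def Suc sum_distrib_left by simp
qed simp

lemma binomial_integral:
  assumes \<mu>: "intertwining_measures n k \<mu>" "y \<in> Rsp n"
  shows "(\<integral>w. (lin n b w + z) ^ d \<partial>\<mu> y) = binpoly (mom \<mu> n b) z d y"
proof -
  have "(\<integral>w. (lin n b w + z) ^ d \<partial>\<mu> y) = (\<integral>w. (\<Sum>e\<le>d. (real (d choose e) * z ^ (d - e)) * lin n b w ^ e) \<partial>\<mu> y)"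
    by (intro Bochner_Integration.integral_cong refl) (simp only: binomial_ring mult_ac)
  also have "\<dots> = (\<Sum>e\<le>d. (real (d choose e) * z ^ (d - e)) * mom \<mu> n b e y)"
    unfolding mom_def
    using intertwining_poly_integrable[OF \<mu> poly_fun_power[OF lin_poly_fun]]
    by (subst Bochner_Integration.integral_sum) auto
  finally show ?thesis unfolding binpoly_def .
qed

text \<open>On all of \<open>Rsp n\<close>, points with equal coordinates included, the moments
  coincide with polynomials, whence measurability with respect to the product Borel sets.\<close>

lemma binomial_integral_measurable:
  assumes \<mu>: "intertwining_measures n k \<mu>"
  shows "(\<lambda>y. \<integral>w. (lin n b w + z) ^ d \<partial>\<mu> y) \<in> borel_measurable (Rmeas n)"
proof -
  have "mom \<mu> n b e \<in> borel_measurable (Rmeas n)" for e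
  proof -
    obtain q where q: "hom_poly n e q" "\<forall>x\<in>Rsp n. mom \<mu> n b e x = q x" using mom_poly[OF \<mu>] by blast
    have "q \<in> borel_measurable (Rmeas n)" using q(1) poly_fun_measurable by (auto simp: hom_poly_def)
    then show ?thesis by (rule measurable_cong[THEN iffD2, rotated]) (use q(2) in \<open>auto simp: space_PiM\<close>)
  qed
  then have "binpoly (mom \<mu> n b) z d \<in> borel_measurable (Rmeas n)"
    unfolding binpoly_def[abs_def] by measurable
  then show ?thesis
    by (rule measurable_cong[THEN iffD2, rotated]) (simp add: space_PiM binomial_integral[OF \<mu>])
qed

text \<open>The coordinate sum is invariant under permutations. Hence the constant term of the
  affine form is the same on the whole orbit, and one family of polynomials in
  \<open>power_formula\<close> serves every orbit point.\<close>

lemma lin_split: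
  assumes \<sigma>: "\<sigma> permutes {1..n+1}"
  shows "lin (n+1) a (x \<circ> \<sigma>) = lin n (\<lambda>s. a s - a (n+1)) (x \<circ> \<sigma>) + a (n+1) * (\<Sum>l\<in>{1..n+1}. x l)"
proof -
  have "(\<Sum>l\<in>{1..n+1}. x l) = (\<Sum>l\<in>{1..n+1}. (x \<circ> \<sigma>) l)"
    using sum.permute[OF \<sigma>, of x] by simp
  then show ?thesis
    unfolding lin_def by (simp add: sum.cl_ivl_Suc algebra_simps sum_subtractf sum_distrib_left)
qed

context chamber
begin

lemma AA_cong:
  assumes "\<And>y. y \<in> Rsp n \<Longrightarrow> g y = g' y"
  shows "AA k x g = AA k x g'"
  unfolding AA_def
proof (rule Bochner_Integration.integral_cong[OF refl])
  fix \<nu> assume "\<nu> \<in> space (Rmeas n)"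
  then have "\<nu> \<in> Rsp n" by (simp add: space_PiM)
  then have "alt n (\<lambda>y. Qf n x y * g y) \<nu> = alt n (\<lambda>y. Qf n x y * g' y) \<nu>"
    using assms Rsp_comp by (intro alt_cong) simp
  then show "wt (\<lambda>_. k) \<nu> * alt n (\<lambda>y. Qf n x y * g y) \<nu> = wt (\<lambda>_. k) \<nu> * alt n (\<lambda>y. Qf n x y * g' y) \<nu>"
    by simp
qed

lemma AA_lincomb:
  assumes k: "k > 0" and g: "g \<in> poly_fun n" "h \<in> poly_fun n"
  shows "AA k x (\<lambda>y. u * g y - v * h y) = u * AA k x g - v * AA k x h"
proof -
  have i: "integrable (Rmeas n) (\<lambda>\<nu>. wt (\<lambda>_. k) \<nu> * alt n (\<lambda>y. Qf n x y * g y) \<nu>)" if "g \<in> poly_fun n" for g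
    using that k by (intro wt_alt_integrable poly_fun.pmult Qf_poly_fun)
  have eq: "alt n (\<lambda>y. Qf n x y * (u * g y - v * h y)) \<nu> = u * alt n (\<lambda>y. Qf n x y * g y) \<nu> - v * alt n (\<lambda>y. Qf n x y * h y) \<nu>" for \<nu>
    unfolding alt_cmult[symmetric] alt_diff[symmetric] by (simp add: algebra_simps)
  have "AA k x (\<lambda>y. u * g y - v * h y) = (\<integral>\<nu>. u * (wt (\<lambda>_. k) \<nu> * alt n (\<lambda>y. Qf n x y * g y) \<nu>) - v * (wt (\<lambda>_. k) \<nu> * alt n (\<lambda>y. Qf n x y * h y) \<nu>) \<partial>Rmeas n)"
    unfolding AA_def eq by (simp only: right_diff_distrib mult_ac)
  then show ?thesis unfolding AA_def using i g by simp
qed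

lemma power_formula:
  assumes k: "k > 0" and \<mu>: "intertwining_measures (n+1) k \<mu>" and \<mu>': "intertwining_measures n k \<mu>'"
    and lam: "lam \<in> Rsp (n+1)"
  shows "mom \<mu> (n+1) a d lam = c_nk n k / vdm (n+1) lam powr (2 * k) *
    AA k lam (\<lambda>y. \<integral>z. (lin n (\<lambda>s. a s - a (n+1)) z + a (n+1) * (\<Sum>l\<in>{1..n+1}. lam l)) ^ d \<partial>\<mu>' y)"
proof -
  define K where "K = c_nk n k / vdm (n+1) lam powr (2 * k)"
  define b where "b = (\<lambda>s. a s - a (n+1))"
  define z where "z = a (n+1) * (\<Sum>l\<in>{1..n+1}. lam l)"
  obtain q where q: "\<And>e. hom_poly n e (q e)" "\<And>e y. y \<in> Rsp n \<Longrightarrow> mom \<mu>' n b e y = q e y"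
    "\<And>e s y. s \<in> {1..n} \<Longrightarrow> y \<in> Rsp n \<Longrightarrow> inj_on y {1..n} \<Longrightarrow> dunkl_T n k s (q e) y = real e * b s * mom \<mu>' n b (e - 1) y"
    using mom_poly[OF \<mu>', of _ b] by metis
  have qp: "q e \<in> poly_fun n" for e using q(1) by (simp add: hom_poly_def)
  \<comment> \<open>A polynomial family agreeing on \<open>Rsp n\<close> with the lower-rank
    operator applied to powers of the affine form; \<open>AA_euler\<close> differentiates its
    argument and works with polynomials.\<close>
  define G where "G = binpoly q z"
  have Gp: "G e \<in> poly_fun n" for e
    unfolding G_def binpoly_def using qp by (intro poly_fun_sum poly_fun.pmult poly_fun.pconst) auto
  have T: "dunkl_T n k s (G e) y = real e * b s * G (e - 1) y"
    if "s \<in> {1..n}" "y \<in> Rsp n" "inj_on y {1..n}" for s y e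
  proof -
    have "dunkl_T n k s (G e) y = (\<Sum>i\<le>e. (real (e choose i) * z ^ (e - i)) * (real i * b s * q (i - 1) y))"
      unfolding G_def binpoly_def dunkl_T_lincomb[OF qp] using q(2,3) that by simp
    then show ?thesis unfolding binpoly_lower G_def .
  qed
  have E: "real e * G e y - (\<Sum>s\<in>{1..n}. y s * pd s (G e) y) = real e * z * G (e - 1) y" if "y \<in> Rsp n" for y e
  proof -
    have "(\<Sum>s\<in>{1..n}. y s * pd s (G e) y) = (\<Sum>s\<in>{1..n}. \<Sum>i\<le>e. (real (e choose i) * z ^ (e - i)) * (y s * pd s (q i) y))"
      unfolding G_def binpoly_def pd_lincomb[OF qp] sum_distrib_left by (simp only: mult_ac)
    also have "\<dots> = (\<Sum>i\<le>e. (real (e choose i) * z ^ (e - i)) * (\<Sum>s\<in>{1..n}. y s * pd s (q i) y))"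
      by (subst sum.swap) (simp only: sum_distrib_left)
    also have "\<dots> = (\<Sum>i\<le>e. (real (e choose i) * z ^ (e - i)) * (real i * q i y))"
      using hom_poly_euler[OF q(1) that] by simp
    finally show ?thesis unfolding G_def binpoly_euler[symmetric] by simp
  qed
  \<comment> \<open>The sign turns the plus between a point and its exchange in
    \<open>AA_euler\<close> into the minus of the Euler equation for moments.\<close>
  define A where "A = (\<lambda>\<sigma> e. K * (of_int (sign \<sigma>) * AA k (lam \<circ> \<sigma>) (G e)))"
  have A: "real e * A \<sigma> e + k * (\<Sum>p\<in>prs (n+1). A \<sigma> e - A (swp p \<sigma>) e) = real e * (lin (n+1) a (lam \<circ> \<sigma>) * A \<sigma> (e - 1))"
    if \<sigma>: "\<sigma> \<in> perms (n+1)" for \<sigma> e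
  proof -
    let ?x = "lam \<circ> \<sigma>"
    let ?l = "lin (n+1) a ?x"
    \<comment> \<open>Pairing \<open>?x\<close> with the lower-rank Dunkl equations yields the
      linear part of \<open>?l\<close>, and the Euler defect of the inhomogeneous \<open>G\<close>
      yields its constant term \<open>z\<close>.\<close>
    let ?\<rho> = "\<lambda>y. (real e * ?l) * G (e - 1) y - real e * G e y"
    have s: "\<sigma> permutes {1..n+1}" using \<sigma> by simp
    have "k * (\<Sum>(i, j)\<in>prs (n+1). AA k ?x (G e) + AA k (swapc i j ?x) (G e)) = AA k ?x ?\<rho>"
    proof (rule AA_euler[OF k s Gp _ refl])
      show "?\<rho> \<in> poly_fun n" using Gp by (intro poly_fun_diff poly_fun.pmult poly_fun.pconst)
      fix y assume y: "y \<in> Rsp n" "inj_on y {1..n}"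
      have "(\<Sum>s\<in>{1..n}. ?x s * dunkl_T n k s (G e) y) = (\<Sum>s\<in>{1..n}. ?x s * pd s (G e) y) +
         k * (\<Sum>s\<in>{1..n}. \<Sum>t\<in>{1..n}-{s}. ?x s * ((G e y - G e (swapc t s y)) / (y s - y t)))"
        unfolding dunkl_T_def by (simp add: distrib_left sum.distrib sum_distrib_left mult_ac)
      also have "(\<Sum>s\<in>{1..n}. \<Sum>t\<in>{1..n}-{s}. ?x s * ((G e y - G e (swapc t s y)) / (y s - y t))) =
         (\<Sum>(s, t)\<in>prs n. ?x t * ((G e y - G e (swapc s t y)) / (y t - y s)) + ?x s * ((G e y - G e (swapc t s y)) / (y s - y t)))"
        by (rule sum_offdiag)
      also have "\<dots> = (\<Sum>(s, t)\<in>prs n. (?x s - ?x t) * ((G e y - G e (swapc s t y)) / (y s - y t)))"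
      proof (intro sum.cong refl, clarify)
        fix s t
        have "swapc t s y = swapc s t y" by (auto simp: swapc_def fun_eq_iff)
        moreover have "u / (y t - y s) = - (u / (y s - y t))" for u
          by (metis minus_diff_eq divide_minus_right)
        ultimately show "?x t * ((G e y - G e (swapc s t y)) / (y t - y s)) + ?x s * ((G e y - G e (swapc t s y)) / (y s - y t)) =
          (?x s - ?x t) * ((G e y - G e (swapc s t y)) / (y s - y t))"
          by (simp only: left_diff_distrib mult_minus_right uminus_add_conv_diff)
      qed
      finally have X: "(\<Sum>s\<in>{1..n}. ?x s * dunkl_T n k s (G e) y) = (\<Sum>s\<in>{1..n}. ?x s * pd s (G e) y) +
         k * (\<Sum>(s, t)\<in>prs n. (?x s - ?x t) * ((G e y - G e (swapc s t y)) / (y s - y t)))" .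
      have "(\<Sum>s\<in>{1..n}. ?x s * dunkl_T n k s (G e) y) = real e * lin n b ?x * G (e - 1) y"
        using T y unfolding lin_def by (simp add: sum_distrib_left sum_distrib_right mult_ac)
      moreover have "?l = lin n b ?x + z" unfolding b_def z_def by (rule lin_split[OF s])
      ultimately have "?\<rho> y = (\<Sum>s\<in>{1..n}. ?x s * dunkl_T n k s (G e) y) - (\<Sum>s\<in>{1..n}. y s * pd s (G e) y)"
        using E[OF y(1), of e] by (simp add: algebra_simps)
      then show "?\<rho> y = (\<Sum>s\<in>{1..n}. (?x s - y s) * pd s (G e) y) +
         k * (\<Sum>(s, t)\<in>prs n. (?x s - ?x t) * ((G e y - G e (swapc s t y)) / (y s - y t)))"
        unfolding X by (simp add: left_diff_distrib sum_subtractf)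
    qed
    also have "AA k ?x ?\<rho> = (real e * ?l) * AA k ?x (G (e - 1)) - real e * AA k ?x (G e)"
      using k Gp Gp by (rule AA_lincomb)
    finally have *: "real e * AA k ?x (G e) + k * (\<Sum>p\<in>prs (n+1). AA k ?x (G e) + AA k (lam \<circ> swp p \<sigma>) (G e)) = real e * (?l * AA k ?x (G (e - 1)))"
      unfolding comp_swp case_prod_unfold by simp
    have "A \<sigma> e - A (swp p \<sigma>) e = K * of_int (sign \<sigma>) * (AA k ?x (G e) + AA k (lam \<circ> swp p \<sigma>) (G e))" if "p \<in> prs (n+1)" for p
      unfolding A_def using sign_swp[OF that \<sigma>] by (simp add: algebra_simps)
    then have "(\<Sum>p\<in>prs (n+1). A \<sigma> e - A (swp p \<sigma>) e) = K * of_int (sign \<sigma>) * (\<Sum>p\<in>prs (n+1). AA k ?x (G e) + AA k (lam \<circ> swp p \<sigma>) (G e))"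
      unfolding sum_distrib_left by (intro sum.cong refl) auto
    then have "real e * A \<sigma> e + k * (\<Sum>p\<in>prs (n+1). A \<sigma> e - A (swp p \<sigma>) e) =
       K * of_int (sign \<sigma>) * (real e * AA k ?x (G e) + k * (\<Sum>p\<in>prs (n+1). AA k ?x (G e) + AA k (lam \<circ> swp p \<sigma>) (G e)))"
      by (simp only: A_def distrib_left mult_ac)
    also have "\<dots> = real e * (?l * A \<sigma> (e - 1))"
      unfolding * A_def by (simp only: mult_ac)
    finally show ?thesis .
  qed
  have id: "id \<in> perms (n+1)" by (simp add: permutes_id)
  have "A \<sigma> e = mom \<mu> (n+1) a e (lam \<circ> \<sigma>)" if "\<sigma> \<in> perms (n+1)" for \<sigma> e
    using that
  proof (induction e arbitrary: \<sigma>)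
    case 0
    \<comment> \<open>In degree 0 the equation only says that the differences sum to zero. Constancy
      moves the evaluation to the identity, where \<open>normalisation\<close> applies.\<close>
    have "A \<sigma> 0 = A id 0"
    proof (rule harmonic_perms_constant[where m = "n+1" and e = "\<lambda>\<sigma>. A \<sigma> 0", OF _ 0 id])
      fix \<tau> assume "\<tau> \<in> perms (n+1)"
      then show "(\<Sum>p\<in>prs (n+1). A \<tau> 0 - A (swp p \<tau>) 0) = 0" using A[of \<tau> 0] k by simp
    qed
    also have "A id 0 = K * AA k lam (G 0)" by (simp add: A_def sign_id)
    also have "AA k lam (G 0) = AA k lam (\<lambda>_. 1)"
    proof (rule AA_cong)
      fix y assume "y \<in> Rsp n"
      then show "G 0 y = 1" using q(2)[of y 0] mom_0[OF \<mu>', of y b] by (simp add: G_def binpoly_def)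
    qed
    also have "K * AA k lam (\<lambda>_. 1) = 1"
      unfolding AA_def alt_def K_def mult_1_right by (rule normalisation[OF k])
    finally have "A \<sigma> 0 = 1" .
    moreover have "mom \<mu> (n+1) a 0 (lam \<circ> \<sigma>) = 1"
      using 0 by (intro mom_0[OF \<mu> Rsp_comp[OF lam]]) simp
    ultimately show ?case by (simp add: comp_def)
  next
    case (Suc e)
    \<comment> \<open>The bound is zero because the difference of the two solutions satisfies the
      homogeneous equation on the whole orbit.\<close>
    have "\<bar>A \<sigma> (Suc e) - mom \<mu> (n+1) a (Suc e) (lam \<circ> \<sigma>)\<bar> \<le> 0"
    proof (rule max_principle_abs[where W = "perms (n+1)" and P = "prs (n+1)" and sw = swp and d = "real (Suc e)" and k = k
          and e = "\<lambda>\<sigma>. A \<sigma> (Suc e) - mom \<mu> (n+1) a (Suc e) (lam \<circ> \<sigma>)"])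
      show "finite (perms (n+1))" by (rule finite_permutations) simp
      fix \<tau> assume \<tau>: "\<tau> \<in> perms (n+1)"
      let ?S = "mom \<mu> (n+1) a (Suc e)"
      have "real (Suc e) * (A \<tau> (Suc e) - ?S (lam \<circ> \<tau>)) +
         k * (\<Sum>p\<in>prs (n+1). A \<tau> (Suc e) - ?S (lam \<circ> \<tau>) - (A (swp p \<tau>) (Suc e) - ?S (lam \<circ> swp p \<tau>))) =
         (real (Suc e) * A \<tau> (Suc e) + k * (\<Sum>p\<in>prs (n+1). A \<tau> (Suc e) - A (swp p \<tau>) (Suc e))) -
         (real (Suc e) * ?S (lam \<circ> \<tau>) + k * (\<Sum>p\<in>prs (n+1). ?S (lam \<circ> \<tau>) - ?S (lam \<circ> swp p \<tau>)))"
      proof -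
        have "(\<Sum>p\<in>prs (n+1). A \<tau> (Suc e) - ?S (lam \<circ> \<tau>) - (A (swp p \<tau>) (Suc e) - ?S (lam \<circ> swp p \<tau>))) =
          (\<Sum>p\<in>prs (n+1). A \<tau> (Suc e) - A (swp p \<tau>) (Suc e)) - (\<Sum>p\<in>prs (n+1). ?S (lam \<circ> \<tau>) - ?S (lam \<circ> swp p \<tau>))"
          unfolding sum_subtractf[symmetric] by (intro sum.cong refl) simp
        then show ?thesis by (simp only: right_diff_distrib)
      qed
      also have "\<dots> = 0"
        unfolding A[OF \<tau>] mom_euler_perm[OF \<mu> lam lam_inj \<tau>] diff_Suc_1
        using Suc.IH[OF \<tau>] by (simp add: comp_def)
      finally show "\<bar>real (Suc e) * (A \<tau> (Suc e) - ?S (lam \<circ> \<tau>)) +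
         k * (\<Sum>p\<in>prs (n+1). A \<tau> (Suc e) - ?S (lam \<circ> \<tau>) - (A (swp p \<tau>) (Suc e) - ?S (lam \<circ> swp p \<tau>)))\<bar> \<le> real (Suc e) * 0"
        by simp
    qed (use Suc.prems swp_perms k in auto)
    then show ?case by (simp add: comp_def)
  qed
  from this[OF id, of d] have "mom \<mu> (n+1) a d lam = K * AA k lam (G d)"
    by (simp add: A_def sign_id)
  also have "AA k lam (G d) = AA k lam (\<lambda>y. \<integral>w. (lin n b w + z) ^ d \<partial>\<mu>' y)"
  proof (rule AA_cong)
    fix y assume y: "y \<in> Rsp n"
    show "G d y = (\<integral>w. (lin n b w + z) ^ d \<partial>\<mu>' y)"
      unfolding binomial_integral[OF \<mu>' y] G_def binpoly_def using q(2)[OF y] by simp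
  qed
  finally show ?thesis unfolding b_def z_def K_def .
qed

end

section \<open>From exponentials to continuous functions\<close>

definition cube :: "nat \<Rightarrow> real \<Rightarrow> (nat \<Rightarrow> real) set" where
  "cube m R = PiE {1..m} (\<lambda>_. {-R..R})"

lemma cube_Rsp: "cube m R \<subseteq> Rsp m"
  by (auto simp: cube_def)

lemma cube_mono: "R \<le> R' \<Longrightarrow> cube m R \<subseteq> cube m R'"
  unfolding cube_def by (intro PiE_mono) auto

text \<open>Extensionality pins every coordinate outside {1..m} to \<open>undefined\<close>, so the
  cube is a product of compact factors over all indices and Tychonoff's theorem applies.\<close>

lemma compact_cube: "compact (cube m R)"
proof -
  have "cube m R = PiE UNIV (\<lambda>i. if i \<in> {1..m} then {-R..R} else {undefined})"
    unfolding cube_def by (auto simp: PiE_def extensional_def Pi_def split: if_splits)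
  moreover have "compactin (product_topology (\<lambda>_. euclidean) UNIV) (PiE UNIV (\<lambda>i. if i \<in> {1..m} then {-R..R} else {undefined}))"
    unfolding compactin_PiE by auto
  ultimately show ?thesis
    by (simp add: euclidean_product_topology)
qed

lemma continuous_on_cube_bounded:
  fixes f :: "(nat \<Rightarrow> real) \<Rightarrow> real"
  assumes "continuous_on (Rsp m) f"
  shows "\<exists>B. \<forall>x\<in>cube m R. \<bar>f x\<bar> \<le> B"
proof -
  have "bounded (f ` cube m R)"
    by (intro compact_imp_bounded compact_continuous_image compact_cube continuous_on_subset[OF assms cube_Rsp])
  then obtain B where "\<forall>y\<in>f ` cube m R. norm y \<le> B" unfolding bounded_iff by blast
  then show ?thesis by (intro exI[of _ B]) simp
qed

text \<open>Continuity refers to the product topology over all natural indices, measurability to the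
  product over {1..m}. The identity between the two is measurable because the additional coordinates
  are constant on extensional functions.\<close>

lemma continuous_on_Rsp_measurable:
  fixes f :: "(nat \<Rightarrow> real) \<Rightarrow> real"
  assumes "continuous_on (Rsp m) f"
  shows "f \<in> borel_measurable (Rmeas m)"
proof -
  have c: "(\<lambda>x. x i) \<in> borel_measurable (Rmeas m)" for i
  proof (cases "i \<in> {1..m}")
    case True
    then show ?thesis using poly_fun_measurable[OF poly_fun.pvar] by simp
  next
    case False
    have "(\<lambda>x. x i) \<in> borel_measurable (Rmeas m) \<longleftrightarrow> (\<lambda>x. undefined :: real) \<in> borel_measurable (Rmeas m)"
      using False by (intro measurable_cong) (auto simp: space_PiM PiE_def extensional_def)
    then show ?thesis by simp
  qed
  have "(\<lambda>x i. x i) \<in> measurable (Rmeas m) (PiM UNIV (\<lambda>_::nat. borel :: real measure))"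
    using c by (intro measurable_PiM_single') auto
  moreover have "measurable (Rmeas m) (PiM UNIV (\<lambda>_::nat. borel :: real measure)) = measurable (Rmeas m) borel"
    by (rule measurable_cong_sets[OF refl sets_PiM_equal_borel])
  ultimately have "(\<lambda>x. x) \<in> measurable (Rmeas m) (borel :: (nat \<Rightarrow> real) measure)" by simp
  then have "(\<lambda>x. x) \<in> measurable (Rmeas m) (restrict_space borel (Rsp m))"
    by (intro measurable_restrict_space2) (auto simp: space_PiM)
  moreover have "f \<in> borel_measurable (restrict_space borel (Rsp m))"
    using assms by (rule borel_measurable_continuous_on_restrict)
  ultimately show ?thesis using measurable_compose[of "\<lambda>x. x"] by fastforce
qed

lemma continuous_on_lin [continuous_intros]: "continuous_on S (lin m a)"
proof -
  have "continuous_on UNIV (lin m a)"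
    unfolding lin_def[abs_def] by (intro continuous_intros continuous_on_product_coordinates)
  then show ?thesis by (rule continuous_on_subset) simp
qed

text \<open>Exponentials of linear forms multiply by adding the forms, so their span is an algebra,
  as Stone--Weierstrass requires; products of powers of different linear forms are not again such
  powers.\<close>

inductive_set exp_span :: "nat \<Rightarrow> ((nat \<Rightarrow> real) \<Rightarrow> real) set" for m where
  span_term: "(\<lambda>x. c * exp (lin m a x)) \<in> exp_span m"
| span_add: "f \<in> exp_span m \<Longrightarrow> g \<in> exp_span m \<Longrightarrow> (\<lambda>x. f x + g x) \<in> exp_span m"

lemma lin_add: "lin m (\<lambda>i. a i + b i) x = lin m a x + lin m b x"
  unfolding lin_def by (simp add: distrib_right sum.distrib)

lemma exp_span_mult:
  assumes "f \<in> exp_span m" "g \<in> exp_span m"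
  shows "(\<lambda>x. f x * g x) \<in> exp_span m"
  using assms(1)
proof induction
  case (span_term c a)
  show ?case using assms(2)
  proof induction
    case (span_term c' a')
    have "(\<lambda>x. c * exp (lin m a x) * (c' * exp (lin m a' x))) = (\<lambda>x. (c * c') * exp (lin m (\<lambda>i. a i + a' i) x))"
      by (simp add: lin_add exp_add mult_ac)
    then show ?case using exp_span.span_term by metis
  next
    case (span_add f g)
    then show ?case using exp_span.span_add[OF span_add.IH] by (simp add: distrib_left)
  qed
next
  case (span_add f1 f2)
  then show ?case using exp_span.span_add[OF span_add.IH] by (simp add: distrib_right)
qed

lemma exp_span_continuous: "f \<in> exp_span m \<Longrightarrow> continuous_on S f"
  by (induction rule: exp_span.induct) (auto intro!: continuous_intros)

lemma exp_span_dense: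
  assumes "continuous_on (Rsp m) f" "e > 0"
  shows "\<exists>g\<in>exp_span m. \<forall>x\<in>cube m R. \<bar>f x - g x\<bar> < e"
proof -
  have "\<exists>g. g \<in> exp_span m \<and> (\<forall>x\<in>cube m R. \<bar>f x - g x\<bar> < e)"
  proof (rule Stone_Weierstrass_HOL[OF compact_cube])
    show "(\<lambda>x. c) \<in> exp_span m" for c
      using exp_span.span_term[of c m "\<lambda>_. 0"] by (simp add: lin_def)
    fix x y assume xy: "x \<in> cube m R \<and> y \<in> cube m R \<and> x \<noteq> y"
    then obtain i where i: "i \<in> {1..m}" "x i \<noteq> y i"
      unfolding cube_def by (metis PiE_ext)
    then show "\<exists>f. f \<in> exp_span m \<and> f x \<noteq> f y"
      using exp_span.span_term[of 1 m "\<lambda>j. if j = i then 1 else 0"]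
      by (intro exI[of _ "\<lambda>z. exp (z i)"]) (simp add: lin_unit)
  qed (use assms exp_span_mult exp_span.span_add exp_span_continuous continuous_on_subset[OF assms(1) cube_Rsp] in auto)
  then show ?thesis by blast
qed

lemma (in prob_space) integral_diff_le:
  fixes f g :: "'a \<Rightarrow> real"
  assumes "integrable M f" "integrable M g" "AE x in M. \<bar>f x - g x\<bar> \<le> e"
  shows "\<bar>integral\<^sup>L M f - integral\<^sup>L M g\<bar> \<le> e"
proof -
  have i: "integrable M (\<lambda>x. \<bar>f x - g x\<bar>)" using assms by simp
  have "\<bar>integral\<^sup>L M f - integral\<^sup>L M g\<bar> = \<bar>\<integral>x. f x - g x \<partial>M\<bar>" using assms by simp
  also have "\<dots> \<le> (\<integral>x. \<bar>f x - g x\<bar> \<partial>M)" by (rule integral_abs_bound)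
  also have "\<dots> \<le> (\<integral>x. e \<partial>M)" using i assms(3) by (intro integral_mono_AE) auto
  finally show ?thesis by (simp add: prob_space)
qed

lemma comp_perm_measurable:
  assumes "w permutes {1..n}"
  shows "(\<lambda>\<nu>. \<nu> \<circ> w) \<in> measurable (Rmeas n) (Rmeas n)"
  unfolding comp_def
proof (rule measurable_PiM_single')
  show "(\<lambda>\<nu>. \<nu> (w i)) \<in> measurable (Rmeas n) lborel" if "i \<in> {1..n}" for i
    using that permutes_in_image[OF assms] by (intro measurable_component_singleton) auto
  show "(\<lambda>\<nu> i. \<nu> (w i)) \<in> space (Rmeas n) \<rightarrow> (\<Pi>\<^sub>E i\<in>{1..n}. space lborel)"
    using Rsp_comp[OF _ assms] by (auto simp: space_PiM comp_def)
qed

lemma alt_measurable: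
  assumes "g \<in> borel_measurable (Rmeas n)"
  shows "alt n g \<in> borel_measurable (Rmeas n)"
  unfolding alt_def[abs_def]
  using measurable_compose[OF comp_perm_measurable assms]
  by (intro borel_measurable_sum borel_measurable_times borel_measurable_const) (auto simp: comp_def)

lemma AE_coordinate_neq:
  assumes i: "i \<in> {1..n}"
  shows "AE \<nu> in Rmeas n. \<nu> i \<noteq> c"
proof (rule AE_I')
  interpret product_sigma_finite "\<lambda>_::nat. lborel :: real measure" ..
  let ?A = "\<lambda>j. if j = i then {c} else UNIV :: real set"
  have "emeasure (Rmeas n) (PiE {1..n} ?A) = (\<Prod>j\<in>{1..n}. emeasure lborel (?A j))"
    by (rule emeasure_PiM) auto
  also have "\<dots> = 0" using i by (intro prod_zero bexI[of _ i]) auto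
  finally show "PiE {1..n} ?A \<in> null_sets (Rmeas n)"
    by (intro null_setsI sets_PiM_I_finite) auto
  show "{\<nu> \<in> space (Rmeas n). \<not> \<nu> i \<noteq> c} \<subseteq> PiE {1..n} ?A"
    by (auto simp: space_PiM PiE_def Pi_def)
qed

section \<open>Uniform supports and passage to the limit\<close>

locale intertwined_chamber = chamber +
  fixes k :: real and \<mu> \<mu>' :: "(nat \<Rightarrow> real) \<Rightarrow> (nat \<Rightarrow> real) measure"
  assumes k: "k > 0" and \<mu>: "intertwining_measures (n+1) k \<mu>" and \<mu>': "intertwining_measures n k \<mu>'"
    and lam: "lam \<in> Rsp (n+1)"
begin

text \<open>The affine parametrisation of the hyperplane of points with the same coordinate sum as
  \<open>lam\<close>; \<open>f_lam\<close> is composition with it.\<close>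

definition ext :: "(nat \<Rightarrow> real) \<Rightarrow> nat \<Rightarrow> real" where
  "ext z = restrict (\<lambda>i. if i \<le> n then z i else (\<Sum>l\<in>{1..n+1}. lam l) - (\<Sum>l\<in>{1..n}. z l)) {1..n+1}"

lemma f_lam_ext: "f_lam n f lam z = f (ext z)"
  unfolding f_lam_def ext_def ..

lemma lin_ext: "lin (n+1) a (ext z) = lin n (\<lambda>s. a s - a (n+1)) z + a (n+1) * (\<Sum>l\<in>{1..n+1}. lam l)"
proof -
  have "lin (n+1) a (ext z) = (\<Sum>i\<in>{1..n}. a i * ext z i) + a (n+1) * ext z (n+1)"
    unfolding lin_def by (simp add: sum.cl_ivl_Suc)
  also have "(\<Sum>i\<in>{1..n}. a i * ext z i) = (\<Sum>i\<in>{1..n}. a i * z i)"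
    by (intro sum.cong) (auto simp: ext_def)
  also have "ext z (n+1) = (\<Sum>l\<in>{1..n+1}. lam l) - (\<Sum>l\<in>{1..n}. z l)" by (simp add: ext_def)
  finally show ?thesis
    unfolding lin_def by (simp add: left_diff_distrib sum_subtractf right_diff_distrib sum_distrib_left)
qed

lemma ext_measurable: "ext \<in> measurable (Rmeas n) (Rmeas (n+1))"
  unfolding ext_def
proof (rule measurable_restrict)
  fix i assume i: "i \<in> {1..n+1}"
  have z: "(\<lambda>z. z l) \<in> borel_measurable (Rmeas n)" if "l \<in> {1..n}" for l
    using that by (intro poly_fun_measurable poly_fun.pvar)
  show "(\<lambda>z. if i \<le> n then z i else (\<Sum>l\<in>{1..n+1}. lam l) - (\<Sum>l\<in>{1..n}. z l)) \<in> measurable (Rmeas n) lborel"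
  proof (cases "i \<le> n")
    case True
    then show ?thesis using z[of i] i by simp
  next
    case False
    have "(\<lambda>z. (\<Sum>l\<in>{1..n+1}. lam l) - (\<Sum>l\<in>{1..n}. z l)) \<in> borel_measurable (Rmeas n)"
      using z by (intro borel_measurable_diff borel_measurable_const borel_measurable_sum)
    then show ?thesis using False by simp
  qed
qed

lemma ext_cube:
  assumes R: "R \<ge> 0" and z: "\<forall>i\<in>{1..n}. \<bar>z i\<bar> \<le> R"
  shows "ext z \<in> cube (n+1) (\<bar>\<Sum>l\<in>{1..n+1}. lam l\<bar> + real (n+1) * R)"
proof -
  have "\<bar>\<Sum>l\<in>{1..n}. z l\<bar> \<le> (\<Sum>l\<in>{1..n}. R)"
    using z by (intro order.trans[OF sum_abs] sum_mono) auto
  then have s: "\<bar>\<Sum>l\<in>{1..n}. z l\<bar> \<le> real n * R" by simp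
  have "\<bar>ext z i\<bar> \<le> \<bar>\<Sum>l\<in>{1..n+1}. lam l\<bar> + real (n+1) * R" if i: "i \<in> {1..n+1}" for i
  proof (cases "i \<le> n")
    case True
    then have "\<bar>ext z i\<bar> \<le> R" using i z by (auto simp: ext_def)
    also have "\<dots> \<le> real (n+1) * R" using R by (simp add: algebra_simps)
    finally show ?thesis by simp
  next
    case False
    then have "\<bar>ext z i\<bar> \<le> \<bar>\<Sum>l\<in>{1..n+1}. lam l\<bar> + \<bar>\<Sum>l\<in>{1..n}. z l\<bar>" using i by (auto simp: ext_def)
    then show ?thesis using s R by (simp add: algebra_simps)
  qed
  then have "ext z i \<in> {- (\<bar>\<Sum>l\<in>{1..n+1}. lam l\<bar> + real (n+1) * R)..\<bar>\<Sum>l\<in>{1..n+1}. lam l\<bar> + real (n+1) * R}"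
    if "i \<in> {1..n+1}" for i
    using that unfolding atLeastAtMost_iff by (meson abs_le_D1 abs_le_iff minus_le_iff)
  then show ?thesis
    unfolding cube_def by (intro PiE_I) (auto simp: ext_def)
qed

lemma \<mu>'_support:
  assumes y: "y \<in> Rsp n"
  shows "\<exists>R. AE z in \<mu>' y. ext z \<in> cube (n+1) R"
proof -
  obtain R where R: "AE z in \<mu>' y. \<forall>i\<in>{1..n}. \<bar>z i\<bar> \<le> R"
    using intertwining_measuresD(3)[OF \<mu>' y] by blast
  have "AE z in \<mu>' y. ext z \<in> cube (n+1) (\<bar>\<Sum>l\<in>{1..n+1}. lam l\<bar> + real (n+1) * \<bar>R\<bar>)"
    using R by eventually_elim (intro ext_cube, auto)
  then show ?thesis by blast
qed

text \<open>\<open>intertwining_support\<close> needs a strictly positive bound, hence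
  \<open>Rad + 1\<close>, and adds another 1; the remaining terms are those of
  \<open>ext_cube\<close> for the radius \<open>Rad + 2\<close>.\<close>

definition Rb :: real where "Rb = \<bar>\<Sum>l\<in>{1..n+1}. lam l\<bar> + real (n+1) * (Rad + 2)"

lemma Rad_nonneg: "Rad \<ge> 0"
  unfolding Rad_def by (intro sum_nonneg) auto

lemma \<mu>'_support_box:
  assumes \<nu>: "\<nu> \<in> Rsp n" "inbox \<nu>" and w: "w permutes {1..n}"
  shows "AE z in \<mu>' (\<nu> \<circ> w). ext z \<in> cube (n+1) Rb"
proof -
  have "AE z in \<mu>' (\<nu> \<circ> w). \<forall>i\<in>{1..n}. \<bar>z i\<bar> \<le> (Rad + 1) + 1"
  proof (rule intertwining_support[OF \<mu>' Rsp_comp[OF \<nu>(1) w] inj_on_comp_perm[OF inbox_inj[OF \<nu>(2)] w]])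
    fix j assume "j \<in> {1..n}"
    then have "w j \<in> {1..n}" using permutes_in_image[OF w] by simp
    then show "\<bar>(\<nu> \<circ> w) j\<bar> \<le> Rad + 1" using cell_Rad[of "w j" "\<nu> (w j)"] \<nu>(2) by auto
  qed (use k Rad_nonneg in auto)
  then have "AE z in \<mu>' (\<nu> \<circ> w). \<forall>i\<in>{1..n}. \<bar>z i\<bar> \<le> Rad + 2" by (simp only: add.assoc one_add_one)
  then show ?thesis
    unfolding Rb_def by eventually_elim (intro ext_cube, use Rad_nonneg in auto)
qed

lemma \<mu>_support: "\<exists>R. AE z in \<mu> lam. z \<in> cube (n+1) R"
proof -
  obtain R where R: "AE z in \<mu> lam. \<forall>i\<in>{1..n+1}. \<bar>z i\<bar> \<le> R"
    using intertwining_measuresD(3)[OF \<mu> lam] by blast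
  have "space (\<mu> lam) = Rsp (n+1)"
    using sets_eq_imp_space_eq[OF intertwining_measuresD(2)[OF \<mu> lam]] by (simp add: space_PiM)
  then have "AE z in \<mu> lam. z \<in> Rsp (n+1)" by (metis AE_space)
  then have "AE z in \<mu> lam. z \<in> cube (n+1) R"
    using R by eventually_elim (auto simp: cube_def PiE_def Pi_def abs_le_iff minus_le_iff)
  then show ?thesis by blast
qed

lemma f_lam_measurable:
  assumes "continuous_on (Rsp (n+1)) f"
  shows "f_lam n f lam \<in> borel_measurable (Rmeas n)"
  unfolding f_lam_ext[abs_def]
  using measurable_compose[OF ext_measurable continuous_on_Rsp_measurable[OF assms]] .

lemma f_lam_integrable:
  assumes f: "continuous_on (Rsp (n+1)) f" and y: "y \<in> Rsp n"
  shows "integrable (\<mu>' y) (f_lam n f lam)"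
proof -
  interpret prob_space "\<mu>' y" using intertwining_measuresD(1)[OF \<mu>' y] .
  obtain R where R: "AE z in \<mu>' y. ext z \<in> cube (n+1) R" using \<mu>'_support[OF y] by blast
  obtain B where B: "\<And>x. x \<in> cube (n+1) R \<Longrightarrow> \<bar>f x\<bar> \<le> B" using continuous_on_cube_bounded[OF f] by blast
  have "f_lam n f lam \<in> borel_measurable (\<mu>' y)"
    using f_lam_measurable[OF f] measurable_cong_sets[OF intertwining_measuresD(2)[OF \<mu>' y] refl] by blast
  moreover have "AE z in \<mu>' y. norm (f_lam n f lam z) \<le> B"
    using R by eventually_elim (use B in \<open>auto simp: f_lam_ext\<close>)
  ultimately show ?thesis by (rule integrable_const_bound[rotated])
qed

lemma f_integrable:
  fixes f :: "(nat \<Rightarrow> real) \<Rightarrow> real"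
  assumes f: "continuous_on (Rsp (n+1)) f"
  shows "integrable (\<mu> lam) f"
proof -
  interpret prob_space "\<mu> lam" using intertwining_measuresD(1)[OF \<mu> lam] .
  obtain R where R: "AE z in \<mu> lam. z \<in> cube (n+1) R" using \<mu>_support by blast
  obtain B where B: "\<And>x. x \<in> cube (n+1) R \<Longrightarrow> \<bar>f x\<bar> \<le> B" using continuous_on_cube_bounded[OF f] by blast
  have "f \<in> borel_measurable (\<mu> lam)"
    using continuous_on_Rsp_measurable[OF f] measurable_cong_sets[OF intertwining_measuresD(2)[OF \<mu> lam] refl] by blast
  moreover have "AE z in \<mu> lam. norm (f z) \<le> B"
    using R by eventually_elim (use B in auto)
  ultimately show ?thesis by (rule integrable_const_bound[rotated])
qed

abbreviation Vt :: "((nat \<Rightarrow> real) \<Rightarrow> real) \<Rightarrow> (nat \<Rightarrow> real) \<Rightarrow> real" where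
  "Vt f \<equiv> Vk \<mu>' (f_lam n f lam)"

lemma Vt_diff_le:
  assumes "continuous_on (Rsp (n+1)) f" "continuous_on (Rsp (n+1)) g" "y \<in> Rsp n"
    and "AE z in \<mu>' y. ext z \<in> cube (n+1) R" and "\<And>x. x \<in> cube (n+1) R \<Longrightarrow> \<bar>f x - g x\<bar> \<le> e"
  shows "\<bar>Vt f y - Vt g y\<bar> \<le> e"
  unfolding Vk_def
proof (rule prob_space.integral_diff_le[OF intertwining_measuresD(1)[OF \<mu>' assms(3)]])
  show "AE z in \<mu>' y. \<bar>f_lam n f lam z - f_lam n g lam z\<bar> \<le> e"
    using assms(4) by eventually_elim (use assms(5) in \<open>auto simp: f_lam_ext\<close>)
qed (use assms f_lam_integrable in auto)

text \<open>\<open>Vt f\<close> has to be measurable on the whole space: the product Borel measure is not complete, and the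
  closed box of the theorem has points with equal coordinates on its boundary, where \<open>Vt f\<close> is not
  controlled by the Dunkl equations.\<close>
definition good :: "((nat \<Rightarrow> real) \<Rightarrow> real) \<Rightarrow> bool" where
  "good f \<longleftrightarrow> continuous_on (Rsp (n+1)) f \<and> Vt f \<in> borel_measurable (Rmeas n) \<and>
     Vk \<mu> f lam = c_nk n k / vdm (n+1) lam powr (2 * k) * AA k lam (Vt f)"

text \<open>The constant is chosen before \<open>g\<close> and \<open>c\<close>: integrability uses
  it with a bound for f, the limit with the approximation error.\<close>

lemma Qf_alt_bound: "\<exists>B\<ge>0. \<forall>\<nu> g c. inbox \<nu> \<longrightarrow> (\<forall>w. w permutes {1..n} \<longrightarrow> \<bar>g (\<nu> \<circ> w)\<bar> \<le> c) \<longrightarrow>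
   \<bar>alt n (\<lambda>y. Qf n lam y * g y) \<nu>\<bar> \<le> B * c"
proof -
  let ?P = "{w. w permutes {1..n}}"
  obtain B where B: "B \<ge> 0" "\<And>x. (\<forall>i\<in>{1..n}. \<bar>x i\<bar> \<le> Rad) \<Longrightarrow> \<bar>Qf n lam x\<bar> \<le> B"
    using poly_fun_bounded[OF Qf_poly_fun, where R = Rad] by blast
  have "\<bar>alt n (\<lambda>y. Qf n lam y * g y) \<nu>\<bar> \<le> (card ?P * B) * c"
    if \<nu>: "inbox \<nu>" and g: "\<forall>w. w permutes {1..n} \<longrightarrow> \<bar>g (\<nu> \<circ> w)\<bar> \<le> c" for \<nu> g c
  proof -
    have "\<bar>alt n (\<lambda>y. Qf n lam y * g y) \<nu>\<bar> \<le> (\<Sum>w\<in>?P. \<bar>of_int (sign w) * (Qf n lam (\<nu> \<circ> w) * g (\<nu> \<circ> w))\<bar>)"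
      unfolding alt_def by (rule sum_abs)
    also have "\<dots> \<le> (\<Sum>w\<in>?P. B * c)"
    proof (rule sum_mono)
      fix w assume "w \<in> ?P"
      then have w: "w permutes {1..n}" by simp
      have "\<bar>(\<nu> \<circ> w) i\<bar> \<le> Rad" if "i \<in> {1..n}" for i
        using that permutes_in_image[OF w, of i] \<nu> cell_Rad[of "w i" "\<nu> (w i)"] by auto
      then have "\<bar>Qf n lam (\<nu> \<circ> w)\<bar> \<le> B" using B(2) by blast
      moreover have "\<bar>of_int (sign w) :: real\<bar> = 1" by (simp add: sign_def)
      ultimately show "\<bar>of_int (sign w) * (Qf n lam (\<nu> \<circ> w) * g (\<nu> \<circ> w))\<bar> \<le> B * c"
        unfolding abs_mult using g w B(1) by (simp add: mult_mono)
    qed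
    finally show ?thesis by simp
  qed
  then show ?thesis using B(1) by (intro exI[of _ "real (card ?P) * B"] conjI allI impI) auto
qed

lemma Vt_box_bound:
  assumes f: "continuous_on (Rsp (n+1)) f" and B: "\<And>x. x \<in> cube (n+1) Rb \<Longrightarrow> \<bar>f x\<bar> \<le> B"
    and \<nu>: "\<nu> \<in> Rsp n" "inbox \<nu>" and w: "w permutes {1..n}"
  shows "\<bar>Vt f (\<nu> \<circ> w)\<bar> \<le> B"
  using Vt_diff_le[OF f continuous_on_const Rsp_comp[OF \<nu>(1) w] \<mu>'_support_box[OF \<nu> w], of 0] B
  by (simp add: Vk_def f_lam_ext)

lemma good_integrable:
  assumes f: "continuous_on (Rsp (n+1)) f" and m: "Vt f \<in> borel_measurable (Rmeas n)"
  shows "integrable (Rmeas n) (\<lambda>\<nu>. wt (\<lambda>_. k) \<nu> * alt n (\<lambda>y. Qf n lam y * Vt f y) \<nu>)"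
proof -
  obtain B where B: "\<And>x. x \<in> cube (n+1) Rb \<Longrightarrow> \<bar>f x\<bar> \<le> B" using continuous_on_cube_bounded[OF f] by blast
  obtain Q where Q: "\<And>\<nu> g c. inbox \<nu> \<Longrightarrow> (\<forall>w. w permutes {1..n} \<longrightarrow> \<bar>g (\<nu> \<circ> w)\<bar> \<le> c) \<Longrightarrow> \<bar>alt n (\<lambda>y. Qf n lam y * g y) \<nu>\<bar> \<le> Q * c"
    using Qf_alt_bound by blast
  have am: "alt n (\<lambda>y. Qf n lam y * Vt f y) \<in> borel_measurable (Rmeas n)"
    using m poly_fun_measurable[OF Qf_poly_fun] by (intro alt_measurable borel_measurable_times)
  show ?thesis
  proof (rule Bochner_Integration.integrable_bound)
    show "integrable (Rmeas n) (\<lambda>\<nu>. (Q * B) * wt (\<lambda>_. k) \<nu>)"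
      using wt_integrable k by (intro integrable_mult_right) auto
    show "(\<lambda>\<nu>. wt (\<lambda>_. k) \<nu> * alt n (\<lambda>y. Qf n lam y * Vt f y) \<nu>) \<in> borel_measurable (Rmeas n)"
      using am wt_integrable[of "\<lambda>_. k"] k by (intro borel_measurable_times) auto
    show "AE \<nu> in Rmeas n. norm (wt (\<lambda>_. k) \<nu> * alt n (\<lambda>y. Qf n lam y * Vt f y) \<nu>) \<le> norm ((Q * B) * wt (\<lambda>_. k) \<nu>)"
    proof (rule AE_I2)
      fix \<nu> assume "\<nu> \<in> space (Rmeas n)"
      then have \<nu>: "\<nu> \<in> Rsp n" by (simp add: space_PiM)
      show "norm (wt (\<lambda>_. k) \<nu> * alt n (\<lambda>y. Qf n lam y * Vt f y) \<nu>) \<le> norm ((Q * B) * wt (\<lambda>_. k) \<nu>)"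
      proof (cases "inbox \<nu>")
        case True
        have "\<bar>alt n (\<lambda>y. Qf n lam y * Vt f y) \<nu>\<bar> \<le> Q * B"
          using Vt_box_bound[OF f B \<nu> True] by (intro Q[OF True]) blast
        then have "wt (\<lambda>_. k) \<nu> * \<bar>alt n (\<lambda>y. Qf n lam y * Vt f y) \<nu>\<bar> \<le> wt (\<lambda>_. k) \<nu> * (Q * B)"
          by (rule mult_left_mono[OF _ wt_nonneg])
        also have "\<dots> \<le> \<bar>(Q * B) * wt (\<lambda>_. k) \<nu>\<bar>" by (simp add: mult.commute)
        finally show ?thesis using wt_nonneg[of "\<lambda>_. k" \<nu>] by (simp only: real_norm_def abs_mult abs_of_nonneg)
      next
        case False
        then have "wt (\<lambda>_. k) \<nu> = 0" using wt_zero by blast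
        then show ?thesis by simp
      qed
    qed
  qed
qed

text \<open>Approximation is required on every cube because no common support radius is available
  for all points of the space, and measurability of \<open>Vt f\<close> concerns all of
  them.\<close>

lemma good_limit:
  assumes f: "continuous_on (Rsp (n+1)) f"
    and ap: "\<And>R e. e > 0 \<Longrightarrow> \<exists>g. good g \<and> (\<forall>x\<in>cube (n+1) R. \<bar>f x - g x\<bar> \<le> e)"
  shows "good f"
proof -
  let ?K = "c_nk n k / vdm (n+1) lam powr (2 * k)"
  \<comment> \<open>The cubes grow while the errors shrink, so one sequence serves every radius: a
    fixed cube lies in all sufficiently late ones.\<close>
  have "\<exists>g. good g \<and> (\<forall>x\<in>cube (n+1) (real i). \<bar>f x - g x\<bar> \<le> 1 / real (Suc i))" for i
    using ap by simp
  then obtain g where g: "\<And>i. good (g i)" "\<And>i x. x \<in> cube (n+1) (real i) \<Longrightarrow> \<bar>f x - g i x\<bar> \<le> 1 / real (Suc i)"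
    by metis
  have gc: "continuous_on (Rsp (n+1)) (g i)" and gm: "Vt (g i) \<in> borel_measurable (Rmeas n)"
    and gf: "Vk \<mu> (g i) lam = ?K * AA k lam (Vt (g i))" for i using g(1)[of i] unfolding good_def by auto
  have le: "\<forall>\<^sub>F i in sequentially. \<forall>x\<in>cube (n+1) R. \<bar>f x - g i x\<bar> \<le> 1 / real (Suc i)" for R
  proof -
    obtain N where "R \<le> real N" using real_arch_simple by blast
    then have "\<forall>i\<ge>N. \<forall>x\<in>cube (n+1) R. \<bar>f x - g i x\<bar> \<le> 1 / real (Suc i)"
      using g(2) cube_mono[of R _ "n+1"] by (meson of_nat_mono order.trans subsetD)
    then show ?thesis unfolding eventually_sequentially by blast
  qed
  have lim0: "X \<longlonglongrightarrow> L" if "\<forall>\<^sub>F i in sequentially. \<bar>L - X i\<bar> \<le> 1 / real (Suc i)" for X :: "nat \<Rightarrow> real" and L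
  proof -
    have "(\<lambda>i. X i - L) \<longlonglongrightarrow> 0"
      by (rule Lim_null_comparison[OF _ lim_1_over_real_power[of 1, simplified, THEN LIMSEQ_Suc]])
         (use that in \<open>auto elim!: eventually_mono simp: abs_minus_commute inverse_eq_divide\<close>)
    then show ?thesis by (simp add: LIM_zero_iff)
  qed
  have Vlim: "(\<lambda>i. Vt (g i) y) \<longlonglongrightarrow> Vt f y" if y: "y \<in> Rsp n" for y
  proof -
    obtain R where R: "AE z in \<mu>' y. ext z \<in> cube (n+1) R" using \<mu>'_support[OF y] by blast
    show ?thesis
      using le[of R] by (intro lim0, elim eventually_mono) (use Vt_diff_le[OF f gc y R] in blast)
  qed
  \<comment> \<open>Convergence holds at every point, with a radius depending on the point, so the
    limit is measurable without discarding a null set.\<close>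
  have fm: "Vt f \<in> borel_measurable (Rmeas n)"
    by (rule borel_measurable_LIMSEQ_real[OF Vlim gm]) (simp add: space_PiM)
  have L: "(\<lambda>i. Vk \<mu> (g i) lam) \<longlonglongrightarrow> Vk \<mu> f lam"
  proof -
    obtain R where R: "AE z in \<mu> lam. z \<in> cube (n+1) R" using \<mu>_support by blast
    have "\<bar>Vk \<mu> f lam - Vk \<mu> (g i) lam\<bar> \<le> e" if "\<forall>x\<in>cube (n+1) R. \<bar>f x - g i x\<bar> \<le> e" for i e
      unfolding Vk_def
    proof (rule prob_space.integral_diff_le[OF intertwining_measuresD(1)[OF \<mu> lam] f_integrable[OF f] f_integrable[OF gc]])
      show "AE z in \<mu> lam. \<bar>f z - g i z\<bar> \<le> e" using R by eventually_elim (use that in blast)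
    qed
    then show ?thesis using le[of R] by (intro lim0, elim eventually_mono) blast
  qed
  have "(\<lambda>i. AA k lam (Vt (g i))) \<longlonglongrightarrow> AA k lam (Vt f)"
  proof -
    obtain B where B: "\<And>x. x \<in> cube (n+1) Rb \<Longrightarrow> \<bar>f x\<bar> \<le> B" using continuous_on_cube_bounded[OF f] by blast
    obtain Q where Q0: "Q \<ge> 0" and Q: "\<And>\<nu> g c. inbox \<nu> \<Longrightarrow> (\<forall>w. w permutes {1..n} \<longrightarrow> \<bar>g (\<nu> \<circ> w)\<bar> \<le> c) \<Longrightarrow> \<bar>alt n (\<lambda>y. Qf n lam y * g y) \<nu>\<bar> \<le> Q * c"
      using Qf_alt_bound by blast
    let ?F = "\<lambda>f \<nu>. wt (\<lambda>_. k) \<nu> * alt n (\<lambda>y. Qf n lam y * Vt f y) \<nu>"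
    \<comment> \<open>Here the single radius \<open>Rb\<close> must serve all points of the box and
      all their rearrangements; this is where the uniform support bound enters.\<close>
    have "\<bar>AA k lam (Vt f) - AA k lam (Vt (g i))\<bar> \<le> (Q * (\<integral>\<nu>. wt (\<lambda>_. k) \<nu> \<partial>Rmeas n)) * (1 / real (Suc i))"
      if e: "\<forall>x\<in>cube (n+1) Rb. \<bar>f x - g i x\<bar> \<le> 1 / real (Suc i)" for i
    proof -
      have i1: "integrable (Rmeas n) (?F f)" "integrable (Rmeas n) (?F (g i))"
        using good_integrable f fm gc gm by blast+
      have "AA k lam (Vt f) - AA k lam (Vt (g i)) = (\<integral>\<nu>. ?F f \<nu> - ?F (g i) \<nu> \<partial>Rmeas n)"
        unfolding AA_def using i1 by (rule Bochner_Integration.integral_diff[symmetric])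
      then have "\<bar>AA k lam (Vt f) - AA k lam (Vt (g i))\<bar> \<le> (\<integral>\<nu>. \<bar>?F f \<nu> - ?F (g i) \<nu>\<bar> \<partial>Rmeas n)"
        by (simp only: integral_abs_bound)
      also have "\<dots> \<le> (\<integral>\<nu>. (Q * (1 / real (Suc i))) * wt (\<lambda>_. k) \<nu> \<partial>Rmeas n)"
      proof (rule integral_mono)
        show "integrable (Rmeas n) (\<lambda>\<nu>. \<bar>?F f \<nu> - ?F (g i) \<nu>\<bar>)"
          using i1 by (intro integrable_abs Bochner_Integration.integrable_diff)
        show "integrable (Rmeas n) (\<lambda>\<nu>. (Q * (1 / real (Suc i))) * wt (\<lambda>_. k) \<nu>)"
          using wt_integrable k by (intro integrable_mult_right) auto
        fix \<nu> assume "\<nu> \<in> space (Rmeas n)"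
        then have \<nu>: "\<nu> \<in> Rsp n" by (simp add: space_PiM)
        show "\<bar>?F f \<nu> - ?F (g i) \<nu>\<bar> \<le> (Q * (1 / real (Suc i))) * wt (\<lambda>_. k) \<nu>"
        proof (cases "inbox \<nu>")
          case True
          have "?F f \<nu> - ?F (g i) \<nu> = wt (\<lambda>_. k) \<nu> * alt n (\<lambda>y. Qf n lam y * (Vt f y - Vt (g i) y)) \<nu>"
            by (simp only: right_diff_distrib alt_diff)
          moreover have "\<bar>alt n (\<lambda>y. Qf n lam y * (Vt f y - Vt (g i) y)) \<nu>\<bar> \<le> Q * (1 / real (Suc i))"
          proof (rule Q[OF True], intro allI impI)
            fix w assume w: "w permutes {1..n}"
            show "\<bar>Vt f (\<nu> \<circ> w) - Vt (g i) (\<nu> \<circ> w)\<bar> \<le> 1 / real (Suc i)"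
              using Vt_diff_le[OF f gc Rsp_comp[OF \<nu> w] \<mu>'_support_box[OF \<nu> True w]] e by blast
          qed
          ultimately show ?thesis using wt_nonneg[of "\<lambda>_. k" \<nu>]
            by (simp only: abs_mult abs_of_nonneg mult.commute[of "wt (\<lambda>_. k) \<nu>"] mult_right_mono)
        next
          case False
          then have "wt (\<lambda>_. k) \<nu> = 0" using wt_zero by blast
          then show ?thesis by simp
        qed
      qed
      also have "\<dots> = (Q * (\<integral>\<nu>. wt (\<lambda>_. k) \<nu> \<partial>Rmeas n)) * (1 / real (Suc i))" by simp
      finally show ?thesis .
    qed
    then have "\<forall>\<^sub>F i in sequentially. norm (AA k lam (Vt (g i)) - AA k lam (Vt f)) \<le> (Q * (\<integral>\<nu>. wt (\<lambda>_. k) \<nu> \<partial>Rmeas n)) * (1 / real (Suc i))"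
      using le[of Rb] by (elim eventually_mono) (simp add: abs_minus_commute)
    moreover have "(\<lambda>i. (Q * (\<integral>\<nu>. wt (\<lambda>_. k) \<nu> \<partial>Rmeas n)) * (1 / real (Suc i))) \<longlonglongrightarrow> 0"
      using tendsto_mult_right_zero[OF lim0[of 0 "\<lambda>i. 1 / real (Suc i)"]] by simp
    ultimately have "(\<lambda>i. AA k lam (Vt (g i)) - AA k lam (Vt f)) \<longlonglongrightarrow> 0"
      by (rule Lim_null_comparison)
    then show ?thesis by (simp add: LIM_zero_iff)
  qed
  then have "(\<lambda>i. Vk \<mu> (g i) lam) \<longlonglongrightarrow> ?K * AA k lam (Vt f)"
    unfolding gf by (rule tendsto_mult_left)
  then have "Vk \<mu> f lam = ?K * AA k lam (Vt f)" using L LIMSEQ_unique by blast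
  then show ?thesis unfolding good_def using f fm by blast
qed

lemma good_lincomb:
  assumes f: "good f" and g: "good g"
  shows "good (\<lambda>x. u * f x + v * g x)"
proof -
  let ?h = "\<lambda>x. u * f x + v * g x"
  let ?K = "c_nk n k / vdm (n+1) lam powr (2 * k)"
  have c: "continuous_on (Rsp (n+1)) f" "continuous_on (Rsp (n+1)) g"
    and m: "Vt f \<in> borel_measurable (Rmeas n)" "Vt g \<in> borel_measurable (Rmeas n)"
    and e: "Vk \<mu> f lam = ?K * AA k lam (Vt f)" "Vk \<mu> g lam = ?K * AA k lam (Vt g)"
    using f g unfolding good_def by auto
  have ch: "continuous_on (Rsp (n+1)) ?h" using c by (intro continuous_intros)
  have V: "Vt ?h y = u * Vt f y + v * Vt g y" if y: "y \<in> Rsp n" for y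
    using f_lam_integrable[OF c(1) y] f_lam_integrable[OF c(2) y] unfolding Vk_def f_lam_ext by simp
  have "(\<lambda>y. u * Vt f y + v * Vt g y) \<in> borel_measurable (Rmeas n)" using m by measurable
  then have hm: "Vt ?h \<in> borel_measurable (Rmeas n)"
    by (rule measurable_cong[THEN iffD2, rotated]) (use V in \<open>simp add: space_PiM\<close>)
  have "AA k lam (Vt ?h) = AA k lam (\<lambda>y. u * Vt f y + v * Vt g y)" using V by (rule AA_cong)
  also have "\<dots> = (\<integral>\<nu>. u * (wt (\<lambda>_. k) \<nu> * alt n (\<lambda>y. Qf n lam y * Vt f y) \<nu>) + v * (wt (\<lambda>_. k) \<nu> * alt n (\<lambda>y. Qf n lam y * Vt g y) \<nu>) \<partial>Rmeas n)"
  proof -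
    have eq: "alt n (\<lambda>y. Qf n lam y * (u * Vt f y + v * Vt g y)) \<nu> = u * alt n (\<lambda>y. Qf n lam y * Vt f y) \<nu> + v * alt n (\<lambda>y. Qf n lam y * Vt g y) \<nu>" for \<nu>
      unfolding alt_cmult[symmetric] alt_add[symmetric] by (simp only: distrib_left mult_ac)
    show ?thesis unfolding AA_def eq by (simp only: distrib_left mult_ac)
  qed
  also have "\<dots> = u * AA k lam (Vt f) + v * AA k lam (Vt g)"
    unfolding AA_def using good_integrable[OF c(1) m(1)] good_integrable[OF c(2) m(2)] by simp
  finally have A: "AA k lam (Vt ?h) = u * AA k lam (Vt f) + v * AA k lam (Vt g)" .
  have "Vk \<mu> ?h lam = u * Vk \<mu> f lam + v * Vk \<mu> g lam"
    unfolding Vk_def using f_integrable[OF c(1)] f_integrable[OF c(2)] by simp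
  also have "\<dots> = ?K * AA k lam (Vt ?h)" unfolding A e by (simp only: distrib_left mult_ac)
  finally show ?thesis unfolding good_def using ch hm by blast
qed

lemma good_power: "good (\<lambda>x. lin (n+1) a x ^ d)"
proof -
  have V: "Vt (\<lambda>x. lin (n+1) a x ^ d) = (\<lambda>y. \<integral>z. (lin n (\<lambda>s. a s - a (n+1)) z + a (n+1) * (\<Sum>l\<in>{1..n+1}. lam l)) ^ d \<partial>\<mu>' y)"
    unfolding Vk_def f_lam_ext lin_ext ..
  have "continuous_on (Rsp (n+1)) (\<lambda>x. lin (n+1) a x ^ d)" by (intro continuous_intros)
  moreover have "Vk \<mu> (\<lambda>x. lin (n+1) a x ^ d) lam = mom \<mu> (n+1) a d lam" by (simp add: Vk_def mom_def)
  ultimately show ?thesis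
    unfolding good_def V using binomial_integral_measurable[OF \<mu>'] power_formula[OF k \<mu> \<mu>' lam] by simp
qed

text \<open>The exponential series converges uniformly on an interval containing the values of the
  linear form on a cube, and its partial sums are combinations of powers already handled.\<close>

lemma good_exp: "good (\<lambda>x. exp (lin (n+1) a x))"
proof (rule good_limit)
  show "continuous_on (Rsp (n+1)) (\<lambda>x. exp (lin (n+1) a x))" by (intro continuous_intros)
  fix R e :: real assume e: "e > 0"
  obtain B where B: "\<And>x. x \<in> cube (n+1) R \<Longrightarrow> \<bar>lin (n+1) a x\<bar> \<le> B"
    using continuous_on_cube_bounded[OF continuous_on_lin] by blast
  have ul: "uniform_limit (cball (0::real) B) (\<lambda>N t. \<Sum>d<N. t ^ d /\<^sub>R fact d) (\<lambda>t. \<Sum>d. t ^ d /\<^sub>R fact d) sequentially"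
  proof (rule Weierstrass_m_test)
    show "summable (\<lambda>d. B ^ d /\<^sub>R fact d)" by (rule summable_exp_generic)
    show "norm (t ^ d /\<^sub>R fact d) \<le> B ^ d /\<^sub>R fact d" if "t \<in> cball 0 B" for d and t :: real
      using power_mono[of "norm t" B d] that by (simp add: abs_mult power_abs)
  qed
  have "\<forall>\<^sub>F N in sequentially. \<forall>t\<in>cball (0::real) B. dist (\<Sum>d<N. t ^ d /\<^sub>R fact d) (exp t) < e"
    unfolding exp_def by (rule uniform_limitD[OF ul e])
  then obtain N where N: "\<And>t. t \<in> cball (0::real) B \<Longrightarrow> dist (\<Sum>d<N. t ^ d /\<^sub>R fact d) (exp t) < e"
    unfolding eventually_sequentially by blast
  have gs: "good (\<lambda>x. \<Sum>d<N. c d * lin (n+1) a x ^ d)" for N and c :: "nat \<Rightarrow> real"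
  proof (induction N)
    case 0
    show ?case using good_lincomb[OF good_power[of a 0] good_power[of a 0], of 0 0] by simp
  next
    case (Suc N)
    show ?case using good_lincomb[OF Suc good_power[of a N], of 1 "c N"] by simp
  qed
  show "\<exists>g. good g \<and> (\<forall>x\<in>cube (n+1) R. \<bar>exp (lin (n+1) a x) - g x\<bar> \<le> e)"
  proof (intro exI conjI ballI)
    show "good (\<lambda>x. \<Sum>d<N. (1 / fact d) * lin (n+1) a x ^ d)" by (rule gs)
    fix x assume "x \<in> cube (n+1) R"
    then have "dist (\<Sum>d<N. lin (n+1) a x ^ d /\<^sub>R fact d) (exp (lin (n+1) a x)) < e"
      using B by (intro N) simp
    then show "\<bar>exp (lin (n+1) a x) - (\<Sum>d<N. (1 / fact d) * lin (n+1) a x ^ d)\<bar> \<le> e"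
      by (simp add: dist_real_def abs_minus_commute divide_inverse)
  qed
qed

lemma good_exp_span: "f \<in> exp_span (n+1) \<Longrightarrow> good f"
proof (induction rule: exp_span.induct)
  case (span_term c a)
  show ?case using good_lincomb[OF good_exp[of a] good_exp[of a], of c 0] by simp
next
  case (span_add f g)
  show ?case using good_lincomb[OF span_add.IH, of 1 1] by simp
qed

lemma good_continuous:
  assumes "continuous_on (Rsp (n+1)) f"
  shows "good f"
  using assms
proof (rule good_limit)
  fix R e :: real assume "e > 0"
  then obtain g where "g \<in> exp_span (n+1)" "\<forall>x\<in>cube (n+1) R. \<bar>f x - g x\<bar> < e"
    using exp_span_dense[OF assms] by blast
  then show "\<exists>g. good g \<and> (\<forall>x\<in>cube (n+1) R. \<bar>f x - g x\<bar> \<le> e)"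
    using good_exp_span by (intro exI[of _ g]) (auto intro: less_imp_le)
qed

text \<open>The differences in \<open>Wf\<close> are ordered so as to be positive at interlacing
  points. There absolute values may be inserted, and the power is distributed over the
  factors.\<close>

lemma Wf_eq_wt:
  assumes \<nu>: "inbox \<nu>"
  shows "Wf n k lam \<nu> = wt (\<lambda>_. k) \<nu>"
proof -
  have "(\<Prod>s\<in>{r..n}. lam r - \<nu> s) * (\<Prod>s\<in>{1..r-1}. \<nu> s - lam r) = (\<Prod>s\<in>{1..n}. \<bar>\<nu> s - lam r\<bar>)" if r: "r \<in> {1..n+1}" for r
  proof -
    have "(\<Prod>s\<in>{r..n}. lam r - \<nu> s) = (\<Prod>s\<in>{r..n}. \<bar>\<nu> s - lam r\<bar>)"
    proof (rule prod.cong[OF refl])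
      fix s assume s: "s \<in> {r..n}"
      then have "s \<in> {1..n}" using r by auto
      then have "\<nu> s < lam r" using cell_cases(1)[of s "\<nu> s" r] \<nu> r s by auto
      then show "lam r - \<nu> s = \<bar>\<nu> s - lam r\<bar>" by simp
    qed
    moreover have "(\<Prod>s\<in>{1..r-1}. \<nu> s - lam r) = (\<Prod>s\<in>{1..r-1}. \<bar>\<nu> s - lam r\<bar>)"
    proof (rule prod.cong[OF refl])
      fix s assume s: "s \<in> {1..r-1}"
      then have "s \<in> {1..n}" using r by auto
      then have "lam r < \<nu> s" using cell_cases(2)[of s "\<nu> s" r] \<nu> r s by auto
      then show "\<nu> s - lam r = \<bar>\<nu> s - lam r\<bar>" by simp
    qed
    moreover have "{1..n} = {r..n} \<union> {1..r-1}" using r by auto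
    moreover have "(\<Prod>s\<in>{r..n} \<union> {1..r-1}. \<bar>\<nu> s - lam r\<bar>) = (\<Prod>s\<in>{r..n}. \<bar>\<nu> s - lam r\<bar>) * (\<Prod>s\<in>{1..r-1}. \<bar>\<nu> s - lam r\<bar>)"
      using r by (intro prod.union_disjoint) auto
    ultimately show ?thesis by simp
  qed
  then have "(\<Prod>r\<in>{1..n+1}. (\<Prod>s\<in>{r..n}. lam r - \<nu> s) * (\<Prod>s\<in>{1..r-1}. \<nu> s - lam r)) = (\<Prod>r\<in>{1..n+1}. \<Prod>s\<in>{1..n}. \<bar>\<nu> s - lam r\<bar>)"
    by (rule prod.cong[OF refl])
  then have "Wf n k lam \<nu> = (\<Prod>r\<in>{1..n+1}. \<Prod>s\<in>{1..n}. \<bar>\<nu> s - lam r\<bar>) powr (k - 1)"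
    unfolding Wf_def by (simp only:)
  also have "\<dots> = (\<Prod>r\<in>{1..n+1}. \<Prod>s\<in>{1..n}. \<bar>\<nu> s - lam r\<bar> powr (k - 1))"
    by (simp only: prod_powr_distrib)
  also have "\<dots> = (\<Prod>s\<in>{1..n}. \<Prod>r\<in>{1..n+1}. \<bar>\<nu> s - lam r\<bar> powr (k - 1))"
    by (rule prod.swap)
  also have "\<dots> = wt (\<lambda>_. k) \<nu>"
    unfolding wt_def wt1_def using \<nu> by (intro prod.cong refl) auto
  finally show ?thesis .
qed

text \<open>The closed box and the product of open cells differ only where some coordinate equals a
  node, which is a null set; elsewhere the two integrands agree.\<close>

lemma box_integral_eq:
  assumes f: "continuous_on (Rsp (n+1)) f"
  shows "(\<integral>\<nu>\<in>box_dom n lam. (\<Sum>w | w permutes {1..n}. of_int (sign w) * Qf n lam (\<nu> \<circ> w) * Vt f (\<nu> \<circ> w)) * Wf n k lam \<nu> \<partial>Rmeas n)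
     = AA k lam (Vt f)"
proof -
  have m: "Vt f \<in> borel_measurable (Rmeas n)" using good_continuous[OF f] unfolding good_def by blast
  have am: "alt n (\<lambda>y. Qf n lam y * Vt f y) \<in> borel_measurable (Rmeas n)"
    using m poly_fun_measurable[OF Qf_poly_fun] by (intro alt_measurable borel_measurable_times)
  have alt: "(\<Sum>w | w permutes {1..n}. of_int (sign w) * Qf n lam (\<nu> \<circ> w) * Vt f (\<nu> \<circ> w)) = alt n (\<lambda>y. Qf n lam y * Vt f y) \<nu>" for \<nu>
    unfolding alt_def by (simp only: mult.assoc)
  have box: "box_dom n lam = PiE {1..n} (\<lambda>i. {lam (i+1)..lam i})"
    unfolding box_dom_def by (auto simp: PiE_def Pi_def)
  have bm: "box_dom n lam \<in> sets (Rmeas n)"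
    unfolding box by (intro sets_PiM_I_finite) auto
  have Wm: "Wf n k lam \<in> borel_measurable (Rmeas n)"
  proof -
    have "(\<lambda>\<nu>. \<Prod>r\<in>{1..n+1}. (\<Prod>s\<in>{r..n}. lam r - \<nu> s) * (\<Prod>s\<in>{1..r-1}. \<nu> s - lam r)) \<in> poly_fun n"
      by (intro poly_fun_prod poly_fun.pmult poly_fun_diff poly_fun.pvar poly_fun.pconst) auto
    note poly_fun_measurable[OF this, measurable]
    show ?thesis unfolding Wf_def[abs_def] by measurable
  qed
  show ?thesis
    unfolding set_lebesgue_integral_def AA_def alt real_scaleR_def
  proof (rule integral_cong_AE)
    show "(\<lambda>\<nu>. indicator (box_dom n lam) \<nu> * (alt n (\<lambda>y. Qf n lam y * Vt f y) \<nu> * Wf n k lam \<nu>)) \<in> borel_measurable (Rmeas n)"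
      using am bm Wm by (intro borel_measurable_times borel_measurable_indicator)
    show "(\<lambda>\<nu>. wt (\<lambda>_. k) \<nu> * alt n (\<lambda>y. Qf n lam y * Vt f y) \<nu>) \<in> borel_measurable (Rmeas n)"
      using good_integrable[OF f m] by (rule borel_measurable_integrable)
    have "AE \<nu> in Rmeas n. \<forall>i\<in>{1..n}. \<nu> i \<noteq> lam i" "AE \<nu> in Rmeas n. \<forall>i\<in>{1..n}. \<nu> i \<noteq> lam (i+1)"
      using AE_coordinate_neq by (intro AE_finite_allI; simp)+
    moreover have "AE \<nu> in Rmeas n. \<nu> \<in> Rsp n" using AE_space[of "Rmeas n"] by (simp add: space_PiM)
    ultimately show "AE \<nu> in Rmeas n. indicator (box_dom n lam) \<nu> * (alt n (\<lambda>y. Qf n lam y * Vt f y) \<nu> * Wf n k lam \<nu>) = wt (\<lambda>_. k) \<nu> * alt n (\<lambda>y. Qf n lam y * Vt f y) \<nu>"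
    proof eventually_elim
      case (elim \<nu>)
      show ?case
      proof (cases "inbox \<nu>")
        case True
        then have "\<nu> \<in> box_dom n lam" using elim(3) unfolding box_dom_def cell_def by (auto intro: less_imp_le)
        then show ?thesis using Wf_eq_wt[OF True] by simp
      next
        case False
        then obtain i where i: "i \<in> {1..n}" "\<nu> i \<notin> cell i" by blast
        have "\<nu> i \<noteq> lam i" "\<nu> i \<noteq> lam (i + 1)" using elim(1,2) i(1) by blast+
        then have "\<not> (lam (i + 1) \<le> \<nu> i \<and> \<nu> i \<le> lam i)" using i(2) unfolding cell_def by auto
        then have "\<nu> \<notin> box_dom n lam" using i(1) unfolding box_dom_def by blast
        moreover have "wt (\<lambda>_. k) \<nu> = 0" using i by (rule wt_zero)
        ultimately show ?thesis by simp
      qed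
    qed
  qed
qed

end

theorem theorem4p2:
  fixes n :: nat and k :: real and f :: "(nat \<Rightarrow> real) \<Rightarrow> real"
    and \<mu> \<mu>' :: "(nat \<Rightarrow> real) \<Rightarrow> (nat \<Rightarrow> real) measure" and lam :: "nat \<Rightarrow> real"
  assumes "n \<ge> 1" and "k > 0"
    and "smooth_coords (n + 1) f"
    and "intertwining_measures (n + 1) k \<mu>"
    and "intertwining_measures n k \<mu>'"
    and "lam \<in> Rsp (n + 1)" and "\<forall>i\<in>{1..n}. lam (i + 1) < lam i"
  shows "Vk \<mu> f lam =
    c_nk n k / pi_A n lam powr (2 * k) *
    (\<integral>\<nu>\<in>box_dom n lam.
       (\<Sum>w | w permutes {1..n}.
          of_int (sign w) * Qf n lam (\<nu> \<circ> w) * Vk \<mu>' (f_lam n f lam) (\<nu> \<circ> w))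
       * Wf n k lam \<nu> \<partial>Rmeas n)"
proof -
  interpret intertwined_chamber n lam k \<mu> \<mu>'
    using assms by unfold_locales auto
  have f: "continuous_on (Rsp (n+1)) f"
    using assms(3) unfolding smooth_coords_def by (metis empty_subsetI iter_pd.simps(1) list.set(1))
  show ?thesis
    unfolding box_integral_eq[OF f] pi_A_eq_vdm
    using good_continuous[OF f] unfolding good_def by blast
qed

end
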